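(* Let $\mathcal{C}$ be a category, $P\in Pro\,\mathcal{C}$ a pro-object, and $F=[P,-]:\mathcal{C}\to\mathcal{E}ns$ the corresponding prorepresentable functor. Assume: (i) every arrow $Y\to X$ in $\mathcal{C}$ is a strict epimorphism; (ii) for every $X\in\mathcal{C}$ there exists $P\to X$, that is, $FX\neq\emptyset$; (iii) $F$ preserves strict epimorphisms. Then for every object $X\in\mathcal{C}$ the action of the localic group of automorphisms $lAut(P)^{op}=lAut(F)$ on the set $[P,X]=FX$ is transitive; that is, for all $x_0,x_1\in FX$, $\#[(X,<\!x_0\,|\,x_1\!>)]\neq 0$ in $lAut(F)$.
   Context: $\mathcal{E}ns$ is the category of sets. $[P,-]$ is the filtered colimit of the representables defining the pro-object $P$; arrows $P\to X$ are elements of $FX$. Prorepresentability of $F$ means that its diagram $\Gamma_F$ (objects: pairs $(x,X)$ with $x\in FX$; arrows $(x,X)\to(y,Y)$: arrows $f:X\to Y$ with $F(f)(x)=y$) is cofiltered. An arrow $f:X\to Y$ is a strict epimorphism if for every $g:X\to Z$ such that for all $s,t:C\to X$, $fs=ft$ implies $gs=gt$, there is a unique $h:Y\to Z$ with $g=hf$. A locale is a complete lattice in which finite infima distribute over arbitrary suprema; morphisms preserve finite infima and arbitrary suprema. Localic spaces are the formal duals: a continuous map $f:H\to E$ is a morphism of locales $f^{*}:E\to H$; $\otimes$ is the coproduct of locales. A localic group is a group object in localic spaces, with multiplication $m^{*}:G\to G\otimes G$. Definition of $lAut(F)$. Let $D_{\Delta F}$ be the preordered set with elements $(X,(x_0,x_1))$,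 $X\in\mathcal{C}$, $x_0,x_1\in FX$, where $(X,(x_0,x_1))\le(Y,(y_0,y_1))$ iff there is $f:X\to Y$ with $F(f)(x_0)=y_0$, $F(f)(x_1)=y_1$. Let $\mathcal{D}(D_{\Delta F})$ be the free inf-lattice on it: its objects $[A]$ are given by finite subsets $A\subset D_{\Delta F}$, with $[A]\le[B]$ iff for every $b\in B$ there is $a\in A$ with $a\le b$; $[A]\wedge[B]=[A\cup B]$, $1=[\emptyset]$; the object of the singleton $\{(X,(x_0,x_1))\}$ is written $[(X,<\!x_0|x_1\!>)]$. Basic covers, for each $X$ and $z\in FX$: the empty family covers $[(X,<\!z|x\!>),(X,<\!z|y\!>)]$ and $[(X,<\!x|z\!>),(X,<\!y|z\!>)]$ for $x\ne y$ in $FX$; the families $\{[(X,<\!x|z\!>)]\}_{x\in FX}$ and $\{[(X,<\!z|x\!>)]\}_{x\in FX}$ cover $1$. The covers are those of the (pre)topology generated (closing under isomorphisms, pullback i.e. infimum with an object, and composition). $lAut(F)$ is the locale of sheaves, i.e. of downward closed subsets $T$ such that for each cover $u_\alpha\to u$, if all $u_\alpha\in T$ then $u\in T$; $\#:\mathcal{D}(D_{\Delta F})\to lAut(F)$ is the associated sheaf map, sending an object to the smallest sheaf containing it. It is a localic group with $m^{*}\#[(X,<\!x|y\!>)]=\bigvee_{z}\#[(X,<\!x|z\!>)]\otimes\#[(X,<\!z|y\!>)]$ and neutral element $e^{*}\#[(X,<\!x|y\!>)]=1\Leftrightarrow x=y$. $lAut(P)$ is the same locale with opposite multiplication. Action.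 For a set $S$, $lAut(S)$ is the localic group given by the same construction with generators $[<\!x|y\!>]$, $x,y\in S$ (site: finite subsets of $S\times S$ ordered by reverse inclusion, same basic covers omitting $X$). An action of a localic group $G$ on $S$ is a morphism of localic groups $\mu:G\to lAut(S)$; it is transitive if $\mu^{*}[<\!x|y\!>]\ne0$ for all $x,y\in S$. $lAut(F)$ acts on $FX$ by $\mu^{*}[<\!x_0|x_1\!>]=\#[(X,<\!x_0|x_1\!>)]$. *)

theory Defs
  imports "HOL-Algebra.Complete_Lattice"
begin

section \<open>Categories\<close>

text \<open>
  \<open>comp C g f\<close> is the composite of \<open>f : X \<rightarrow> Y\<close> followed by \<open>g : Y \<rightarrow> Z\<close>; its value is
  unspecified unless \<open>cod f = dom g\<close>.
\<close>

record ('o, 'm) cat =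
  obj :: "'o set"
  arr :: "'m set"
  dom :: "'m \<Rightarrow> 'o"
  cod :: "'m \<Rightarrow> 'o"
  ident :: "'o \<Rightarrow> 'm"
  comp :: "'m \<Rightarrow> 'm \<Rightarrow> 'm"

definition homset :: "('o, 'm) cat \<Rightarrow> 'o \<Rightarrow> 'o \<Rightarrow> 'm set" where
  "homset C X Y = {f \<in> arr C. dom C f = X \<and> cod C f = Y}"

locale category =
  fixes C :: "('o, 'm) cat"
  assumes dom_obj: "f \<in> arr C \<Longrightarrow> dom C f \<in> obj C"
    and cod_obj: "f \<in> arr C \<Longrightarrow> cod C f \<in> obj C"
    and ident_hom: "X \<in> obj C \<Longrightarrow> ident C X \<in> homset C X X"
    and comp_hom: "f \<in> homset C X Y \<Longrightarrow> g \<in> homset C Y Z \<Longrightarrow> comp C g f \<in> homset C X Z"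
    and comp_ident_right: "f \<in> homset C X Y \<Longrightarrow> comp C f (ident C X) = f"
    and comp_ident_left: "f \<in> homset C X Y \<Longrightarrow> comp C (ident C Y) f = f"
    and comp_assoc: "f \<in> homset C W X \<Longrightarrow> g \<in> homset C X Y \<Longrightarrow> h \<in> homset C Y Z \<Longrightarrow>
      comp C h (comp C g f) = comp C (comp C h g) f"

definition strict_epi :: "('o, 'm) cat \<Rightarrow> 'm \<Rightarrow> bool" where
  "strict_epi C f \<longleftrightarrow> f \<in> arr C \<and>
    (\<forall>Z \<in> obj C. \<forall>g \<in> homset C (dom C f) Z.
      (\<forall>D \<in> obj C. \<forall>s \<in> homset C D (dom C f). \<forall>t \<in> homset C D (dom C f).
        comp C f s = comp C f t \<longrightarrow> comp C g s = comp C g t) \<longrightarrow>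
      (\<exists>!h. h \<in> homset C (cod C f) Z \<and> g = comp C h f))"

record ('o, 'm, 'p, 'q) functr =
  on_obj :: "'o \<Rightarrow> 'p"
  on_arr :: "'m \<Rightarrow> 'q"

definition is_functor :: "('o, 'm) cat \<Rightarrow> ('p, 'q) cat \<Rightarrow> ('o, 'm, 'p, 'q) functr \<Rightarrow> bool" where
  "is_functor C D F \<longleftrightarrow> category C \<and> category D \<and>
    (\<forall>X \<in> obj C. on_obj F X \<in> obj D) \<and>
    (\<forall>X \<in> obj C. \<forall>Y \<in> obj C. \<forall>f \<in> homset C X Y.
      on_arr F f \<in> homset D (on_obj F X) (on_obj F Y)) \<and>
    (\<forall>X \<in> obj C. on_arr F (ident C X) = ident D (on_obj F X)) \<and>
    (\<forall>X \<in> obj C. \<forall>Y \<in> obj C. \<forall>Z \<in> obj C. \<forall>f \<in> homset C X Y. \<forall>g \<in> homset C Y Z.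
      on_arr F (comp C g f) = comp D (on_arr F g) (on_arr F f))"

definition preserves_strict_epis ::
    "('o, 'm) cat \<Rightarrow> ('p, 'q) cat \<Rightarrow> ('o, 'm, 'p, 'q) functr \<Rightarrow> bool" where
  "preserves_strict_epis C D F \<longleftrightarrow> (\<forall>f. strict_epi C f \<longrightarrow> strict_epi D (on_arr F f))"


section \<open>The category of sets\<close>

text \<open>
  The universe of sets is the collection of all subsets of a type \<open>'u\<close>. An arrow is a triple
  \<open>(A, f, B)\<close> with \<open>f\<close> extensional on \<open>A\<close>.
\<close>

type_synonym 'u fn = "'u set \<times> ('u \<Rightarrow> 'u) \<times> 'u set"

definition Ens :: "('u set, 'u fn) cat" where
  "Ens = \<lparr>obj = UNIV,
    arr = {(A, f, B). f \<in> A \<rightarrow>\<^sub>E B},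
    dom = (\<lambda>(A, f, B). A),
    cod = (\<lambda>(A, f, B). B),
    ident = (\<lambda>A. (A, restrict id A, A)),
    comp = (\<lambda>(B, g, Z) (A, f, B'). (A, compose A g f, Z))\<rparr>"

definition apply_fn :: "'u fn \<Rightarrow> 'u \<Rightarrow> 'u" where
  "apply_fn a x = fst (snd a) x"


section \<open>Pro-objects and prorepresentable functors\<close>

definition cofiltered :: "('i, 'j) cat \<Rightarrow> bool" where
  "cofiltered I \<longleftrightarrow> category I \<and> obj I \<noteq> {} \<and>
    (\<forall>i \<in> obj I. \<forall>j \<in> obj I. \<exists>k \<in> obj I. homset I k i \<noteq> {} \<and> homset I k j \<noteq> {}) \<and>
    (\<forall>i \<in> obj I. \<forall>j \<in> obj I. \<forall>u \<in> homset I i j. \<forall>v \<in> homset I i j.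
      \<exists>k \<in> obj I. \<exists>w \<in> homset I k i. comp I u w = comp I v w)"

record ('i, 'j, 'o, 'm) pro =
  index :: "('i, 'j) cat"
  diagram :: "('i, 'j, 'o, 'm) functr"

definition pro_object :: "('o, 'm) cat \<Rightarrow> ('i, 'j, 'o, 'm) pro \<Rightarrow> bool" where
  "pro_object C P \<longleftrightarrow> cofiltered (index P) \<and> is_functor (index P) C (diagram P)"

text \<open>
  \<open>[P, X]\<close> is the filtered colimit of the sets \<open>homset C P\<^sub>i X\<close>: the quotient of their disjoint
  union that identifies \<open>(i, f)\<close> and \<open>(j, g)\<close> when they become equal at some common \<open>k\<close>.
\<close>

definition germs :: "('o, 'm) cat \<Rightarrow> ('i, 'j, 'o, 'm) pro \<Rightarrow> 'o \<Rightarrow> ('i \<times> 'm) set" where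
  "germs C P X = {(i, f). i \<in> obj (index P) \<and> f \<in> homset C (on_obj (diagram P) i) X}"

definition germ_rel ::
    "('o, 'm) cat \<Rightarrow> ('i, 'j, 'o, 'm) pro \<Rightarrow> 'o \<Rightarrow> (('i \<times> 'm) \<times> ('i \<times> 'm)) set" where
  "germ_rel C P X = {((i, f), (j, g)). (i, f) \<in> germs C P X \<and> (j, g) \<in> germs C P X \<and>
    (\<exists>k \<in> obj (index P). \<exists>u \<in> homset (index P) k i. \<exists>v \<in> homset (index P) k j.
      comp C f (on_arr (diagram P) u) = comp C g (on_arr (diagram P) v))}"

definition pro_hom :: "('o, 'm) cat \<Rightarrow> ('i, 'j, 'o, 'm) pro \<Rightarrow> 'o \<Rightarrow> ('i \<times> 'm) set set" where
  "pro_hom C P X = germs C P X // germ_rel C P X"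

text \<open>Post-composition with \<open>f : X \<rightarrow> Y\<close>, sending the class of \<open>(i, g)\<close> to that of \<open>(i, f g)\<close>.\<close>

definition pro_hom_map ::
    "('o, 'm) cat \<Rightarrow> ('i, 'j, 'o, 'm) pro \<Rightarrow> 'm \<Rightarrow> ('i \<times> 'm) set \<Rightarrow> ('i \<times> 'm) set" where
  "pro_hom_map C P f = restrict
    (\<lambda>x. \<Union>(i, g) \<in> x. germ_rel C P (cod C f) `` {(i, comp C f g)}) (pro_hom C P (dom C f))"

definition hom_functor ::
    "('o, 'm) cat \<Rightarrow> ('i, 'j, 'o, 'm) pro \<Rightarrow> ('o, 'm, ('i \<times> 'm) set set, ('i \<times> 'm) set fn) functr"
  where
  "hom_functor C P = \<lparr>on_obj = pro_hom C P,
    on_arr = (\<lambda>f. (pro_hom C P (dom C f), pro_hom_map C P f, pro_hom C P (cod C f)))\<rparr>"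


section \<open>Locales and localic groups\<close>

locale localic = complete_lattice L for L (structure) +
  assumes meet_sup: "a \<in> carrier L \<Longrightarrow> B \<subseteq> carrier L \<Longrightarrow> a \<sqinter> \<Squnion>B = \<Squnion>((\<lambda>b. a \<sqinter> b) ` B)"

text \<open>Arrows of locales point in the algebraic direction, so these are the inverse images \<open>f\<^sup>*\<close>.\<close>

definition locale_hom :: "('a, 'x) gorder_scheme \<Rightarrow> ('b, 'y) gorder_scheme \<Rightarrow> ('a \<Rightarrow> 'b) \<Rightarrow> bool"
  where
  "locale_hom L M f \<longleftrightarrow> f \<in> carrier L \<rightarrow> carrier M \<and>
    f \<top>\<^bsub>L\<^esub> = \<top>\<^bsub>M\<^esub> \<and>
    (\<forall>a \<in> carrier L. \<forall>b \<in> carrier L. f (a \<sqinter>\<^bsub>L\<^esub> b) = f a \<sqinter>\<^bsub>M\<^esub> f b) \<and>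
    (\<forall>B. B \<subseteq> carrier L \<longrightarrow> f (\<Squnion>\<^bsub>L\<^esub>B) = \<Squnion>\<^bsub>M\<^esub>(f ` B))"

definition inclusion_order :: "'a set set \<Rightarrow> 'a set gorder" where
  "inclusion_order \<X> = \<lparr>carrier = \<X>, eq = (=), le = (\<subseteq>)\<rparr>"

definition two :: "bool gorder" where
  "two = \<lparr>carrier = UNIV, eq = (=), le = (\<le>)\<rparr>"

text \<open>
  The coproduct \<open>L \<otimes> M\<close>, realised by the sets of pairs that are downward closed and closed under
  suprema in each variable separately; \<open>tens L M a b\<close> is \<open>a \<otimes> b\<close>.
\<close>

definition bi_ideal ::
    "('a, 'x) gorder_scheme \<Rightarrow> ('b, 'y) gorder_scheme \<Rightarrow> ('a \<times> 'b) set \<Rightarrow> bool" where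
  "bi_ideal L M U \<longleftrightarrow> U \<subseteq> carrier L \<times> carrier M \<and>
    (\<forall>(a, b) \<in> U. \<forall>a' \<in> carrier L. \<forall>b' \<in> carrier M.
      a' \<sqsubseteq>\<^bsub>L\<^esub> a \<longrightarrow> b' \<sqsubseteq>\<^bsub>M\<^esub> b \<longrightarrow> (a', b') \<in> U) \<and>
    (\<forall>A b. A \<subseteq> carrier L \<longrightarrow> b \<in> carrier M \<longrightarrow> A \<times> {b} \<subseteq> U \<longrightarrow> (\<Squnion>\<^bsub>L\<^esub>A, b) \<in> U) \<and>
    (\<forall>a B. a \<in> carrier L \<longrightarrow> B \<subseteq> carrier M \<longrightarrow> {a} \<times> B \<subseteq> U \<longrightarrow> (a, \<Squnion>\<^bsub>M\<^esub>B) \<in> U)"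

definition tensor ::
    "('a, 'x) gorder_scheme \<Rightarrow> ('b, 'y) gorder_scheme \<Rightarrow> ('a \<times> 'b) set gorder" where
  "tensor L M = inclusion_order {U. bi_ideal L M U}"

definition tens ::
    "('a, 'x) gorder_scheme \<Rightarrow> ('b, 'y) gorder_scheme \<Rightarrow> 'a \<Rightarrow> 'b \<Rightarrow> ('a \<times> 'b) set" where
  "tens L M a b = \<Inter>{U. bi_ideal L M U \<and> (a, b) \<in> U}"

definition inj1 :: "('a, 'x) gorder_scheme \<Rightarrow> ('b, 'y) gorder_scheme \<Rightarrow> 'a \<Rightarrow> ('a \<times> 'b) set" where
  "inj1 L M a = tens L M a \<top>\<^bsub>M\<^esub>"

definition inj2 :: "('a, 'x) gorder_scheme \<Rightarrow> ('b, 'y) gorder_scheme \<Rightarrow> 'b \<Rightarrow> ('a \<times> 'b) set" where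
  "inj2 L M b = tens L M \<top>\<^bsub>L\<^esub> b"

text \<open>\<open>copair N f g : L \<otimes> M \<rightarrow> N\<close> is the arrow with components \<open>f : L \<rightarrow> N\<close> and \<open>g : M \<rightarrow> N\<close>.\<close>

definition copair ::
    "('c, 'z) gorder_scheme \<Rightarrow> ('a \<Rightarrow> 'c) \<Rightarrow> ('b \<Rightarrow> 'c) \<Rightarrow> ('a \<times> 'b) set \<Rightarrow> 'c" where
  "copair N f g U = \<Squnion>\<^bsub>N\<^esub>((\<lambda>(a, b). f a \<sqinter>\<^bsub>N\<^esub> g b) ` U)"

definition tensor_map ::
    "('c, 'x) gorder_scheme \<Rightarrow> ('d, 'y) gorder_scheme \<Rightarrow> ('a \<Rightarrow> 'c) \<Rightarrow> ('b \<Rightarrow> 'd) \<Rightarrow>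
      ('a \<times> 'b) set \<Rightarrow> ('c \<times> 'd) set" where
  "tensor_map L M f g = copair (tensor L M) (inj1 L M \<circ> f) (inj2 L M \<circ> g)"

text \<open>The canonical isomorphism \<open>L \<otimes> (M \<otimes> N) \<rightarrow> (L \<otimes> M) \<otimes> N\<close>.\<close>

definition tensor_assoc ::
    "('a, 'x) gorder_scheme \<Rightarrow> ('b, 'y) gorder_scheme \<Rightarrow> ('c, 'z) gorder_scheme \<Rightarrow>
      ('a \<times> ('b \<times> 'c) set) set \<Rightarrow> (('a \<times> 'b) set \<times> 'c) set" where
  "tensor_assoc L M N = copair (tensor (tensor L M) N)
    (inj1 (tensor L M) N \<circ> inj1 L M)
    (copair (tensor (tensor L M) N) (inj1 (tensor L M) N \<circ> inj2 L M) (inj2 (tensor L M) N))"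

text \<open>
  A localic group is given by its locale, \<open>comult = m\<^sup>*\<close> and \<open>counit = e\<^sup>*\<close>; the terminal localic
  space is the locale \<open>two\<close>. The inverse is determined by the other data. \<open>from_two G\<close> is the only
  arrow of locales from \<open>two\<close> to \<open>G\<close>.
\<close>

record 'a lgroup = "'a gorder" +
  comult :: "'a \<Rightarrow> ('a \<times> 'a) set"
  counit :: "'a \<Rightarrow> bool"

definition from_two :: "('a, 'x) gorder_scheme \<Rightarrow> bool \<Rightarrow> 'a" where
  "from_two G p = (if p then \<top>\<^bsub>G\<^esub> else \<bottom>\<^bsub>G\<^esub>)"

definition localic_group :: "'a lgroup \<Rightarrow> bool" where
  "localic_group G \<longleftrightarrow> localic G \<and> locale_hom G (tensor G G) (comult G) \<and>
    locale_hom G two (counit G) \<and>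
    (\<forall>a \<in> carrier G. tensor_map (tensor G G) G (comult G) id (comult G a) =
      tensor_assoc G G G (tensor_map G (tensor G G) id (comult G) (comult G a))) \<and>
    (\<forall>a \<in> carrier G. copair G (from_two G \<circ> counit G) id (comult G a) = a) \<and>
    (\<forall>a \<in> carrier G. copair G id (from_two G \<circ> counit G) (comult G a) = a) \<and>
    (\<exists>i. locale_hom G G i \<and> (\<forall>a \<in> carrier G.
      copair G id i (comult G a) = from_two G (counit G a) \<and>
      copair G i id (comult G a) = from_two G (counit G a)))"

text \<open>A morphism \<open>\<mu> : G \<rightarrow> H\<close> of localic groups, given by its inverse image \<open>f = \<mu>\<^sup>* : H \<rightarrow> G\<close>.\<close>

definition localic_group_hom :: "'a lgroup \<Rightarrow> 'b lgroup \<Rightarrow> ('b \<Rightarrow> 'a) \<Rightarrow> bool" where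
  "localic_group_hom G H f \<longleftrightarrow> localic_group G \<and> localic_group H \<and> locale_hom H G f \<and>
    (\<forall>a \<in> carrier H. comult G (f a) = tensor_map G G f f (comult H a)) \<and>
    (\<forall>a \<in> carrier H. counit G (f a) = counit H a)"

text \<open>On \<open>G \<otimes> G\<close>, as a set of pairs, the twist is relational converse.\<close>

definition opposite :: "'a lgroup \<Rightarrow> 'a lgroup" where
  "opposite G = G\<lparr>comult := (\<lambda>a. (comult G a)\<inverse>)\<rparr>"


section \<open>Sheaves on a free inf-lattice\<close>

text \<open>
  \<open>gens\<close> is a set preordered by \<open>gle\<close>. The objects of the site are the finite subsets of \<open>gens\<close>,
  read as formal infima; \<open>basic\<close> consists of pairs (covering family, covered object).
\<close>

record 'd site =
  gens :: "'d set"
  gle :: "'d \<Rightarrow> 'd \<Rightarrow> bool"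
  basic :: "('d set set \<times> 'd set) set"

definition objs :: "'d site \<Rightarrow> 'd set set" where
  "objs S = {A. finite A \<and> A \<subseteq> gens S}"

definition obj_le :: "'d site \<Rightarrow> 'd set \<Rightarrow> 'd set \<Rightarrow> bool" where
  "obj_le S A B \<longleftrightarrow> (\<forall>b \<in> B. \<exists>a \<in> A. gle S a b)"

inductive covers :: "'d site \<Rightarrow> 'd set set \<Rightarrow> 'd set \<Rightarrow> bool" for S where
  basic: "(U, A) \<in> basic S \<Longrightarrow> covers S U A"
| iso: "A \<in> objs S \<Longrightarrow> B \<in> objs S \<Longrightarrow> obj_le S A B \<Longrightarrow> obj_le S B A \<Longrightarrow> covers S {A} B"
| pullback: "covers S U A \<Longrightarrow> B \<in> objs S \<Longrightarrow> covers S ((\<lambda>V. V \<union> B) ` U) (A \<union> B)"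
| composition: "covers S U A \<Longrightarrow> (\<And>V. V \<in> U \<Longrightarrow> covers S (W V) V) \<Longrightarrow>
    covers S (\<Union>V \<in> U. W V) A"

definition sheaf :: "'d site \<Rightarrow> 'd set set \<Rightarrow> bool" where
  "sheaf S T \<longleftrightarrow> T \<subseteq> objs S \<and>
    (\<forall>A \<in> T. \<forall>B \<in> objs S. obj_le S B A \<longrightarrow> B \<in> T) \<and>
    (\<forall>U A. covers S U A \<longrightarrow> U \<subseteq> T \<longrightarrow> A \<in> T)"

definition sheaf_locale :: "'d site \<Rightarrow> 'd set set gorder" where
  "sheaf_locale S = inclusion_order {T. sheaf S T}"

text \<open>The associated sheaf map \<open>#\<close>.\<close>

definition sharp :: "'d site \<Rightarrow> 'd set \<Rightarrow> 'd set set" where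
  "sharp S A = \<Inter>{T. sheaf S T \<and> A \<in> T}"

text \<open>
  If \<open>\<phi>\<close> is monotone on generators and its extension to finite infima respects the basic covers,
  \<open>extend L \<phi>\<close> is the only arrow of locales \<open>sheaf_locale S \<rightarrow> L\<close> with value \<open>\<phi> d\<close> at \<open>#[d]\<close>
  for each generator \<open>d\<close>.
\<close>

definition extend :: "('a, 'x) gorder_scheme \<Rightarrow> ('d \<Rightarrow> 'a) \<Rightarrow> 'd set set \<Rightarrow> 'a" where
  "extend L \<phi> T = \<Squnion>\<^bsub>L\<^esub>((\<lambda>A. \<Sqinter>\<^bsub>L\<^esub>(\<phi> ` A)) ` T)"


section \<open>The localic groups \<open>lAut(S)\<close> and \<open>lAut(F)\<close>\<close>

text \<open>\<open>c (x, y)\<close> is the generator written \<open><x|y>\<close> on the set \<open>E\<close>.\<close>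

definition aut_covers :: "('e \<times> 'e \<Rightarrow> 'd) \<Rightarrow> 'e set \<Rightarrow> ('d set set \<times> 'd set) set" where
  "aut_covers c E =
    {({}, {c (z, x), c (z, y)}) |x y z. x \<in> E \<and> y \<in> E \<and> z \<in> E \<and> x \<noteq> y} \<union>
    {({}, {c (x, z), c (y, z)}) |x y z. x \<in> E \<and> y \<in> E \<and> z \<in> E \<and> x \<noteq> y} \<union>
    {((\<lambda>x. {c (x, z)}) ` E, {}) |z. z \<in> E} \<union>
    {((\<lambda>x. {c (z, x)}) ` E, {}) |z. z \<in> E}"

definition aut_comult ::
    "'d site \<Rightarrow> ('e \<times> 'e \<Rightarrow> 'd) \<Rightarrow> 'e set \<Rightarrow> 'e \<times> 'e \<Rightarrow> ('d set set \<times> 'd set set) set" where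
  "aut_comult S c E = (\<lambda>(x, y).
    \<Squnion>\<^bsub>tensor (sheaf_locale S) (sheaf_locale S)\<^esub>
      ((\<lambda>z. tens (sheaf_locale S) (sheaf_locale S) (sharp S {c (x, z)}) (sharp S {c (z, y)})) ` E))"

definition aut_set_site :: "'e set \<Rightarrow> ('e \<times> 'e) site" where
  "aut_set_site E = \<lparr>gens = E \<times> E, gle = (=), basic = aut_covers id E\<rparr>"

definition lAut_set :: "'e set \<Rightarrow> ('e \<times> 'e) set set lgroup" where
  "lAut_set E = (let S = aut_set_site E; L = sheaf_locale S in
    \<lparr>carrier = carrier L, eq = eq L, le = le L,
     comult = extend (tensor L L) (aut_comult S id E),
     counit = extend two (\<lambda>(x, y). x = y)\<rparr>)"

definition aut_site ::
    "('o, 'm) cat \<Rightarrow> ('o, 'm, 'u set, 'u fn) functr \<Rightarrow> ('o \<times> ('u \<times> 'u)) site" where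
  "aut_site C F = \<lparr>
    gens = {(X, (x0, x1)). X \<in> obj C \<and> x0 \<in> on_obj F X \<and> x1 \<in> on_obj F X},
    gle = (\<lambda>(X, (x0, x1)) (Y, (y0, y1)). \<exists>f \<in> homset C X Y.
      apply_fn (on_arr F f) x0 = y0 \<and> apply_fn (on_arr F f) x1 = y1),
    basic = (\<Union>X \<in> obj C. aut_covers (Pair X) (on_obj F X))\<rparr>"

definition lAut ::
    "('o, 'm) cat \<Rightarrow> ('o, 'm, 'u set, 'u fn) functr \<Rightarrow> ('o \<times> ('u \<times> 'u)) set set lgroup" where
  "lAut C F = (let S = aut_site C F; L = sheaf_locale S in
    \<lparr>carrier = carrier L, eq = eq L, le = le L,
     comult = extend (tensor L L) (\<lambda>(X, p). aut_comult S (Pair X) (on_obj F X) p),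
     counit = extend two (\<lambda>(X, (x, y)). x = y)\<rparr>)"

definition lAut_pro ::
    "('o, 'm) cat \<Rightarrow> ('i, 'j, 'o, 'm) pro \<Rightarrow>
      ('o \<times> (('i \<times> 'm) set \<times> ('i \<times> 'm) set)) set set lgroup" where
  "lAut_pro C P = opposite (lAut C (hom_functor C P))"


section \<open>Actions\<close>

definition action :: "'a lgroup \<Rightarrow> 'e set \<Rightarrow> (('e \<times> 'e) set set \<Rightarrow> 'a) \<Rightarrow> bool" where
  "action G E \<mu> \<longleftrightarrow> localic_group_hom G (lAut_set E) \<mu>"

definition transitive_action :: "'a lgroup \<Rightarrow> 'e set \<Rightarrow> (('e \<times> 'e) set set \<Rightarrow> 'a) \<Rightarrow> bool" where
  "transitive_action G E \<mu> \<longleftrightarrow> action G E \<mu> \<and>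
    (\<forall>x \<in> E. \<forall>y \<in> E. \<mu> (sharp (aut_set_site E) {(x, y)}) \<noteq> \<bottom>\<^bsub>G\<^esub>)"

text \<open>The action of \<open>lAut(F)\<close> on \<open>F X\<close>, given by \<open>\<mu>\<^sup>*[<x0|x1>] = #[(X, <x0|x1>)]\<close>.\<close>

definition lAut_action ::
    "('o, 'm) cat \<Rightarrow> ('o, 'm, 'u set, 'u fn) functr \<Rightarrow> 'o \<Rightarrow>
      ('u \<times> 'u) set set \<Rightarrow> ('o \<times> ('u \<times> 'u)) set set" where
  "lAut_action C F X = extend (lAut C F) (\<lambda>p. sharp (aut_site C F) {(X, p)})"

end

theory Submission
  imports Defs
begin

text \<open>
  Nonvanishing. Call a generator \<open>(W, (w, w'))\<close> evidence for an object \<open>A\<close> of the site if it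
  lies below \<open>A\<close>. The objects without evidence form a sheaf; since \<open>[(X, <x\<^sub>0|x\<^sub>1>)]\<close> has itself as
  evidence, it is not in that sheaf, and so not in the smallest sheaf \<open>0\<close> either. That they form a
  sheaf means that evidence for a covered object can be refined to evidence for a member of the
  cover, and this is where the hypotheses enter. Evidence for \<open>[<z|x>, <z|y>]\<close> consists of two arrows
  \<open>f, g : W \<rightarrow> X\<close> that agree at \<open>w \<in> F W\<close>. All arrows being strict epimorphisms, they are epimorphisms, so
  agreement at one point of the filtered colimit \<open>F W\<close> forces \<open>f = g\<close> and \<open>x = y\<close> (\<open>F_faithful\<close>).
  Evidence for \<open>1\<close> is refined to evidence for some \<open>[<x|z>]\<close> by dominating \<open>w'\<close> and \<open>z\<close> by one element of
  the cofiltered diagram of \<open>F\<close> (\<open>F_span\<close>) and lifting \<open>w\<close> along the arrow obtained, which is possible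
  because \<open>F\<close> turns arrows into strict epimorphisms of sets, that is, surjections (\<open>F_surj\<close>). The argument
  is put together in \<open>sharp_nonzero\<close>.

  Action. An action is by definition a morphism of localic groups, so \<open>lAut(F)\<close> and
  \<open>lAut(F X)\<close> must be localic groups, and the action a morphism. This holds for every set-valued
  functor. Sheaf locales and tensor products of locales are both presented by basic opens
  (\<open>presented_frame\<close>): arrows out of them are determined by, and can be defined by, values on generators
  (\<open>hom_ext\<close>, \<open>hom_from_points\<close>). The generators \<open><x|y>\<close> of the automorphism sites are the entries of the
  generic bijection matrix over a frame; multiplication, unit and inverse are matrix product, identity
  matrix and transpose, and each group law is the corresponding law for matrices, checked on
  generators. One locale, \<open>aut_system\<close>, covers the sites of \<open>lAut(S)\<close> and \<open>lAut(F)\<close>.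
\<close>

section \<open>Suprema in locales, and morphisms of locales\<close>

context localic
begin

lemma sup_eqI:
  assumes "B \<subseteq> carrier L" "s \<in> carrier L" "\<And>b. b \<in> B \<Longrightarrow> b \<sqsubseteq> s"
    and "\<And>t. t \<in> carrier L \<Longrightarrow> (\<And>b. b \<in> B \<Longrightarrow> b \<sqsubseteq> t) \<Longrightarrow> s \<sqsubseteq> t"
  shows "\<Squnion>B = s"
proof (rule le_antisym)
  show "\<Squnion>B \<sqsubseteq> s" using assms by (intro sup_least) auto
  show "s \<sqsubseteq> \<Squnion>B" using assms(1) by (intro assms(4)) (auto intro: sup_upper)
qed (use assms in auto)

lemma sup_meet:
  assumes "a \<in> carrier L" "B \<subseteq> carrier L"
  shows "\<Squnion>B \<sqinter> a = \<Squnion>((\<lambda>b. b \<sqinter> a) ` B)"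
  using meet_sup[OF assms] by (simp add: meet_comm)

lemma sup_image_cong_le:
  assumes "f \<in> A \<rightarrow> carrier L" "g \<in> B \<rightarrow> carrier L"
    and "\<And>a. a \<in> A \<Longrightarrow> \<exists>b \<in> B. f a \<sqsubseteq> g b"
  shows "\<Squnion>(f ` A) \<sqsubseteq> \<Squnion>(g ` B)"
proof (rule sup_least)
  show "f ` A \<subseteq> carrier L" using assms(1) by auto
  have gB: "g ` B \<subseteq> carrier L" using assms(2) by auto
  then show "\<Squnion>(g ` B) \<in> carrier L" by simp
  fix x assume "x \<in> f ` A"
  then obtain a b where "a \<in> A" "x = f a" "b \<in> B" "f a \<sqsubseteq> g b" using assms(3) by blast
  moreover have "g b \<sqsubseteq> \<Squnion>(g ` B)" using gB \<open>b \<in> B\<close> by (auto intro: sup_upper)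
  ultimately show "x \<sqsubseteq> \<Squnion>(g ` B)"
    using le_trans[of "f a" "g b" "\<Squnion>(g ` B)"] assms(1,2) gB \<open>a \<in> A\<close> \<open>x = f a\<close> \<open>b \<in> B\<close> by (auto simp: Pi_iff)
qed

lemma sup_sup:
  assumes "\<And>a b. a \<in> A \<Longrightarrow> b \<in> B a \<Longrightarrow> f a b \<in> carrier L"
  shows "\<Squnion>((\<lambda>a. \<Squnion>(f a ` B a)) ` A) = \<Squnion>((\<lambda>(a, b). f a b) ` Sigma A B)"
proof (rule sup_eqI)
  have c: "f a ` B a \<subseteq> carrier L" if "a \<in> A" for a using assms that by auto
  have C: "(\<lambda>(a, b). f a b) ` Sigma A B \<subseteq> carrier L" using assms by auto
  show "(\<lambda>a. \<Squnion>(f a ` B a)) ` A \<subseteq> carrier L" using c by auto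
  show "\<Squnion>((\<lambda>(a, b). f a b) ` Sigma A B) \<in> carrier L" using C by simp
  show "s \<sqsubseteq> \<Squnion>((\<lambda>(a, b). f a b) ` Sigma A B)" if s: "s \<in> (\<lambda>a. \<Squnion>(f a ` B a)) ` A" for s
  proof -
    obtain a where a: "a \<in> A" "s = \<Squnion>(f a ` B a)" using s by auto
    show ?thesis unfolding a(2)
      using C a(1) by (intro sup_least c) (auto intro!: sup_upper)
  qed
  fix t assume t: "t \<in> carrier L"
    and le: "\<And>s. s \<in> (\<lambda>a. \<Squnion>(f a ` B a)) ` A \<Longrightarrow> s \<sqsubseteq> t"
  show "\<Squnion>((\<lambda>(a, b). f a b) ` Sigma A B) \<sqsubseteq> t"
  proof (rule sup_least[OF C t])
    fix x assume "x \<in> (\<lambda>(a, b). f a b) ` Sigma A B"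
    then obtain a b where ab: "a \<in> A" "b \<in> B a" "x = f a b" by auto
    then have "x \<sqsubseteq> \<Squnion>(f a ` B a)" by (intro sup_upper[OF c]) auto
    moreover have "\<Squnion>(f a ` B a) \<sqsubseteq> t" using ab le by blast
    ultimately show "x \<sqsubseteq> t" using ab c t by (metis assms le_trans sup_closed)
  qed
qed

lemma sup_swap:
  assumes "\<And>a b. a \<in> A \<Longrightarrow> b \<in> B \<Longrightarrow> f a b \<in> carrier L"
  shows "\<Squnion>((\<lambda>a. \<Squnion>(f a ` B)) ` A) = \<Squnion>((\<lambda>b. \<Squnion>((\<lambda>a. f a b) ` A)) ` B)"
proof -
  have "(\<lambda>(a, b). f a b) ` (A \<times> B) = (\<lambda>(b, a). f a b) ` (B \<times> A)" by auto
  then show ?thesis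
    using sup_sup[of A "\<lambda>_. B" f] sup_sup[of B "\<lambda>_. A" "\<lambda>b a. f a b"] assms by simp
qed

lemma meet_of_sups:
  assumes "f \<in> A \<rightarrow> carrier L" "g \<in> B \<rightarrow> carrier L"
  shows "\<Squnion>(f ` A) \<sqinter> \<Squnion>(g ` B) = \<Squnion>((\<lambda>(a, b). f a \<sqinter> g b) ` (A \<times> B))"
proof -
  have fA: "f ` A \<subseteq> carrier L" and gB: "g ` B \<subseteq> carrier L" using assms by auto
  have "\<Squnion>(f ` A) \<sqinter> \<Squnion>(g ` B) = \<Squnion>((\<lambda>a. f a \<sqinter> \<Squnion>(g ` B)) ` A)"
    using fA gB by (simp add: sup_meet image_image)
  also have "\<dots> = \<Squnion>((\<lambda>a. \<Squnion>((\<lambda>b. f a \<sqinter> g b) ` B)) ` A)"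
  proof -
    have "f a \<sqinter> \<Squnion>(g ` B) = \<Squnion>((\<lambda>b. f a \<sqinter> g b) ` B)" if "a \<in> A" for a
      using meet_sup[of "f a" "g ` B"] assms(1) gB that by (auto simp: image_image)
    then show ?thesis by simp
  qed
  also have "\<dots> = \<Squnion>((\<lambda>(a, b). f a \<sqinter> g b) ` (A \<times> B))"
    using assms by (intro sup_sup meet_closed) auto
  finally show ?thesis .
qed

lemma sup_empty [simp]: "\<Squnion>{} = \<bottom>"
  using weak_sup_empty by (simp add: eq_is_equal)

lemma inf_empty [simp]: "\<Sqinter>{} = \<top>"
  using weak_inf_empty by (simp add: eq_is_equal)

lemma sup_bottoms:
  assumes "\<And>b. b \<in> B \<Longrightarrow> b = \<bottom>"
  shows "\<Squnion>B = \<bottom>"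
proof -
  have "B \<subseteq> {\<bottom>}" using assms by auto
  then have "B = {} \<or> B = {\<bottom>}" by auto
  then show ?thesis by auto
qed

lemma inf_Un:
  assumes "A \<subseteq> carrier L" "B \<subseteq> carrier L"
  shows "\<Sqinter>(A \<union> B) = \<Sqinter>A \<sqinter> \<Sqinter>B"
proof (rule le_antisym)
  show "\<Sqinter>(A \<union> B) \<sqsubseteq> \<Sqinter>A \<sqinter> \<Sqinter>B"
    using assms by (intro meet_le inf_greatest) (auto intro: inf_lower)
  show "\<Sqinter>A \<sqinter> \<Sqinter>B \<sqsubseteq> \<Sqinter>(A \<union> B)"
  proof (rule inf_greatest)
    fix x assume x: "x \<in> A \<union> B"
    have c: "\<Sqinter>A \<in> carrier L" "\<Sqinter>B \<in> carrier L" "x \<in> carrier L" using x assms by auto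
    from x show "\<Sqinter>A \<sqinter> \<Sqinter>B \<sqsubseteq> x"
    proof
      assume "x \<in> A"
      then show ?thesis using c assms by (meson inf_lower le_trans meet_closed meet_left)
    next
      assume "x \<in> B"
      then show ?thesis using c assms by (meson inf_lower le_trans meet_closed meet_right)
    qed
  qed (use assms in auto)
qed (use assms in auto)

lemma meet_interchange:
  assumes "a \<in> carrier L" "b \<in> carrier L" "c \<in> carrier L" "d \<in> carrier L"
  shows "(a \<sqinter> b) \<sqinter> (c \<sqinter> d) = (a \<sqinter> c) \<sqinter> (b \<sqinter> d)"
  using assms by (metis meet_assoc meet_comm meet_closed)

lemma meet_top [simp]: "a \<in> carrier L \<Longrightarrow> a \<sqinter> \<top> = a"
  using top_meet[of a] by (simp add: eq_is_equal meet_comm)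

lemma top_meet' [simp]: "a \<in> carrier L \<Longrightarrow> \<top> \<sqinter> a = a"
  using top_meet[of a] by (simp add: eq_is_equal)

lemma meet_bottom [simp]: "a \<in> carrier L \<Longrightarrow> a \<sqinter> \<bottom> = \<bottom>"
  using bottom_meet[of a] by (simp add: eq_is_equal meet_comm)

lemma bottom_meet' [simp]: "a \<in> carrier L \<Longrightarrow> \<bottom> \<sqinter> a = \<bottom>"
  using bottom_meet[of a] by (simp add: eq_is_equal)

lemma meet_idem: "a \<in> carrier L \<Longrightarrow> a \<sqinter> a = a"
  by (simp add: meet_def)

lemma meet_mono:
  assumes "a \<sqsubseteq> a'" "b \<sqsubseteq> b'" "a \<in> carrier L" "a' \<in> carrier L" "b \<in> carrier L" "b' \<in> carrier L"
  shows "a \<sqinter> b \<sqsubseteq> a' \<sqinter> b'"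
  using assms by (meson le_trans meet_closed meet_le meet_left meet_right)

lemma meet_eq_left: "a \<sqsubseteq> b \<Longrightarrow> a \<in> carrier L \<Longrightarrow> b \<in> carrier L \<Longrightarrow> a \<sqinter> b = a"
  by (simp add: le_antisym meet_le meet_left)

end

lemma locale_hom_closed: "locale_hom L M f \<Longrightarrow> a \<in> carrier L \<Longrightarrow> f a \<in> carrier M"
  by (auto simp: locale_hom_def)

lemma locale_hom_top: "locale_hom L M f \<Longrightarrow> f \<top>\<^bsub>L\<^esub> = \<top>\<^bsub>M\<^esub>"
  by (simp add: locale_hom_def)

lemma locale_hom_meet:
  "locale_hom L M f \<Longrightarrow> a \<in> carrier L \<Longrightarrow> b \<in> carrier L \<Longrightarrow> f (a \<sqinter>\<^bsub>L\<^esub> b) = f a \<sqinter>\<^bsub>M\<^esub> f b"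
  by (simp add: locale_hom_def)

lemma locale_hom_sup:
  "locale_hom L M f \<Longrightarrow> B \<subseteq> carrier L \<Longrightarrow> f (\<Squnion>\<^bsub>L\<^esub>B) = \<Squnion>\<^bsub>M\<^esub>(f ` B)"
  by (simp add: locale_hom_def)

lemma locale_hom_sup_image:
  assumes "locale_hom L M f" "\<And>a. a \<in> A \<Longrightarrow> g a \<in> carrier L"
  shows "f (\<Squnion>\<^bsub>L\<^esub>(g ` A)) = \<Squnion>\<^bsub>M\<^esub>((\<lambda>a. f (g a)) ` A)"
  using locale_hom_sup[OF assms(1), of "g ` A"] assms(2) by (auto simp: image_image)

lemma locale_hom_mono:
  assumes "localic L" "localic M" "locale_hom L M f" "a \<in> carrier L" "b \<in> carrier L" "a \<sqsubseteq>\<^bsub>L\<^esub> b"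
  shows "f a \<sqsubseteq>\<^bsub>M\<^esub> f b"
proof -
  interpret L: localic L by fact
  interpret M: localic M by fact
  have "f a = f a \<sqinter>\<^bsub>M\<^esub> f b"
    using assms locale_hom_meet[of L M f a b] L.meet_eq_left by simp
  then show ?thesis using assms by (metis M.meet_right locale_hom_closed)
qed

lemma locale_hom_id: "localic L \<Longrightarrow> locale_hom L L id"
  by (auto simp: locale_hom_def)

lemma locale_hom_comp:
  assumes "locale_hom L M f" "locale_hom M N g"
  shows "locale_hom L N (g \<circ> f)"
proof -
  have "f ` B \<subseteq> carrier M" if "B \<subseteq> carrier L" for B using assms(1) that by (auto simp: locale_hom_def)
  then show ?thesis
    using assms by (auto simp: locale_hom_def image_comp Pi_iff)
qed

section \<open>Frames of closed sets\<close>

text \<open>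
  Both the sheaves on a site and the elements of a tensor product of locales are families \<open>X\<close> of
  subsets of a fixed set \<open>W\<close> of formal basic opens, closed under intersection. What makes such a
  family a frame is the same in the two cases: \<open>W\<close> has a formal meet \<open>mt\<close>, and pulling a closed set
  back along \<open>mt u\<close> gives a closed set again (covers are stable under meet). The frame structure and
  the universal property are therefore proved once, for this situation. The point
  \<open>e\<close> is the formal top.
\<close>

locale presented_frame =
  fixes W :: "'w set" and X :: "'w set set" and mt :: "'w \<Rightarrow> 'w \<Rightarrow> 'w" and e :: 'w
  assumes closed_sub: "U \<in> X \<Longrightarrow> U \<subseteq> W"
    and closed_Inter: "\<A> \<subseteq> X \<Longrightarrow> W \<inter> \<Inter>\<A> \<in> X"
    and mt_mem: "U \<in> X \<Longrightarrow> V \<in> X \<Longrightarrow> u \<in> U \<Longrightarrow> v \<in> V \<Longrightarrow> mt u v \<in> U \<inter> V"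
    and mt_idem: "u \<in> W \<Longrightarrow> mt u u = u"
    and mt_commute: "u \<in> W \<Longrightarrow> v \<in> W \<Longrightarrow> mt u v = mt v u"
    and residual_closed: "U \<in> X \<Longrightarrow> u \<in> W \<Longrightarrow> {v \<in> W. mt u v \<in> U} \<in> X"
    and unit_mem: "e \<in> W"
begin

definition cl :: "'w \<Rightarrow> 'w set" where "cl w = \<Inter>{U \<in> X. w \<in> U}"

abbreviation L :: "'w set gorder" where "L \<equiv> inclusion_order X"

lemma whole_closed: "W \<in> X"
  using closed_Inter[of "{}"] by simp

lemma Inter_closed: "\<A> \<subseteq> X \<Longrightarrow> \<A> \<noteq> {} \<Longrightarrow> \<Inter>\<A> \<in> X"
  using closed_Inter[of \<A>] closed_sub by (metis Inf_lower2 inf.absorb2 ex_in_conv subsetD)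

lemma hull_closed: "B \<subseteq> W \<Longrightarrow> \<Inter>{U \<in> X. B \<subseteq> U} \<in> X"
  using whole_closed by (intro Inter_closed) auto

lemma cl_closed: "w \<in> W \<Longrightarrow> cl w \<in> X"
  using whole_closed unfolding cl_def by (intro Inter_closed) auto

lemma cl_mem: "w \<in> cl w"
  by (auto simp: cl_def)

lemma cl_least: "U \<in> X \<Longrightarrow> w \<in> U \<Longrightarrow> cl w \<subseteq> U"
  by (auto simp: cl_def)

lemma order_simps [simp]: "carrier L = X" "le L = (\<subseteq>)" "eq L = (=)"
  by (auto simp: inclusion_order_def)

lemma is_sup: "B \<subseteq> X \<Longrightarrow> least L (\<Inter>{U \<in> X. \<Union>B \<subseteq> U}) (Upper L B)"
  unfolding least_def
proof (intro conjI ballI)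
  assume B: "B \<subseteq> X"
  have "\<Union>B \<subseteq> W" using B closed_sub by blast
  then show "\<Inter>{U \<in> X. \<Union>B \<subseteq> U} \<in> Upper L B"
    using hull_closed[of "\<Union>B"] by (auto simp: Upper_def)
  fix V assume "V \<in> Upper L B"
  then have "V \<in> X" "\<Union>B \<subseteq> V" using B by (auto simp: Upper_def)
  then show "\<Inter>{U \<in> X. \<Union>B \<subseteq> U} \<sqsubseteq>\<^bsub>L\<^esub> V" by (auto intro!: Inter_lower)
qed (auto simp: Upper_def)

lemma is_inf: "B \<subseteq> X \<Longrightarrow> greatest L (W \<inter> \<Inter>B) (Lower L B)"
  using closed_Inter[of B] closed_sub by (auto simp: greatest_def Lower_def)

lemma complete_lattice_L: "complete_lattice L"
proof
  show "\<exists>s. least L s (Upper L A)" if "A \<subseteq> carrier L" for A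
    using that is_sup[of A] by auto
  show "\<exists>s. greatest L s (Lower L A)" if "A \<subseteq> carrier L" for A
    using that is_inf[of A] by auto
qed auto

lemma sup_eq: "B \<subseteq> X \<Longrightarrow> \<Squnion>\<^bsub>L\<^esub>B = \<Inter>{U \<in> X. \<Union>B \<subseteq> U}"
proof -
  interpret complete_lattice L by (rule complete_lattice_L)
  show "B \<subseteq> X \<Longrightarrow> ?thesis"
    using is_sup[of B] sup_lub[of B] by (simp add: least_unique)
qed

lemma meet_eq: "U \<in> X \<Longrightarrow> V \<in> X \<Longrightarrow> U \<sqinter>\<^bsub>L\<^esub> V = U \<inter> V"
proof -
  interpret complete_lattice L by (rule complete_lattice_L)
  show "U \<in> X \<Longrightarrow> V \<in> X \<Longrightarrow> ?thesis"
    using is_inf[of "{U, V}"] inf_glb[of "{U, V}"] closed_sub[of U]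
    by (auto simp: meet_def dest: greatest_unique)
qed

lemma top_eq: "\<top>\<^bsub>L\<^esub> = W"
proof -
  interpret complete_lattice L by (rule complete_lattice_L)
  show ?thesis using whole_closed closed_sub top_closed top_higher by (metis order_simps(1,2) subset_antisym)
qed

lemma bottom_eq: "\<bottom>\<^bsub>L\<^esub> = \<Inter>X"
proof -
  interpret complete_lattice L by (rule complete_lattice_L)
  show ?thesis using bottom_closed bottom_lower by (metis Inf_greatest Inf_lower order_simps(1,2) subset_antisym)
qed

text \<open>
  The Heyting implication: the largest closed set whose intersection with \<open>U\<close> lies in \<open>K\<close>.
\<close>

definition residual :: "'w set \<Rightarrow> 'w set \<Rightarrow> 'w set" where
  "residual U K = W \<inter> \<Inter>((\<lambda>u. {v \<in> W. mt u v \<in> K}) ` U)"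

lemma residual:
  assumes "U \<in> X" "K \<in> X"
  shows "residual U K \<in> X" and "V \<in> X \<Longrightarrow> V \<subseteq> residual U K \<longleftrightarrow> U \<inter> V \<subseteq> K"
proof -
  show "residual U K \<in> X"
    unfolding residual_def using assms closed_sub by (intro closed_Inter) (auto intro: residual_closed)
  assume V: "V \<in> X"
  show "V \<subseteq> residual U K \<longleftrightarrow> U \<inter> V \<subseteq> K"
  proof
    assume "V \<subseteq> residual U K"
    then show "U \<inter> V \<subseteq> K" using closed_sub[OF V] mt_idem by (force simp: residual_def)
  next
    assume "U \<inter> V \<subseteq> K"
    then show "V \<subseteq> residual U K"
      using mt_mem[OF assms(1) V] closed_sub[OF V] by (auto simp: residual_def)
  qed
qed

text \<open>
  Meeting with \<open>a\<close> has the right adjoint \<^term>\<open>residual a\<close>, hence it preserves suprema.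
\<close>

lemma localic_L: "localic L"
proof (rule localic.intro[OF complete_lattice_L], unfold_locales)
  fix a B assume a: "a \<in> carrier L" and B: "B \<subseteq> carrier L"
  interpret complete_lattice L by (rule complete_lattice_L)
  let ?K = "\<Squnion>\<^bsub>L\<^esub>((\<lambda>b. a \<sqinter>\<^bsub>L\<^esub> b) ` B)"
  have im: "(\<lambda>b. a \<sqinter>\<^bsub>L\<^esub> b) ` B \<subseteq> carrier L"
    using a B by (auto intro!: meet_closed simp del: order_simps)
  then have K: "?K \<in> X" using sup_closed[of "(\<lambda>b. a \<sqinter>\<^bsub>L\<^esub> b) ` B"] by simp
  have aX: "a \<in> X" and BX: "B \<subseteq> X" using a B by auto
  have "b \<subseteq> residual a ?K" if "b \<in> B" for b
  proof -
    have "a \<sqinter>\<^bsub>L\<^esub> b \<subseteq> ?K" using sup_upper[OF im] that by auto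
    then show ?thesis using residual(2)[OF aX K, of b] meet_eq[of a b] aX BX that by auto
  qed
  then have "\<Squnion>\<^bsub>L\<^esub>B \<subseteq> residual a ?K"
    using sup_least[of B "residual a ?K"] BX residual(1)[OF aX K] by auto
  then have "a \<sqinter>\<^bsub>L\<^esub> \<Squnion>\<^bsub>L\<^esub>B \<subseteq> ?K"
    using residual(2)[OF aX K, of "\<Squnion>\<^bsub>L\<^esub>B"] meet_eq[of a "\<Squnion>\<^bsub>L\<^esub>B"] aX BX sup_closed[of B] by auto
  moreover have "?K \<subseteq> a \<sqinter>\<^bsub>L\<^esub> \<Squnion>\<^bsub>L\<^esub>B"
  proof -
    have "x \<subseteq> a \<sqinter>\<^bsub>L\<^esub> \<Squnion>\<^bsub>L\<^esub>B" if x: "x \<in> (\<lambda>b. a \<sqinter>\<^bsub>L\<^esub> b) ` B" for x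
    proof -
      obtain b where b: "b \<in> B" "x = a \<sqinter>\<^bsub>L\<^esub> b" using x by auto
      have "b \<subseteq> \<Squnion>\<^bsub>L\<^esub>B" using sup_upper[of B b] B b by auto
      moreover have "b \<in> X" "\<Squnion>\<^bsub>L\<^esub>B \<in> X" using b BX sup_closed[of B] by auto
      ultimately show ?thesis using b aX by (auto simp: meet_eq)
    qed
    moreover have "a \<sqinter>\<^bsub>L\<^esub> \<Squnion>\<^bsub>L\<^esub>B \<in> carrier L" using a B by (intro meet_closed sup_closed)
    ultimately show ?thesis using sup_least[OF im, of "a \<sqinter>\<^bsub>L\<^esub> \<Squnion>\<^bsub>L\<^esub>B"] by simp
  qed
  ultimately show "a \<sqinter>\<^bsub>L\<^esub> \<Squnion>\<^bsub>L\<^esub>B = ?K" by blast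
qed

text \<open>
  The nontrivial inclusion holds because membership in \<open>cl (mt u v)\<close> may be tested one variable at a
  time: residuals by \<open>v\<close>, and then by a point of \<open>cl u\<close>, are closed sets. The diagonal of the
  resulting two-variable statement is the claim, by idempotence.
\<close>

lemma cl_mt:
  assumes "u \<in> W" "v \<in> W" "mt u v \<in> W"
  shows "cl (mt u v) = cl u \<inter> cl v"
proof
  show "cl (mt u v) \<subseteq> cl u \<inter> cl v"
    using mt_mem[OF cl_closed cl_closed cl_mem cl_mem] assms
    by (meson Int_iff Int_greatest cl_closed cl_least)
  let ?K = "cl (mt u v)"
  have K: "?K \<in> X" using assms by (intro cl_closed)
  have 1: "mt v x \<in> ?K" if "x \<in> cl u" for x
  proof -
    have "cl u \<subseteq> {x \<in> W. mt v x \<in> ?K}"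
      using assms K cl_mem[of "mt u v"] by (intro cl_least residual_closed) (auto simp: mt_commute)
    then show ?thesis using that by auto
  qed
  have "mt x y \<in> ?K" if xy: "x \<in> cl u" "y \<in> cl v" for x y
  proof -
    have xW: "x \<in> W" using xy(1) closed_sub[OF cl_closed[OF assms(1)]] by auto
    have "cl v \<subseteq> {y \<in> W. mt x y \<in> ?K}"
      using assms K xW 1[OF xy(1)] by (intro cl_least residual_closed) (auto simp: mt_commute)
    then show ?thesis using xy by auto
  qed
  then have "mt x x \<in> ?K" if "x \<in> cl u \<inter> cl v" for x using that by blast
  moreover have "mt x x = x" if "x \<in> cl u \<inter> cl v" for x
    using that closed_sub[OF cl_closed[OF assms(1)]] by (intro mt_idem) blast
  ultimately show "cl u \<inter> cl v \<subseteq> ?K" by (metis subsetI)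
qed

lemma unit_is_top:
  assumes "\<And>w. w \<in> W \<Longrightarrow> mt e w = w"
  shows "cl e = W"
proof -
  have "w \<in> cl e" if "w \<in> W" for w
    using mt_mem[OF cl_closed whole_closed cl_mem that, of e] unit_mem assms that by auto
  then show ?thesis using closed_sub[OF cl_closed[OF unit_mem]] by auto
qed

lemma sup_of_points: "U \<in> X \<Longrightarrow> \<Squnion>\<^bsub>L\<^esub>(cl ` U) = U"
proof -
  assume U: "U \<in> X"
  have "cl ` U \<subseteq> X" using U closed_sub cl_closed by auto
  then have "\<Squnion>\<^bsub>L\<^esub>(cl ` U) = \<Inter>{V \<in> X. \<Union>(cl ` U) \<subseteq> V}" by (rule sup_eq)
  also have "\<dots> = U"
  proof (intro subset_antisym)
    show "\<Inter>{V \<in> X. \<Union>(cl ` U) \<subseteq> V} \<subseteq> U"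
      using U cl_least[OF U] by (intro Inter_lower) auto
    show "U \<subseteq> \<Inter>{V \<in> X. \<Union>(cl ` U) \<subseteq> V}" using cl_mem by blast
  qed
  finally show ?thesis .
qed

text \<open>
  Every closed set is the supremum of the closures of its points, so these closures generate.
\<close>

lemma hom_ext:
  assumes "locale_hom L N f" "locale_hom L N g" "\<And>w. w \<in> W \<Longrightarrow> f (cl w) = g (cl w)" "U \<in> X"
  shows "f U = g U"
proof -
  have "cl ` U \<subseteq> carrier L" using assms(4) closed_sub cl_closed by auto
  moreover have "f ` cl ` U = g ` cl ` U"
    using assms(3,4) closed_sub by (force simp: image_image)
  ultimately show ?thesis
    using locale_hom_sup[OF assms(1)] locale_hom_sup[OF assms(2)] sup_of_points[OF assms(4)] by metis
qed

text \<open>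
  The universal property. The map is left adjoint to \<open>n \<mapsto> {w. h w \<sqsubseteq> n}\<close>, and the last hypothesis says
  that this right adjoint takes values in closed sets, which is how a presentation states that \<open>h\<close>
  respects the covers; so suprema are preserved. Finite meets are preserved since \<open>h\<close> preserves the
  formal ones and binary meets distribute over suprema.
\<close>

lemma hom_from_points:
  fixes N (structure)
  assumes "localic N"
    and h: "\<And>w. w \<in> W \<Longrightarrow> h w \<in> carrier N"
    and h_unit: "h e = \<top>"
    and h_mt: "\<And>u v. u \<in> W \<Longrightarrow> v \<in> W \<Longrightarrow> h (mt u v) = h u \<sqinter> h v"
    and below_closed: "\<And>n. n \<in> carrier N \<Longrightarrow> {w \<in> W. h w \<sqsubseteq> n} \<in> X"
  shows "locale_hom L N (\<lambda>U. \<Squnion>(h ` U))"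
    and "w \<in> W \<Longrightarrow> \<Squnion>(h ` cl w) = h w"
proof -
  interpret N: localic N by fact
  interpret L: localic L by (rule localic_L)
  let ?f = "\<lambda>U. \<Squnion>(h ` U)"
  have hU: "h ` U \<subseteq> carrier N" if "U \<subseteq> W" for U using that h by auto
  have adj: "?f U \<sqsubseteq> n \<longleftrightarrow> U \<subseteq> {w \<in> W. h w \<sqsubseteq> n}" if "U \<subseteq> W" "n \<in> carrier N" for U n
  proof
    assume le: "?f U \<sqsubseteq> n"
    show "U \<subseteq> {w \<in> W. h w \<sqsubseteq> n}"
    proof
      fix w assume w: "w \<in> U"
      then have "h w \<sqsubseteq> ?f U" using N.sup_upper[OF hU[OF that(1)]] by auto
      then show "w \<in> {w \<in> W. h w \<sqsubseteq> n}"
        using w that h le by (metis (no_types, lifting) CollectI N.le_trans N.sup_closed hU subsetD)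
    qed
  next
    assume "U \<subseteq> {w \<in> W. h w \<sqsubseteq> n}"
    then show "?f U \<sqsubseteq> n" by (intro N.sup_least[OF hU[OF that(1)] that(2)]) auto
  qed
  show point: "?f (cl w) = h w" if "w \<in> W" for w
  proof (rule N.le_antisym)
    have c: "cl w \<subseteq> W" using that closed_sub cl_closed by auto
    show "?f (cl w) \<sqsubseteq> h w"
      using adj[OF c h[OF that]] cl_least[OF below_closed[OF h[OF that]], of w] that h by auto
    show "h w \<sqsubseteq> ?f (cl w)" using N.sup_upper[OF hU[OF c]] cl_mem[of w] by auto
    show "?f (cl w) \<in> carrier N" using hU[OF c] by simp
  qed (use h that in auto)
  show "locale_hom L N ?f"
    unfolding locale_hom_def
  proof (intro conjI ballI allI impI)
    show "?f \<in> carrier L \<rightarrow> carrier N" using hU closed_sub by auto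
    have "h e \<in> h ` W" using unit_mem by blast
    then have "\<top> \<sqsubseteq> ?f W" using N.sup_upper[OF hU[OF subset_refl]] h_unit by simp
    moreover have "?f W \<in> carrier N" using hU[OF subset_refl] by simp
    ultimately show "?f \<top>\<^bsub>L\<^esub> = \<top>" by (metis top_eq N.le_antisym N.top_closed N.top_higher)
  next
    fix U V assume "U \<in> carrier L" "V \<in> carrier L"
    then have UV: "U \<in> X" "V \<in> X" by auto
    then have sub: "U \<subseteq> W" "V \<subseteq> W" using closed_sub by auto
    have "?f U \<sqinter> ?f V = \<Squnion>((\<lambda>(u, v). h u \<sqinter> h v) ` (U \<times> V))"
      using sub h by (intro N.meet_of_sups) auto
    also have "(\<lambda>(u, v). h u \<sqinter> h v) ` (U \<times> V) = h ` (U \<inter> V)"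
    proof (intro subset_antisym subsetI)
      fix x assume "x \<in> (\<lambda>(u, v). h u \<sqinter> h v) ` (U \<times> V)"
      then obtain u v where "u \<in> U" "v \<in> V" "x = h u \<sqinter> h v" by auto
      then show "x \<in> h ` (U \<inter> V)"
        using mt_mem[OF UV, of u v] h_mt[of u v] sub by (metis imageI subsetD)
    next
      fix x assume "x \<in> h ` (U \<inter> V)"
      then obtain u where "u \<in> U" "u \<in> V" "x = h u" by auto
      then show "x \<in> (\<lambda>(u, v). h u \<sqinter> h v) ` (U \<times> V)"
        using sub h by (auto simp: N.meet_idem intro!: image_eqI[of _ _ "(u, u)"])
    qed
    finally show "?f (U \<sqinter>\<^bsub>L\<^esub> V) = ?f U \<sqinter> ?f V" using UV by (simp add: meet_eq)
  next
    fix B assume "B \<subseteq> carrier L"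
    then have B: "B \<subseteq> X" by simp
    have fB: "?f ` B \<subseteq> carrier N" using B hU closed_sub by auto
    have S: "\<Squnion>\<^bsub>L\<^esub>B \<in> X" using L.sup_closed[of B] B by simp
    show "?f (\<Squnion>\<^bsub>L\<^esub>B) = \<Squnion>(?f ` B)"
    proof (rule N.sup_eqI[symmetric, OF fB])
      show "?f (\<Squnion>\<^bsub>L\<^esub>B) \<in> carrier N" using hU closed_sub[OF S] by auto
      fix x assume "x \<in> ?f ` B"
      then obtain U where U: "U \<in> B" "x = ?f U" by auto
      have "U \<subseteq> \<Squnion>\<^bsub>L\<^esub>B" using L.sup_upper[of B U] B U by auto
      moreover have "\<Squnion>\<^bsub>L\<^esub>B \<subseteq> W" by (rule closed_sub[OF S])
      ultimately show "x \<sqsubseteq> ?f (\<Squnion>\<^bsub>L\<^esub>B)"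
        unfolding U(2)
      proof (intro N.sup_image_cong_le)
        show "\<exists>v \<in> \<Squnion>\<^bsub>L\<^esub>B. h u \<sqsubseteq> h v" if "u \<in> U" "U \<subseteq> \<Squnion>\<^bsub>L\<^esub>B" "\<Squnion>\<^bsub>L\<^esub>B \<subseteq> W" for u
          using that N.le_refl[OF h, of u] by blast
      qed (use h in blast)+
    next
      fix n assume n: "n \<in> carrier N" and le: "\<And>x. x \<in> ?f ` B \<Longrightarrow> x \<sqsubseteq> n"
      have "U \<subseteq> {w \<in> W. h w \<sqsubseteq> n}" if "U \<in> B" for U
      proof -
        have "U \<subseteq> W" using that B closed_sub by auto
        moreover have "?f U \<sqsubseteq> n" using that by (intro le imageI)
        ultimately show ?thesis using adj n by blast
      qed
      then have "\<Squnion>\<^bsub>L\<^esub>B \<subseteq> {w \<in> W. h w \<sqsubseteq> n}"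
        using L.sup_least[of B "{w \<in> W. h w \<sqsubseteq> n}"] B below_closed[OF n] by auto
      then show "?f (\<Squnion>\<^bsub>L\<^esub>B) \<sqsubseteq> n" using adj[OF closed_sub[OF S] n] by blast
    qed
  qed
qed

end

section \<open>The universal property of sheaves on a free inf-lattice\<close>

locale generated_site =
  fixes S :: "'d site"
  assumes gle_refl: "d \<in> gens S \<Longrightarrow> gle S d d"
    and basic_objs: "(U, A) \<in> basic S \<Longrightarrow> A \<in> objs S"
    and basic_family: "(U, A) \<in> basic S \<Longrightarrow> U \<subseteq> objs S"
begin

lemma covers_objs: "covers S U A \<Longrightarrow> A \<in> objs S"
  by (induction rule: covers.induct) (use basic_objs in \<open>auto simp: objs_def\<close>)

lemma Un_objs: "A \<in> objs S \<Longrightarrow> B \<in> objs S \<Longrightarrow> A \<union> B \<in> objs S"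
  by (auto simp: objs_def)

lemma obj_le_superset: "B \<in> objs S \<Longrightarrow> A \<subseteq> B \<Longrightarrow> obj_le S B A"
  using gle_refl by (auto simp: obj_le_def objs_def)

lemma obj_le_Un: "B \<in> objs S \<Longrightarrow> obj_le S A' A \<Longrightarrow> obj_le S (A' \<union> B) (A \<union> B)"
  using gle_refl by (fastforce simp: obj_le_def objs_def)

text \<open>
  It is enough to test the basic covers after meeting them with arbitrary objects. The statement with
  the extra object \<open>B\<close> is what passes through the pullback and composition rules in the induction
  over the generated covers.
\<close>

lemma sheafI:
  assumes "T \<subseteq> objs S"
    and down: "\<And>A B. A \<in> T \<Longrightarrow> B \<in> objs S \<Longrightarrow> obj_le S B A \<Longrightarrow> B \<in> T"
    and cover: "\<And>U A B. (U, A) \<in> basic S \<Longrightarrow> B \<in> objs S \<Longrightarrow> (\<And>V. V \<in> U \<Longrightarrow> V \<union> B \<in> T) \<Longrightarrow> A \<union> B \<in> T"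
  shows "sheaf S T"
proof -
  have "\<forall>B \<in> objs S. (\<forall>V \<in> U. V \<union> B \<in> T) \<longrightarrow> A \<union> B \<in> T" if "covers S U A" for U A
    using that
  proof induction
    case (basic U A)
    then show ?case using cover by blast
  next
    case (iso A B)
    then show ?case using down obj_le_Un Un_objs by (metis insertI1)
  next
    case (pullback U A B)
    then show ?case using Un_objs by (auto simp: Un_assoc)
  next
    case (composition U A W)
    show ?case
    proof (intro ballI impI)
      fix B assume B: "B \<in> objs S" and W: "\<forall>V \<in> \<Union>(W ` U). V \<union> B \<in> T"
      have "V \<union> B \<in> T" if "V \<in> U" for V
        using composition.IH(2)[OF that] B W that by blast
      then show "A \<union> B \<in> T" using composition.IH(1) B by blast
    qed
  qed
  note step = this
  have empty: "{} \<in> objs S" by (simp add: objs_def)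
  have "A \<in> T" if "covers S U A" "U \<subseteq> T" for U A
    using bspec[OF step[OF that(1)] empty] that(2) by auto
  then show ?thesis unfolding sheaf_def using assms(1) down by blast
qed

lemma sheaf_residual:
  assumes "sheaf S T" "A \<in> objs S"
  shows "sheaf S {V \<in> objs S. A \<union> V \<in> T}"
  unfolding sheaf_def
proof (intro conjI ballI allI impI)
  fix V B assume "V \<in> {V \<in> objs S. A \<union> V \<in> T}" "B \<in> objs S" "obj_le S B V"
  then show "B \<in> {V \<in> objs S. A \<union> V \<in> T}"
    using assms Un_objs obj_le_Un[of A B V] by (auto simp: sheaf_def Un_commute)
next
  fix U V assume c: "covers S U V" and "U \<subseteq> {V \<in> objs S. A \<union> V \<in> T}"
  then have "(\<lambda>V. V \<union> A) ` U \<subseteq> T" by (auto simp: Un_commute)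
  then have "V \<union> A \<in> T" using covers.pullback[OF c assms(2)] assms(1) by (auto simp: sheaf_def)
  then show "V \<in> {V \<in> objs S. A \<union> V \<in> T}" using covers_objs[OF c] by (auto simp: Un_commute)
qed auto

lemma sheaf_Inter: "\<A> \<subseteq> {T. sheaf S T} \<Longrightarrow> sheaf S (objs S \<inter> \<Inter>\<A>)"
  using covers_objs unfolding sheaf_def by blast

lemma presented: "presented_frame (objs S) {T. sheaf S T} (\<union>) {}"
proof
  show "u \<union> v \<in> U \<inter> V"
    if UV: "U \<in> {T. sheaf S T}" "V \<in> {T. sheaf S T}" "u \<in> U" "v \<in> V" for U V u v
  proof -
    have "u \<in> objs S" "v \<in> objs S" using UV by (auto simp: sheaf_def)
    then have o: "u \<union> v \<in> objs S" by (rule Un_objs)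
    then have "obj_le S (u \<union> v) u" "obj_le S (u \<union> v) v" by (auto intro: obj_le_superset)
    then show ?thesis using UV o unfolding sheaf_def by blast
  qed
next
  show "U \<subseteq> objs S" if "U \<in> {T. sheaf S T}" for U using that by (simp add: sheaf_def)
  show "objs S \<inter> \<Inter>\<A> \<in> {T. sheaf S T}" if "\<A> \<subseteq> {T. sheaf S T}" for \<A>
    using sheaf_Inter[OF that] by simp
  show "{v \<in> objs S. u \<union> v \<in> U} \<in> {T. sheaf S T}" if "U \<in> {T. sheaf S T}" "u \<in> objs S" for U u
    using sheaf_residual that by simp
qed (auto simp: objs_def)

end

sublocale generated_site \<subseteq> frame: presented_frame "objs S" "{T. sheaf S T}" "(\<union>)" "{}"
  by (rule presented)

context generated_site
begin

lemma sharp_eq: "sharp S = frame.cl"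
  by (auto simp: sharp_def frame.cl_def fun_eq_iff)

lemma localic_sheaves: "localic (sheaf_locale S)"
  using frame.localic_L by (simp add: sheaf_locale_def)

lemma sharp_closed: "A \<in> objs S \<Longrightarrow> sharp S A \<in> carrier (sheaf_locale S)"
  using frame.cl_closed by (simp add: sharp_eq sheaf_locale_def)

lemma gen_objs: "d \<in> gens S \<Longrightarrow> {d} \<in> objs S"
  by (simp add: objs_def)

lemma gen_closed: "d \<in> gens S \<Longrightarrow> sharp S {d} \<in> carrier (sheaf_locale S)"
  by (intro sharp_closed gen_objs)

lemma sharp_Un:
  assumes "A \<in> objs S" "B \<in> objs S"
  shows "sharp S (A \<union> B) = sharp S A \<sqinter>\<^bsub>sheaf_locale S\<^esub> sharp S B"
  using assms frame.cl_mt[of A B] frame.meet_eq[of "sharp S A" "sharp S B"] Un_objs[of A B]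
    frame.cl_closed
  by (simp add: sharp_eq sheaf_locale_def)

lemma sharp_empty: "sharp S {} = \<top>\<^bsub>sheaf_locale S\<^esub>"
  using frame.unit_is_top frame.top_eq by (simp add: sharp_eq sheaf_locale_def)

lemma sharp_mono:
  assumes "A \<in> objs S" "B \<in> objs S" "obj_le S A B"
  shows "sharp S A \<sqsubseteq>\<^bsub>sheaf_locale S\<^esub> sharp S B"
proof -
  have "A \<in> sharp S B"
    using frame.cl_closed[OF assms(2)] frame.cl_mem[of B] assms by (auto simp: sharp_eq sheaf_def)
  then show ?thesis
    using frame.cl_least[OF frame.cl_closed[OF assms(2)]] by (simp add: sharp_eq sheaf_locale_def)
qed

lemma sharp_cover:
  assumes "(U, A) \<in> basic S"
  shows "sharp S A \<sqsubseteq>\<^bsub>sheaf_locale S\<^esub> \<Squnion>\<^bsub>sheaf_locale S\<^esub>(sharp S ` U)"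
proof -
  interpret L: localic "sheaf_locale S" by (rule localic_sheaves)
  let ?K = "\<Squnion>\<^bsub>sheaf_locale S\<^esub>(sharp S ` U)"
  have c: "sharp S ` U \<subseteq> carrier (sheaf_locale S)"
    using basic_family[OF assms] sharp_closed by auto
  then have K: "sheaf S ?K" using L.sup_closed by (simp add: sheaf_locale_def inclusion_order_def)
  have "V \<in> ?K" if "V \<in> U" for V
    using L.sup_upper[OF c, of "sharp S V"] that frame.cl_mem[of V]
    by (auto simp: sharp_eq sheaf_locale_def inclusion_order_def)
  then have "A \<in> ?K" using K covers.basic[OF assms] unfolding sheaf_def by blast
  then show ?thesis
    using frame.cl_least[of ?K A] K by (simp add: sharp_eq sheaf_locale_def inclusion_order_def)
qed

lemma hom_ext_gens:
  assumes "locale_hom (sheaf_locale S) N f" "locale_hom (sheaf_locale S) N g"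
    and gens: "\<And>d. d \<in> gens S \<Longrightarrow> f (sharp S {d}) = g (sharp S {d})"
    and "T \<in> carrier (sheaf_locale S)"
  shows "f T = g T"
proof -
  have "f (sharp S A) = g (sharp S A)" if "A \<in> objs S" for A
  proof -
    have "finite A" "A \<subseteq> gens S" using that by (auto simp: objs_def)
    then show ?thesis
    proof (induction A)
      case empty
      show ?case using assms(1,2) by (simp add: sharp_empty locale_hom_top)
    next
      case (insert d A)
      then have o: "{d} \<in> objs S" "A \<in> objs S" by (auto simp: objs_def)
      then have "sharp S (insert d A) = sharp S {d} \<sqinter>\<^bsub>sheaf_locale S\<^esub> sharp S A"
        using sharp_Un[of "{d}" A] by simp
      then show ?case
        using insert gens[of d] o assms(1,2) by (simp add: locale_hom_meet sharp_closed)
    qed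
  qed
  then show ?thesis
    using frame.hom_ext[of N f g T] assms by (simp add: sharp_eq sheaf_locale_def)
qed

text \<open>
  The universal property of the sheaves on a site: a monotone assignment on the generators that
  respects the basic covers extends to an arrow of locales. Respecting basic covers is enough, by
  \<open>sheafI\<close> and distributivity in \<open>N\<close>.
\<close>

lemma extend_hom:
  fixes N (structure)
  assumes "localic N"
    and \<phi>: "\<And>d. d \<in> gens S \<Longrightarrow> \<phi> d \<in> carrier N"
    and mono: "\<And>d d'. d \<in> gens S \<Longrightarrow> d' \<in> gens S \<Longrightarrow> gle S d d' \<Longrightarrow> \<phi> d \<sqsubseteq> \<phi> d'"
    and cover: "\<And>U A. (U, A) \<in> basic S \<Longrightarrow> \<Sqinter>(\<phi> ` A) \<sqsubseteq> \<Squnion>((\<lambda>V. \<Sqinter>(\<phi> ` V)) ` U)"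
  shows "locale_hom (sheaf_locale S) N (extend N \<phi>)"
    and "d \<in> gens S \<Longrightarrow> extend N \<phi> (sharp S {d}) = \<phi> d"
proof -
  interpret N: localic N by fact
  let ?h = "\<lambda>A. \<Sqinter>(\<phi> ` A)"
  have sub: "\<phi> ` A \<subseteq> carrier N" if "A \<in> objs S" for A using that \<phi> by (auto simp: objs_def)
  have h: "?h A \<in> carrier N" if "A \<in> objs S" for A using sub[OF that] by simp
  have h_Un: "?h (A \<union> B) = ?h A \<sqinter> ?h B" if "A \<in> objs S" "B \<in> objs S" for A B
    using N.inf_Un[of "\<phi> ` A" "\<phi> ` B"] sub that by (simp add: image_Un)
  have h_mono: "?h A \<sqsubseteq> ?h B" if AB: "A \<in> objs S" "B \<in> objs S" "obj_le S A B" for A B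
  proof (rule N.inf_greatest)
    show "\<phi> ` B \<subseteq> carrier N" "?h A \<in> carrier N" using AB sub h by auto
    fix x assume "x \<in> \<phi> ` B"
    then obtain b where b: "b \<in> B" "x = \<phi> b" by auto
    then obtain a where a: "a \<in> A" "gle S a b" using AB by (auto simp: obj_le_def)
    have g: "a \<in> gens S" "b \<in> gens S" using a b AB by (auto simp: objs_def)
    have "?h A \<sqsubseteq> \<phi> a" using N.inf_lower[OF sub[OF AB(1)]] a by auto
    then show "?h A \<sqsubseteq> x"
      using N.le_trans[of "?h A" "\<phi> a" "\<phi> b"] mono[OF g a(2)] h[OF AB(1)] \<phi> g b by simp
  qed
  have below: "{A \<in> objs S. ?h A \<sqsubseteq> n} \<in> {T. sheaf S T}" if n: "n \<in> carrier N" for n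
    unfolding mem_Collect_eq
  proof (rule sheafI)
    fix A B assume "A \<in> {A \<in> objs S. ?h A \<sqsubseteq> n}" "B \<in> objs S" "obj_le S B A"
    then show "B \<in> {A \<in> objs S. ?h A \<sqsubseteq> n}"
      using N.le_trans[of "?h B" "?h A" n] h_mono[of B A] h n by auto
  next
    fix U A B assume b: "(U, A) \<in> basic S" and B: "B \<in> objs S"
      and V: "\<And>V. V \<in> U \<Longrightarrow> V \<union> B \<in> {A \<in> objs S. ?h A \<sqsubseteq> n}"
    have A: "A \<in> objs S" and U: "U \<subseteq> objs S" using b basic_objs basic_family by auto
    have hU: "?h ` U \<subseteq> carrier N" using U h by auto
    have "?h A \<sqinter> ?h B \<sqsubseteq> \<Squnion>(?h ` U) \<sqinter> ?h B"
      using cover[OF b] h A B hU by (intro N.meet_mono N.le_refl N.sup_closed) auto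
    moreover have "\<Squnion>(?h ` U) \<sqinter> ?h B = \<Squnion>((\<lambda>V. ?h (V \<union> B)) ` U)"
    proof -
      have "?h V \<sqinter> ?h B = ?h (V \<union> B)" if "V \<in> U" for V using h_Un[OF _ B] U that by auto
      then show ?thesis using N.sup_meet[OF h[OF B] hU] by (simp add: image_image)
    qed
    moreover have "\<Squnion>((\<lambda>V. ?h (V \<union> B)) ` U) \<sqsubseteq> n" using V n h by (intro N.sup_least) auto
    moreover have "\<Squnion>(?h ` U) \<sqinter> ?h B \<in> carrier N"
      using N.sup_closed[OF hU] h[OF B] by (rule N.meet_closed)
    moreover have "?h A \<sqinter> ?h B \<in> carrier N" using h[OF A] h[OF B] by (rule N.meet_closed)
    ultimately have "?h A \<sqinter> ?h B \<sqsubseteq> n" using N.le_trans n by metis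
    then have "?h (A \<union> B) \<sqsubseteq> n" using h_Un[OF A B] by simp
    then show "A \<union> B \<in> {A \<in> objs S. ?h A \<sqsubseteq> n}" using Un_objs[OF A B] by simp
  qed auto
  have h_empty: "?h {} = \<top>" by simp
  show "locale_hom (sheaf_locale S) N (extend N \<phi>)"
    using frame.hom_from_points(1)[of N ?h, OF assms(1) h h_empty h_Un below]
    by (simp add: extend_def[abs_def] sheaf_locale_def)
  assume d: "d \<in> gens S"
  show "extend N \<phi> (sharp S {d}) = \<phi> d"
    using frame.hom_from_points(2)[of N ?h, OF assms(1) h h_empty h_Un below gen_objs[OF d]] \<phi>[OF d]
    by (simp add: extend_def sharp_eq)
qed

end

section \<open>The coproduct of two locales\<close>

text \<open>
  Bi-ideals are the closed sets of a presentation whose basic opens are the pairs \<open>(a, b)\<close> with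
  componentwise meet; distributivity in the two factors is exactly the stability required of the
  residuals. The universal property \<open>copair_hom\<close> is then an instance of \<open>hom_from_points\<close>.
\<close>

locale locale_pair = L: localic L + M: localic M
  for L :: "('a, 'x) gorder_scheme" and M :: "('b, 'y) gorder_scheme"
begin

definition pair_meet :: "'a \<times> 'b \<Rightarrow> 'a \<times> 'b \<Rightarrow> 'a \<times> 'b" where
  "pair_meet u v = (fst u \<sqinter>\<^bsub>L\<^esub> fst v, snd u \<sqinter>\<^bsub>M\<^esub> snd v)"

lemma bi_idealI:
  assumes "U \<subseteq> carrier L \<times> carrier M"
    and "\<And>a b a' b'. (a, b) \<in> U \<Longrightarrow> a' \<in> carrier L \<Longrightarrow> b' \<in> carrier M \<Longrightarrow> a' \<sqsubseteq>\<^bsub>L\<^esub> a \<Longrightarrow> b' \<sqsubseteq>\<^bsub>M\<^esub> b \<Longrightarrow> (a', b') \<in> U"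
    and "\<And>A b. A \<subseteq> carrier L \<Longrightarrow> b \<in> carrier M \<Longrightarrow> (\<And>a. a \<in> A \<Longrightarrow> (a, b) \<in> U) \<Longrightarrow> (\<Squnion>\<^bsub>L\<^esub>A, b) \<in> U"
    and "\<And>a B. a \<in> carrier L \<Longrightarrow> B \<subseteq> carrier M \<Longrightarrow> (\<And>b. b \<in> B \<Longrightarrow> (a, b) \<in> U) \<Longrightarrow> (a, \<Squnion>\<^bsub>M\<^esub>B) \<in> U"
  shows "bi_ideal L M U"
  unfolding bi_ideal_def
proof (intro conjI allI impI)
  show "\<forall>(a, b)\<in>U. \<forall>a'\<in>carrier L. \<forall>b'\<in>carrier M. a' \<sqsubseteq>\<^bsub>L\<^esub> a \<longrightarrow> b' \<sqsubseteq>\<^bsub>M\<^esub> b \<longrightarrow> (a', b') \<in> U"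
    using assms(2) by blast
  show "U \<subseteq> carrier L \<times> carrier M" by (rule assms(1))
  show "(\<Squnion>\<^bsub>L\<^esub>A, b) \<in> U" if "A \<subseteq> carrier L" "b \<in> carrier M" "A \<times> {b} \<subseteq> U" for A b
    using that by (intro assms(3)) auto
  show "(a, \<Squnion>\<^bsub>M\<^esub>B) \<in> U" if "a \<in> carrier L" "B \<subseteq> carrier M" "{a} \<times> B \<subseteq> U" for a B
    using that by (intro assms(4)) auto
qed

lemma bi_idealD:
  assumes "bi_ideal L M U"
  shows "U \<subseteq> carrier L \<times> carrier M"
    and "(a, b) \<in> U \<Longrightarrow> a' \<in> carrier L \<Longrightarrow> b' \<in> carrier M \<Longrightarrow> a' \<sqsubseteq>\<^bsub>L\<^esub> a \<Longrightarrow> b' \<sqsubseteq>\<^bsub>M\<^esub> b \<Longrightarrow> (a', b') \<in> U"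
    and "A \<subseteq> carrier L \<Longrightarrow> b \<in> carrier M \<Longrightarrow> (\<And>a. a \<in> A \<Longrightarrow> (a, b) \<in> U) \<Longrightarrow> (\<Squnion>\<^bsub>L\<^esub>A, b) \<in> U"
    and "a \<in> carrier L \<Longrightarrow> B \<subseteq> carrier M \<Longrightarrow> (\<And>b. b \<in> B \<Longrightarrow> (a, b) \<in> U) \<Longrightarrow> (a, \<Squnion>\<^bsub>M\<^esub>B) \<in> U"
proof -
  note * = assms[unfolded bi_ideal_def]
  show "U \<subseteq> carrier L \<times> carrier M" by (rule conjunct1[OF *])
  show "(a, b) \<in> U \<Longrightarrow> a' \<in> carrier L \<Longrightarrow> b' \<in> carrier M \<Longrightarrow> a' \<sqsubseteq>\<^bsub>L\<^esub> a \<Longrightarrow> b' \<sqsubseteq>\<^bsub>M\<^esub> b \<Longrightarrow> (a', b') \<in> U"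
    using bspec[OF conjunct1[OF conjunct2[OF *]], of "(a, b)"] by simp
  note 1 = conjunct1[OF conjunct2[OF conjunct2[OF *]], rule_format]
    and 2 = conjunct2[OF conjunct2[OF conjunct2[OF *]], rule_format]
  show "A \<subseteq> carrier L \<Longrightarrow> b \<in> carrier M \<Longrightarrow> (\<And>a. a \<in> A \<Longrightarrow> (a, b) \<in> U) \<Longrightarrow> (\<Squnion>\<^bsub>L\<^esub>A, b) \<in> U"
    by (rule 1) auto
  show "a \<in> carrier L \<Longrightarrow> B \<subseteq> carrier M \<Longrightarrow> (\<And>b. b \<in> B \<Longrightarrow> (a, b) \<in> U) \<Longrightarrow> (a, \<Squnion>\<^bsub>M\<^esub>B) \<in> U"
    by (rule 2) auto
qed

lemma bi_ideal_Inter: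
  assumes "\<A> \<subseteq> {U. bi_ideal L M U}"
  shows "bi_ideal L M (carrier L \<times> carrier M \<inter> \<Inter>\<A>)"
proof -
  have *: "bi_ideal L M U" if "U \<in> \<A>" for U using assms that by auto
  show ?thesis
  proof (rule bi_idealI)
    fix a b a' b'
    assume "(a, b) \<in> carrier L \<times> carrier M \<inter> \<Inter>\<A>" "a' \<in> carrier L" "b' \<in> carrier M" "a' \<sqsubseteq>\<^bsub>L\<^esub> a" "b' \<sqsubseteq>\<^bsub>M\<^esub> b"
    then show "(a', b') \<in> carrier L \<times> carrier M \<inter> \<Inter>\<A>"
      using bi_idealD(2)[OF *, of _ a b a' b'] by simp
  next
    fix A b assume A: "A \<subseteq> carrier L" "b \<in> carrier M"
      "\<And>a. a \<in> A \<Longrightarrow> (a, b) \<in> carrier L \<times> carrier M \<inter> \<Inter>\<A>"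
    have "(\<Squnion>\<^bsub>L\<^esub>A, b) \<in> U" if "U \<in> \<A>" for U
      using A(3) that by (rule_tac bi_idealD(3)[OF *[OF that] A(1,2)]) simp
    then show "(\<Squnion>\<^bsub>L\<^esub>A, b) \<in> carrier L \<times> carrier M \<inter> \<Inter>\<A>" using A(1,2) by simp
  next
    fix a B assume A: "a \<in> carrier L" "B \<subseteq> carrier M"
      "\<And>b. b \<in> B \<Longrightarrow> (a, b) \<in> carrier L \<times> carrier M \<inter> \<Inter>\<A>"
    have "(a, \<Squnion>\<^bsub>M\<^esub>B) \<in> U" if "U \<in> \<A>" for U
      using A(3) that by (rule_tac bi_idealD(4)[OF *[OF that] A(1,2)]) simp
    then show "(a, \<Squnion>\<^bsub>M\<^esub>B) \<in> carrier L \<times> carrier M \<inter> \<Inter>\<A>" using A(1,2) by simp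
  qed simp
qed

lemma bi_ideal_residual:
  assumes U: "bi_ideal L M U" and u: "u \<in> carrier L \<times> carrier M"
  shows "bi_ideal L M {v \<in> carrier L \<times> carrier M. pair_meet u v \<in> U}"
proof -
  obtain x y where xy: "u = (x, y)" "x \<in> carrier L" "y \<in> carrier M" using u by auto
  have pm: "pair_meet (x, y) (a, b) = (x \<sqinter>\<^bsub>L\<^esub> a, y \<sqinter>\<^bsub>M\<^esub> b)" for a b by (simp add: pair_meet_def)
  show ?thesis
  proof (rule bi_idealI)
    fix a b a' b'
    assume *: "(a, b) \<in> {v \<in> carrier L \<times> carrier M. pair_meet u v \<in> U}"
      "a' \<in> carrier L" "b' \<in> carrier M" "a' \<sqsubseteq>\<^bsub>L\<^esub> a" "b' \<sqsubseteq>\<^bsub>M\<^esub> b"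
    then have "(x \<sqinter>\<^bsub>L\<^esub> a', y \<sqinter>\<^bsub>M\<^esub> b') \<in> U"
      using xy by (rule_tac bi_idealD(2)[OF U, of "x \<sqinter>\<^bsub>L\<^esub> a" "y \<sqinter>\<^bsub>M\<^esub> b"])
        (auto simp: pm intro!: L.meet_mono M.meet_mono)
    then show "(a', b') \<in> {v \<in> carrier L \<times> carrier M. pair_meet u v \<in> U}" using * xy by (simp add: pm)
  next
    fix A b assume *: "A \<subseteq> carrier L" "b \<in> carrier M"
      "\<And>a. a \<in> A \<Longrightarrow> (a, b) \<in> {v \<in> carrier L \<times> carrier M. pair_meet u v \<in> U}"
    then have "(\<Squnion>\<^bsub>L\<^esub>((\<lambda>a. x \<sqinter>\<^bsub>L\<^esub> a) ` A), y \<sqinter>\<^bsub>M\<^esub> b) \<in> U"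
      using xy by (rule_tac bi_idealD(3)[OF U]) (auto simp: pm)
    then show "(\<Squnion>\<^bsub>L\<^esub>A, b) \<in> {v \<in> carrier L \<times> carrier M. pair_meet u v \<in> U}"
      using * xy by (simp add: pm L.meet_sup)
  next
    fix a B assume *: "a \<in> carrier L" "B \<subseteq> carrier M"
      "\<And>b. b \<in> B \<Longrightarrow> (a, b) \<in> {v \<in> carrier L \<times> carrier M. pair_meet u v \<in> U}"
    then have "(x \<sqinter>\<^bsub>L\<^esub> a, \<Squnion>\<^bsub>M\<^esub>((\<lambda>b. y \<sqinter>\<^bsub>M\<^esub> b) ` B)) \<in> U"
      using xy by (rule_tac bi_idealD(4)[OF U]) (auto simp: pm)
    then show "(a, \<Squnion>\<^bsub>M\<^esub>B) \<in> {v \<in> carrier L \<times> carrier M. pair_meet u v \<in> U}"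
      using * xy by (simp add: pm M.meet_sup)
  qed auto
qed

lemma presented:
  "presented_frame (carrier L \<times> carrier M) {U. bi_ideal L M U} pair_meet (\<top>\<^bsub>L\<^esub>, \<top>\<^bsub>M\<^esub>)"
proof
  fix U V u v
  assume *: "U \<in> {U. bi_ideal L M U}" "V \<in> {U. bi_ideal L M U}" "u \<in> U" "v \<in> V"
  then have "u \<in> carrier L \<times> carrier M" "v \<in> carrier L \<times> carrier M"
    using bi_idealD(1) by blast+
  then have c: "fst u \<in> carrier L" "fst v \<in> carrier L" "snd u \<in> carrier M" "snd v \<in> carrier M" by auto
  have "pair_meet u v \<in> U" unfolding pair_meet_def
    using * c by (rule_tac bi_idealD(2)[of U "fst u" "snd u"]) (auto intro: L.meet_left M.meet_left)
  moreover have "pair_meet u v \<in> V" unfolding pair_meet_def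
    using * c by (rule_tac bi_idealD(2)[of V "fst v" "snd v"]) (auto intro: L.meet_right M.meet_right)
  ultimately show "pair_meet u v \<in> U \<inter> V" by simp
next
  show "pair_meet u u = u" if "u \<in> carrier L \<times> carrier M" for u
    using that by (auto simp: pair_meet_def L.meet_idem M.meet_idem)
  show "pair_meet u v = pair_meet v u" for u v
    by (simp add: pair_meet_def meet_comm)
next
  show "U \<subseteq> carrier L \<times> carrier M" if "U \<in> {U. bi_ideal L M U}" for U using that bi_idealD(1) by simp
  show "carrier L \<times> carrier M \<inter> \<Inter>\<A> \<in> {U. bi_ideal L M U}" if "\<A> \<subseteq> {U. bi_ideal L M U}" for \<A>
    using bi_ideal_Inter[OF that] by simp
  show "{v \<in> carrier L \<times> carrier M. pair_meet u v \<in> U} \<in> {U. bi_ideal L M U}"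
    if "U \<in> {U. bi_ideal L M U}" "u \<in> carrier L \<times> carrier M" for U u
    using bi_ideal_residual that by simp
qed auto

end

sublocale locale_pair \<subseteq> frame: presented_frame
  "carrier L \<times> carrier M" "{U. bi_ideal L M U}" pair_meet "(\<top>\<^bsub>L\<^esub>, \<top>\<^bsub>M\<^esub>)"
  by (rule presented)

context locale_pair
begin

abbreviation LM :: "('a \<times> 'b) set gorder" where "LM \<equiv> tensor L M"

lemma tens_eq: "tens L M a b = frame.cl (a, b)"
  by (simp add: tens_def frame.cl_def)

lemma localic_tensor: "localic LM"
  using frame.localic_L by (simp add: tensor_def)

lemma tens_closed: "a \<in> carrier L \<Longrightarrow> b \<in> carrier M \<Longrightarrow> tens L M a b \<in> carrier LM"
  using frame.cl_closed[of "(a, b)"] by (simp add: tens_eq tensor_def)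

lemma tens_meet:
  assumes "a \<in> carrier L" "b \<in> carrier M" "a' \<in> carrier L" "b' \<in> carrier M"
  shows "tens L M (a \<sqinter>\<^bsub>L\<^esub> a') (b \<sqinter>\<^bsub>M\<^esub> b') = tens L M a b \<sqinter>\<^bsub>LM\<^esub> tens L M a' b'"
  using assms frame.cl_mt[of "(a, b)" "(a', b')"] frame.meet_eq[OF frame.cl_closed frame.cl_closed, of "(a, b)" "(a', b')"]
  by (simp add: tens_eq tensor_def pair_meet_def)

lemma tens_top: "tens L M \<top>\<^bsub>L\<^esub> \<top>\<^bsub>M\<^esub> = \<top>\<^bsub>LM\<^esub>"
  using frame.unit_is_top frame.top_eq by (auto simp: tens_eq tensor_def pair_meet_def)

lemma tens_split:
  assumes "a \<in> carrier L" "b \<in> carrier M"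
  shows "tens L M a b = inj1 L M a \<sqinter>\<^bsub>LM\<^esub> inj2 L M b"
  using tens_meet[of a "\<top>\<^bsub>M\<^esub>" "\<top>\<^bsub>L\<^esub>" b] assms by (simp add: inj1_def inj2_def)

lemma tens_sup1:
  assumes "A \<subseteq> carrier L" "b \<in> carrier M"
  shows "tens L M (\<Squnion>\<^bsub>L\<^esub>A) b = \<Squnion>\<^bsub>LM\<^esub>((\<lambda>a. tens L M a b) ` A)"
proof -
  interpret T: localic LM by (rule localic_tensor)
  let ?K = "\<Squnion>\<^bsub>LM\<^esub>((\<lambda>a. tens L M a b) ` A)"
  have c: "(\<lambda>a. tens L M a b) ` A \<subseteq> carrier LM" using assms tens_closed by auto
  then have "?K \<in> carrier LM" by simp
  then have K: "bi_ideal L M ?K" by (simp add: tensor_def inclusion_order_def)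
  have "(a, b) \<in> ?K" if "a \<in> A" for a
    using T.sup_upper[OF c, of "tens L M a b"] that frame.cl_mem[of "(a, b)"]
    by (auto simp: tens_eq tensor_def inclusion_order_def)
  then have "(\<Squnion>\<^bsub>L\<^esub>A, b) \<in> ?K" using assms by (rule_tac bi_idealD(3)[OF K])
  then have le: "tens L M (\<Squnion>\<^bsub>L\<^esub>A) b \<sqsubseteq>\<^bsub>LM\<^esub> ?K"
    using frame.cl_least[of ?K] K by (simp add: tens_eq tensor_def inclusion_order_def)
  have "tens L M a b \<sqsubseteq>\<^bsub>LM\<^esub> tens L M (\<Squnion>\<^bsub>L\<^esub>A) b" if "a \<in> A" for a
  proof -
    have J: "bi_ideal L M (tens L M (\<Squnion>\<^bsub>L\<^esub>A) b)"
      using tens_closed assms by (simp add: tensor_def inclusion_order_def)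
    have "(a, b) \<in> tens L M (\<Squnion>\<^bsub>L\<^esub>A) b"
      using assms that frame.cl_mem[of "(\<Squnion>\<^bsub>L\<^esub>A, b)"] 
      by (rule_tac bi_idealD(2)[OF J, of "\<Squnion>\<^bsub>L\<^esub>A" b]) (auto simp: tens_eq intro: L.sup_upper)
    then show ?thesis
      using frame.cl_least[of "tens L M (\<Squnion>\<^bsub>L\<^esub>A) b" "(a, b)"] J
      by (simp add: tens_eq tensor_def inclusion_order_def)
  qed
  then have "?K \<sqsubseteq>\<^bsub>LM\<^esub> tens L M (\<Squnion>\<^bsub>L\<^esub>A) b"
    using assms by (intro T.sup_least[OF c] tens_closed) auto
  then show ?thesis using le c assms by (intro T.le_antisym tens_closed T.sup_closed) auto
qed

lemma tens_sup2:
  assumes "a \<in> carrier L" "B \<subseteq> carrier M"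
  shows "tens L M a (\<Squnion>\<^bsub>M\<^esub>B) = \<Squnion>\<^bsub>LM\<^esub>((\<lambda>b. tens L M a b) ` B)"
proof -
  interpret T: localic LM by (rule localic_tensor)
  let ?K = "\<Squnion>\<^bsub>LM\<^esub>((\<lambda>b. tens L M a b) ` B)"
  have c: "(\<lambda>b. tens L M a b) ` B \<subseteq> carrier LM" using assms tens_closed by auto
  then have "?K \<in> carrier LM" by simp
  then have K: "bi_ideal L M ?K" by (simp add: tensor_def inclusion_order_def)
  have "(a, b) \<in> ?K" if "b \<in> B" for b
    using T.sup_upper[OF c, of "tens L M a b"] that frame.cl_mem[of "(a, b)"]
    by (auto simp: tens_eq tensor_def inclusion_order_def)
  then have "(a, \<Squnion>\<^bsub>M\<^esub>B) \<in> ?K" using assms by (rule_tac bi_idealD(4)[OF K])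
  then have le: "tens L M a (\<Squnion>\<^bsub>M\<^esub>B) \<sqsubseteq>\<^bsub>LM\<^esub> ?K"
    using frame.cl_least[of ?K] K by (simp add: tens_eq tensor_def inclusion_order_def)
  have "tens L M a b \<sqsubseteq>\<^bsub>LM\<^esub> tens L M a (\<Squnion>\<^bsub>M\<^esub>B)" if "b \<in> B" for b
  proof -
    have J: "bi_ideal L M (tens L M a (\<Squnion>\<^bsub>M\<^esub>B))"
      using tens_closed assms by (simp add: tensor_def inclusion_order_def)
    have "(a, b) \<in> tens L M a (\<Squnion>\<^bsub>M\<^esub>B)"
      using assms that frame.cl_mem[of "(a, \<Squnion>\<^bsub>M\<^esub>B)"] 
      by (rule_tac bi_idealD(2)[OF J, of a "\<Squnion>\<^bsub>M\<^esub>B"]) (auto simp: tens_eq intro: M.sup_upper)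
    then show ?thesis
      using frame.cl_least[of "tens L M a (\<Squnion>\<^bsub>M\<^esub>B)" "(a, b)"] J
      by (simp add: tens_eq tensor_def inclusion_order_def)
  qed
  then have "?K \<sqsubseteq>\<^bsub>LM\<^esub> tens L M a (\<Squnion>\<^bsub>M\<^esub>B)"
    using assms by (intro T.sup_least[OF c] tens_closed) auto
  then show ?thesis using le c assms by (intro T.le_antisym tens_closed T.sup_closed) auto
qed

lemma tens_bottom1: "b \<in> carrier M \<Longrightarrow> tens L M \<bottom>\<^bsub>L\<^esub> b = \<bottom>\<^bsub>LM\<^esub>"
  using tens_sup1[of "{}" b] localic.sup_empty[OF localic_tensor] by simp

lemma tens_bottom2: "a \<in> carrier L \<Longrightarrow> tens L M a \<bottom>\<^bsub>M\<^esub> = \<bottom>\<^bsub>LM\<^esub>"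
  using tens_sup2[of a "{}"] localic.sup_empty[OF localic_tensor] by simp

lemma tens_mono:
  assumes "a \<sqsubseteq>\<^bsub>L\<^esub> a'" "b \<sqsubseteq>\<^bsub>M\<^esub> b'" "a \<in> carrier L" "b \<in> carrier M" "a' \<in> carrier L" "b' \<in> carrier M"
  shows "tens L M a b \<sqsubseteq>\<^bsub>LM\<^esub> tens L M a' b'"
proof -
  interpret T: localic LM by (rule localic_tensor)
  have "tens L M a b = tens L M a b \<sqinter>\<^bsub>LM\<^esub> tens L M a' b'"
    using tens_meet[of a b a' b'] assms by (simp add: L.meet_eq_left M.meet_eq_left)
  then show ?thesis using assms by (metis T.meet_right tens_closed)
qed

lemma inj1_hom: "locale_hom L LM (inj1 L M)"
  unfolding locale_hom_def inj1_def
  using tens_closed tens_top tens_sup1 tens_meet[of _ "\<top>\<^bsub>M\<^esub>" _ "\<top>\<^bsub>M\<^esub>"] by auto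

lemma inj2_hom: "locale_hom M LM (inj2 L M)"
  unfolding locale_hom_def inj2_def
  using tens_closed tens_top tens_sup2 tens_meet[of "\<top>\<^bsub>L\<^esub>" _ "\<top>\<^bsub>L\<^esub>"] by auto

lemma copair_hom:
  fixes N :: "('c, 'z) gorder_scheme"
  assumes N: "localic N" and f: "locale_hom L N f" and g: "locale_hom M N g"
  shows "locale_hom LM N (copair N f g)"
    and "a \<in> carrier L \<Longrightarrow> b \<in> carrier M \<Longrightarrow> copair N f g (tens L M a b) = f a \<sqinter>\<^bsub>N\<^esub> g b"
proof -
  interpret N: localic N by fact
  let ?h = "\<lambda>(a, b). f a \<sqinter>\<^bsub>N\<^esub> g b"
  note fc = locale_hom_closed[OF f] and gc = locale_hom_closed[OF g]
  have h: "?h w \<in> carrier N" if "w \<in> carrier L \<times> carrier M" for w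
    using that fc gc by auto
  have unit: "?h (\<top>\<^bsub>L\<^esub>, \<top>\<^bsub>M\<^esub>) = \<top>\<^bsub>N\<^esub>" using f g by (simp add: locale_hom_top)
  have h_mt: "?h (pair_meet u v) = ?h u \<sqinter>\<^bsub>N\<^esub> ?h v"
    if "u \<in> carrier L \<times> carrier M" "v \<in> carrier L \<times> carrier M" for u v
    using that fc gc
    by (auto simp: pair_meet_def locale_hom_meet[OF f] locale_hom_meet[OF g] intro!: N.meet_interchange)
  have below: "{w \<in> carrier L \<times> carrier M. ?h w \<sqsubseteq>\<^bsub>N\<^esub> n} \<in> {U. bi_ideal L M U}"
    if n: "n \<in> carrier N" for n
    unfolding mem_Collect_eq
  proof (rule bi_idealI)
    fix a b a' b'
    assume *: "(a, b) \<in> {w \<in> carrier L \<times> carrier M. ?h w \<sqsubseteq>\<^bsub>N\<^esub> n}"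
      "a' \<in> carrier L" "b' \<in> carrier M" "a' \<sqsubseteq>\<^bsub>L\<^esub> a" "b' \<sqsubseteq>\<^bsub>M\<^esub> b"
    have "f a' \<sqinter>\<^bsub>N\<^esub> g b' \<sqsubseteq>\<^bsub>N\<^esub> f a \<sqinter>\<^bsub>N\<^esub> g b"
      using * fc gc
      by (intro N.meet_mono locale_hom_mono[OF L.localic_axioms N f] locale_hom_mono[OF M.localic_axioms N g])
        auto
    then show "(a', b') \<in> {w \<in> carrier L \<times> carrier M. ?h w \<sqsubseteq>\<^bsub>N\<^esub> n}"
      using * fc gc n N.le_trans[of "f a' \<sqinter>\<^bsub>N\<^esub> g b'" "f a \<sqinter>\<^bsub>N\<^esub> g b" n] by auto
  next
    fix A b assume *: "A \<subseteq> carrier L" "b \<in> carrier M"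
      "\<And>a. a \<in> A \<Longrightarrow> (a, b) \<in> {w \<in> carrier L \<times> carrier M. ?h w \<sqsubseteq>\<^bsub>N\<^esub> n}"
    have "f (\<Squnion>\<^bsub>L\<^esub>A) \<sqinter>\<^bsub>N\<^esub> g b = \<Squnion>\<^bsub>N\<^esub>((\<lambda>a. f a \<sqinter>\<^bsub>N\<^esub> g b) ` A)"
      using * fc gc N.sup_meet[of "g b" "f ` A"]
      by (auto simp: locale_hom_sup[OF f] image_image)
    also have "\<dots> \<sqsubseteq>\<^bsub>N\<^esub> n" using * fc gc n by (intro N.sup_least) auto
    finally show "(\<Squnion>\<^bsub>L\<^esub>A, b) \<in> {w \<in> carrier L \<times> carrier M. ?h w \<sqsubseteq>\<^bsub>N\<^esub> n}" using * by simp
  next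
    fix a B assume *: "a \<in> carrier L" "B \<subseteq> carrier M"
      "\<And>b. b \<in> B \<Longrightarrow> (a, b) \<in> {w \<in> carrier L \<times> carrier M. ?h w \<sqsubseteq>\<^bsub>N\<^esub> n}"
    have "f a \<sqinter>\<^bsub>N\<^esub> g (\<Squnion>\<^bsub>M\<^esub>B) = \<Squnion>\<^bsub>N\<^esub>((\<lambda>b. f a \<sqinter>\<^bsub>N\<^esub> g b) ` B)"
    proof -
      have "g ` B \<subseteq> carrier N" using *(2) gc by auto
      then show ?thesis
        using N.meet_sup[of "f a" "g ` B"] fc[OF *(1)] by (simp add: locale_hom_sup[OF g *(2)] image_image)
    qed
    also have "\<dots> \<sqsubseteq>\<^bsub>N\<^esub> n" using * fc gc n by (intro N.sup_least) auto
    finally show "(a, \<Squnion>\<^bsub>M\<^esub>B) \<in> {w \<in> carrier L \<times> carrier M. ?h w \<sqsubseteq>\<^bsub>N\<^esub> n}" using * by simp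
  qed auto
  note * = frame.hom_from_points[of N ?h, OF N h unit h_mt below]
  show "locale_hom LM N (copair N f g)"
    using *(1) by (simp add: copair_def[abs_def] tensor_def)
  assume "a \<in> carrier L" "b \<in> carrier M"
  then show "copair N f g (tens L M a b) = f a \<sqinter>\<^bsub>N\<^esub> g b"
    using *(2)[of "(a, b)"] by (simp add: copair_def tens_eq)
qed

end

lemma tensor_map_hom:
  assumes "localic A" "localic B" "localic L" "localic M"
    and f: "locale_hom A L f" and g: "locale_hom B M g"
  shows "locale_hom (tensor A B) (tensor L M) (tensor_map L M f g)"
    and "a \<in> carrier A \<Longrightarrow> b \<in> carrier B \<Longrightarrow> tensor_map L M f g (tens A B a b) = tens L M (f a) (g b)"
proof -
  interpret AB: locale_pair A B using assms by (simp add: locale_pair_def)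
  interpret LM: locale_pair L M using assms by (simp add: locale_pair_def)
  note h = locale_hom_comp[OF f LM.inj1_hom] locale_hom_comp[OF g LM.inj2_hom]
  show "locale_hom (tensor A B) (tensor L M) (tensor_map L M f g)"
    unfolding tensor_map_def by (rule AB.copair_hom(1)[OF LM.localic_tensor h])
  assume "a \<in> carrier A" "b \<in> carrier B"
  then show "tensor_map L M f g (tens A B a b) = tens L M (f a) (g b)"
    using AB.copair_hom(2)[OF LM.localic_tensor h] LM.tens_split locale_hom_closed[OF f] locale_hom_closed[OF g]
    by (simp add: tensor_map_def)
qed

lemma tensor_assoc_hom:
  assumes "localic L" "localic M" "localic N"
  shows "locale_hom (tensor L (tensor M N)) (tensor (tensor L M) N) (tensor_assoc L M N)"
    and "a \<in> carrier L \<Longrightarrow> b \<in> carrier M \<Longrightarrow> c \<in> carrier N \<Longrightarrow>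
      tensor_assoc L M N (tens L (tensor M N) a (tens M N b c)) = tens (tensor L M) N (tens L M a b) c"
proof -
  interpret LM: locale_pair L M using assms by (simp add: locale_pair_def)
  interpret MN: locale_pair M N using assms by (simp add: locale_pair_def)
  interpret L_MN: locale_pair L "tensor M N" using assms MN.localic_tensor by (simp add: locale_pair_def)
  interpret LM_N: locale_pair "tensor L M" N using assms LM.localic_tensor by (simp add: locale_pair_def)
  interpret T: localic "tensor (tensor L M) N" by (rule LM_N.localic_tensor)
  note i1 = LM_N.inj1_hom and i2 = LM_N.inj2_hom
  note l = locale_hom_comp[OF LM.inj1_hom i1] and m = locale_hom_comp[OF LM.inj2_hom i1]
  note mn = MN.copair_hom[OF T.localic_axioms m i2]
  note all = L_MN.copair_hom[OF T.localic_axioms l mn(1)]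
  show "locale_hom (tensor L (tensor M N)) (tensor (tensor L M) N) (tensor_assoc L M N)"
    unfolding tensor_assoc_def by (rule all(1))
  assume *: "a \<in> carrier L" "b \<in> carrier M" "c \<in> carrier N"
  have c: "inj1 L M a \<in> carrier (tensor L M)" "inj2 L M b \<in> carrier (tensor L M)"
    using * locale_hom_closed[OF LM.inj1_hom] locale_hom_closed[OF LM.inj2_hom] by auto
  have "tensor_assoc L M N (tens L (tensor M N) a (tens M N b c)) =
      inj1 (tensor L M) N (inj1 L M a) \<sqinter>\<^bsub>tensor (tensor L M) N\<^esub>
      (inj1 (tensor L M) N (inj2 L M b) \<sqinter>\<^bsub>tensor (tensor L M) N\<^esub> inj2 (tensor L M) N c)"
    unfolding tensor_assoc_def using all(2)[OF *(1) MN.tens_closed[OF *(2,3)]] mn(2)[OF *(2,3)] by simp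
  also have "\<dots> = tens (tensor L M) N (tens L M a b) c"
    using * c locale_hom_closed[OF i1] locale_hom_closed[OF i2] locale_hom_meet[OF i1 c]
      LM.tens_split LM_N.tens_split[OF LM.tens_closed]
    by (simp add: T.meet_assoc)
  finally show "tensor_assoc L M N (tens L (tensor M N) a (tens M N b c)) =
    tens (tensor L M) N (tens L M a b) c" .
qed

section \<open>The terminal localic space\<close>

lemma two_simps [simp]: "carrier two = UNIV" "le two = (\<le>)" "eq two = (=)"
  by (auto simp: two_def)

lemma complete_lattice_two: "complete_lattice two"
proof
  show "\<exists>s. least two s (Upper two A)" for A
    by (rule exI[of _ "True \<in> A"]) (auto simp: least_def Upper_def)
  show "\<exists>s. greatest two s (Lower two A)" for A
    by (rule exI[of _ "False \<notin> A"]) (auto simp: greatest_def Lower_def, metis (full_types))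
qed auto

lemma two_sup: "\<Squnion>\<^bsub>two\<^esub>A \<longleftrightarrow> True \<in> A"
proof -
  interpret complete_lattice two by (rule complete_lattice_two)
  show ?thesis using sup_upper[of A True] sup_least[of A "True \<in> A"] by auto (metis (full_types))
qed

lemma two_inf: "\<Sqinter>\<^bsub>two\<^esub>A \<longleftrightarrow> False \<notin> A"
proof -
  interpret complete_lattice two by (rule complete_lattice_two)
  show ?thesis using inf_lower[of A False] inf_greatest[of A "False \<notin> A"] by auto (metis (full_types))
qed

lemma two_meet: "a \<sqinter>\<^bsub>two\<^esub> b \<longleftrightarrow> a \<and> b"
  by (auto simp: meet_def two_inf)

lemma localic_two: "localic two"
  by (rule localic.intro[OF complete_lattice_two], unfold_locales) (auto simp: two_sup two_meet)

lemma two_top: "\<top>\<^bsub>two\<^esub>"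
  using localic.inf_empty[OF localic_two] two_inf[of "{}"] by simp

lemma two_bottom: "\<not> \<bottom>\<^bsub>two\<^esub>"
  using localic.sup_empty[OF localic_two] two_sup[of "{}"] by simp

lemma from_two_hom:
  assumes "localic G"
  shows "locale_hom two G (from_two G)"
proof -
  interpret G: localic G by fact
  have "from_two G (\<Squnion>\<^bsub>two\<^esub>B) = \<Squnion>\<^bsub>G\<^esub>(from_two G ` B)" for B
  proof -
    have "\<Squnion>\<^bsub>G\<^esub>(from_two G ` B) = from_two G (True \<in> B)"
      by (rule G.sup_eqI) (auto simp: from_two_def)
    then show ?thesis by (simp add: two_sup)
  qed
  then show ?thesis by (auto simp: locale_hom_def two_meet two_top from_two_def)
qed

section \<open>Localic groups of bijection matrices\<close>

text \<open>
  A localic group is a record extending an order, while the sheaf locale is a bare order. The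
  following lemmas transport every notion that depends on the order alone between the two records.
\<close>

definition same_order :: "('a, 'x) gorder_scheme \<Rightarrow> ('a, 'y) gorder_scheme \<Rightarrow> bool" where
  "same_order G L \<longleftrightarrow> carrier G = carrier L \<and> le G = le L \<and> eq G = eq L"

context
  fixes G :: "('a, 'x) gorder_scheme" and L :: "('a, 'y) gorder_scheme"
  assumes same: "same_order G L"
begin

lemma same_carrier: "carrier G = carrier L" and same_le: "le G = le L" and same_eq: "eq G = eq L"
  using same by (auto simp: same_order_def)

lemma same_least: "least G = least L" "greatest G = greatest L" "Upper G = Upper L" "Lower G = Lower L"
  by (auto simp: fun_eq_iff least_def greatest_def Upper_def Lower_def same_carrier same_le)

lemma same_sup: "Lattice.sup G = Lattice.sup L" and same_inf: "Lattice.inf G = Lattice.inf L"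
  by (auto simp: fun_eq_iff sup_def inf_def same_least)

lemma same_meet: "meet G = meet L"
  by (auto simp: fun_eq_iff meet_def same_inf)

lemma same_top: "\<top>\<^bsub>G\<^esub> = \<top>\<^bsub>L\<^esub>" and same_bottom: "\<bottom>\<^bsub>G\<^esub> = \<bottom>\<^bsub>L\<^esub>"
  by (simp_all add: top_def bottom_def same_least same_carrier)

lemmas same_simps = same_carrier same_le same_eq same_least same_sup same_inf same_meet same_top same_bottom

lemma same_from_two: "from_two G = from_two L"
  by (simp add: fun_eq_iff from_two_def same_simps)

lemma same_extend: "extend G = extend L"
  by (simp add: fun_eq_iff extend_def same_simps)

lemma same_copair: "copair G = copair L"
  by (simp add: fun_eq_iff copair_def same_simps)

lemma same_hom_from: "locale_hom G M = locale_hom L M"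
  by (simp add: fun_eq_iff locale_hom_def same_simps)

lemma same_hom_to: "locale_hom M G = locale_hom M L"
  by (simp add: fun_eq_iff locale_hom_def same_simps)

lemma same_localic: "localic G \<longleftrightarrow> localic L"
  unfolding localic_def localic_axioms_def complete_lattice_def complete_lattice_axioms_def
    partial_order_def partial_order_axioms_def weak_partial_order_def weak_partial_order_axioms_def
    equivalence_def same_simps ..

lemma same_bi_ideal1: "bi_ideal G M = bi_ideal L M"
  by (simp add: fun_eq_iff bi_ideal_def same_simps)

lemma same_bi_ideal2: "bi_ideal M G = bi_ideal M L"
  by (simp add: fun_eq_iff bi_ideal_def same_simps)

lemma same_tensor1: "tensor G M = tensor L M" and same_tensor2: "tensor M G = tensor M L"
  by (simp_all add: tensor_def same_bi_ideal1 same_bi_ideal2)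

lemma same_tens1: "tens G M = tens L M" and same_tens2: "tens M G = tens M L"
  by (simp_all add: fun_eq_iff tens_def same_bi_ideal1 same_bi_ideal2)

lemma same_inj:
  "inj1 G M = inj1 L M" "inj1 M G = inj1 M L" "inj2 G M = inj2 L M" "inj2 M G = inj2 M L"
  by (simp_all add: fun_eq_iff inj1_def inj2_def same_tens1 same_tens2 same_simps)

lemma same_tensor_map: "tensor_map G M = tensor_map L M" "tensor_map M G = tensor_map M L"
  by (simp_all add: fun_eq_iff tensor_map_def same_tensor1 same_tensor2 same_inj)

lemma same_tensor_assoc: "tensor_assoc G G G = tensor_assoc L L L"
  by (simp add: fun_eq_iff tensor_assoc_def same_tensor1 same_tensor2 same_inj)

lemmas same_order_simps = same_simps same_from_two same_extend same_copair same_hom_from same_hom_to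
  same_localic same_tensor1 same_tensor2 same_tens1 same_tens2 same_tensor_map same_tensor_assoc

end

text \<open>
  The sites of \<open>lAut(S)\<close> and of \<open>lAut(F)\<close> are both disjoint unions of squares \<open>E i \<times> E i\<close>: one square in
  the first case, one for each object of the category in the second. Any inequality between
  generators of two squares must come from a map \<open>f : E i \<rightarrow> E j\<close> which then induces inequalities
  between all corresponding entries; this uniformity is what makes the multiplication, a supremum over
  the middle entry, monotone. The functions \<open>\<epsilon>\<close>, \<open>\<sigma>\<close> and \<open>\<mu>\<close> give the counit, the inverse and the
  comultiplication on generators.
\<close>

locale aut_system =
  fixes S :: "'d site" and I :: "'i set" and E :: "'i \<Rightarrow> 'e set" and c :: "'i \<Rightarrow> 'e \<times> 'e \<Rightarrow> 'd"
    and \<epsilon> :: "'d \<Rightarrow> bool" and \<sigma> :: "'d \<Rightarrow> 'd" and \<mu> :: "'d \<Rightarrow> ('d set set \<times> 'd set set) set"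
  assumes gens_eq: "gens S = (\<Union>i \<in> I. c i ` (E i \<times> E i))"
    and basic_eq: "basic S = (\<Union>i \<in> I. aut_covers (c i) (E i))"
    and gle_self: "d \<in> gens S \<Longrightarrow> gle S d d"
    and transition: "i \<in> I \<Longrightarrow> j \<in> I \<Longrightarrow> x \<in> E i \<Longrightarrow> y \<in> E i \<Longrightarrow> x' \<in> E j \<Longrightarrow> y' \<in> E j \<Longrightarrow>
      gle S (c i (x, y)) (c j (x', y')) \<Longrightarrow>
      \<exists>f \<in> E i \<rightarrow> E j. f x = x' \<and> f y = y' \<and>
        (\<forall>u \<in> E i. \<forall>v \<in> E i. gle S (c i (u, v)) (c j (f u, f v)))"
    and counit_gen: "i \<in> I \<Longrightarrow> x \<in> E i \<Longrightarrow> y \<in> E i \<Longrightarrow> \<epsilon> (c i (x, y)) \<longleftrightarrow> x = y"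
    and inverse_gen: "i \<in> I \<Longrightarrow> x \<in> E i \<Longrightarrow> y \<in> E i \<Longrightarrow> \<sigma> (c i (x, y)) = c i (y, x)"
    and comult_gen: "i \<in> I \<Longrightarrow> x \<in> E i \<Longrightarrow> y \<in> E i \<Longrightarrow>
      \<mu> (c i (x, y)) = aut_comult S (c i) (E i) (x, y)"

sublocale aut_system \<subseteq> generated_site S
proof
  show "A \<in> objs S" "U \<subseteq> objs S" if "(U, A) \<in> basic S" for U A
    using that unfolding basic_eq aut_covers_def objs_def gens_eq by auto
qed (rule gle_self)

context aut_system
begin

abbreviation L :: "'d set set gorder" where "L \<equiv> sheaf_locale S"

text \<open>
  The four lemmas \<open>entry_functional\<close>, \<open>entry_injective\<close>, \<open>entry_surjective\<close> and \<open>entry_total\<close> below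
  read the basic covers as the statement that these elements are the entries of the matrix of a
  bijection of \<open>E i\<close>, with values in the frame. In these terms the comultiplication is the product
  of two such matrices, the counit the identity matrix and the inverse the transpose.
\<close>

definition entry :: "'i \<Rightarrow> 'e \<Rightarrow> 'e \<Rightarrow> 'd set set" where "entry i x y = sharp S {c i (x, y)}"

lemma gen: "i \<in> I \<Longrightarrow> x \<in> E i \<Longrightarrow> y \<in> E i \<Longrightarrow> c i (x, y) \<in> gens S"
  by (auto simp: gens_eq)

lemma gen_cases:
  assumes "d \<in> gens S"
  obtains i x y where "i \<in> I" "x \<in> E i" "y \<in> E i" "d = c i (x, y)"
  using assms by (auto simp: gens_eq)

lemma entry_closed: "i \<in> I \<Longrightarrow> x \<in> E i \<Longrightarrow> y \<in> E i \<Longrightarrow> entry i x y \<in> carrier L"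
  unfolding entry_def by (intro gen_closed gen)

lemma entry_mono:
  assumes "i \<in> I" "j \<in> I" "x \<in> E i" "y \<in> E i" "x' \<in> E j" "y' \<in> E j" "gle S (c i (x, y)) (c j (x', y'))"
  shows "entry i x y \<sqsubseteq>\<^bsub>L\<^esub> entry j x' y'"
  unfolding entry_def using assms by (intro sharp_mono gen_objs gen) (auto simp: obj_le_def)

lemma entry_meet:
  assumes "i \<in> I" "x \<in> E i" "y \<in> E i" "x' \<in> E i" "y' \<in> E i"
  shows "sharp S {c i (x, y), c i (x', y')} = entry i x y \<sqinter>\<^bsub>L\<^esub> entry i x' y'"
  using sharp_Un[OF gen_objs gen_objs, of "c i (x, y)" "c i (x', y')"] assms gen
  by (simp add: entry_def insert_commute)

lemma entry_functional:
  assumes "i \<in> I" "x \<in> E i" "y \<in> E i" "z \<in> E i" "x \<noteq> y"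
  shows "entry i z x \<sqinter>\<^bsub>L\<^esub> entry i z y = \<bottom>\<^bsub>L\<^esub>"
proof -
  interpret L: localic L by (rule localic_sheaves)
  have "({}, {c i (z, x), c i (z, y)}) \<in> aut_covers (c i) (E i)"
    using assms unfolding aut_covers_def by blast
  then have "({}, {c i (z, x), c i (z, y)}) \<in> basic S"
    using assms(1) unfolding basic_eq by (rule UN_I[rotated])
  from sharp_cover[OF this] have "entry i z x \<sqinter>\<^bsub>L\<^esub> entry i z y \<sqsubseteq>\<^bsub>L\<^esub> \<bottom>\<^bsub>L\<^esub>"
    using assms by (simp add: entry_meet)
  then show ?thesis using assms by (intro L.le_antisym) (simp_all add: entry_closed)
qed

lemma entry_injective:
  assumes "i \<in> I" "x \<in> E i" "y \<in> E i" "z \<in> E i" "x \<noteq> y"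
  shows "entry i x z \<sqinter>\<^bsub>L\<^esub> entry i y z = \<bottom>\<^bsub>L\<^esub>"
proof -
  interpret L: localic L by (rule localic_sheaves)
  have "({}, {c i (x, z), c i (y, z)}) \<in> aut_covers (c i) (E i)"
    using assms unfolding aut_covers_def by blast
  then have "({}, {c i (x, z), c i (y, z)}) \<in> basic S"
    using assms(1) unfolding basic_eq by (rule UN_I[rotated])
  from sharp_cover[OF this] have "entry i x z \<sqinter>\<^bsub>L\<^esub> entry i y z \<sqsubseteq>\<^bsub>L\<^esub> \<bottom>\<^bsub>L\<^esub>"
    using assms by (simp add: entry_meet)
  then show ?thesis using assms by (intro L.le_antisym) (simp_all add: entry_closed)
qed

lemma entry_surjective:
  assumes "i \<in> I" "z \<in> E i"
  shows "\<Squnion>\<^bsub>L\<^esub>((\<lambda>x. entry i x z) ` E i) = \<top>\<^bsub>L\<^esub>"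
proof -
  interpret L: localic L by (rule localic_sheaves)
  have cl: "(\<lambda>x. entry i x z) ` E i \<subseteq> carrier L" using assms entry_closed by auto
  have "((\<lambda>x. {c i (x, z)}) ` E i, {}) \<in> aut_covers (c i) (E i)"
    using assms unfolding aut_covers_def by blast
  then have "((\<lambda>x. {c i (x, z)}) ` E i, {}) \<in> basic S"
    using assms(1) unfolding basic_eq by (rule UN_I[rotated])
  from sharp_cover[OF this] have "\<top>\<^bsub>L\<^esub> \<sqsubseteq>\<^bsub>L\<^esub> \<Squnion>\<^bsub>L\<^esub>((\<lambda>x. entry i x z) ` E i)"
    by (simp add: sharp_empty image_image entry_def)
  then show ?thesis using cl by (intro L.le_antisym) auto
qed

lemma entry_total:
  assumes "i \<in> I" "z \<in> E i"
  shows "\<Squnion>\<^bsub>L\<^esub>((\<lambda>x. entry i z x) ` E i) = \<top>\<^bsub>L\<^esub>"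
proof -
  interpret L: localic L by (rule localic_sheaves)
  have cl: "(\<lambda>x. entry i z x) ` E i \<subseteq> carrier L" using assms entry_closed by auto
  have "((\<lambda>x. {c i (z, x)}) ` E i, {}) \<in> aut_covers (c i) (E i)"
    using assms unfolding aut_covers_def by blast
  then have "((\<lambda>x. {c i (z, x)}) ` E i, {}) \<in> basic S"
    using assms(1) unfolding basic_eq by (rule UN_I[rotated])
  from sharp_cover[OF this] have "\<top>\<^bsub>L\<^esub> \<sqsubseteq>\<^bsub>L\<^esub> \<Squnion>\<^bsub>L\<^esub>((\<lambda>x. entry i z x) ` E i)"
    by (simp add: sharp_empty image_image entry_def)
  then show ?thesis using cl by (intro L.le_antisym) auto
qed

lemma hom_ext_entries:
  assumes "locale_hom L N f" "locale_hom L N h"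
    and "\<And>i x y. i \<in> I \<Longrightarrow> x \<in> E i \<Longrightarrow> y \<in> E i \<Longrightarrow> f (entry i x y) = h (entry i x y)"
    and "T \<in> carrier L"
  shows "f T = h T"
  using assms(3) by (intro hom_ext_gens[OF assms(1,2) _ assms(4)]) (auto simp: entry_def elim!: gen_cases)

text \<open>
  An arrow out of the locale is the same as a system of frame-valued bijection matrices, monotone
  along the transition maps.
\<close>

lemma extend_aut:
  fixes N (structure)
  assumes N: "localic N"
    and \<phi>: "\<And>i x y. i \<in> I \<Longrightarrow> x \<in> E i \<Longrightarrow> y \<in> E i \<Longrightarrow> \<phi> (c i (x, y)) \<in> carrier N"
    and mono: "\<And>i j x y f. i \<in> I \<Longrightarrow> j \<in> I \<Longrightarrow> f \<in> E i \<rightarrow> E j \<Longrightarrow> x \<in> E i \<Longrightarrow> y \<in> E i \<Longrightarrow>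
      (\<And>u v. u \<in> E i \<Longrightarrow> v \<in> E i \<Longrightarrow> gle S (c i (u, v)) (c j (f u, f v))) \<Longrightarrow>
      \<phi> (c i (x, y)) \<sqsubseteq> \<phi> (c j (f x, f y))"
    and func: "\<And>i x y z. i \<in> I \<Longrightarrow> x \<in> E i \<Longrightarrow> y \<in> E i \<Longrightarrow> z \<in> E i \<Longrightarrow> x \<noteq> y \<Longrightarrow>
      \<phi> (c i (z, x)) \<sqinter> \<phi> (c i (z, y)) = \<bottom>"
    and inj: "\<And>i x y z. i \<in> I \<Longrightarrow> x \<in> E i \<Longrightarrow> y \<in> E i \<Longrightarrow> z \<in> E i \<Longrightarrow> x \<noteq> y \<Longrightarrow>
      \<phi> (c i (x, z)) \<sqinter> \<phi> (c i (y, z)) = \<bottom>"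
    and surj: "\<And>i z. i \<in> I \<Longrightarrow> z \<in> E i \<Longrightarrow> \<Squnion>((\<lambda>x. \<phi> (c i (x, z))) ` E i) = \<top>"
    and total: "\<And>i z. i \<in> I \<Longrightarrow> z \<in> E i \<Longrightarrow> \<Squnion>((\<lambda>x. \<phi> (c i (z, x))) ` E i) = \<top>"
  shows "locale_hom L N (extend N \<phi>)"
    and "i \<in> I \<Longrightarrow> x \<in> E i \<Longrightarrow> y \<in> E i \<Longrightarrow> extend N \<phi> (entry i x y) = \<phi> (c i (x, y))"
proof -
  interpret N: localic N by fact
  have single: "\<Sqinter>(\<phi> ` {c i (x, y)}) = \<phi> (c i (x, y))" if "i \<in> I" "x \<in> E i" "y \<in> E i" for i x y
    using \<phi>[OF that] by simp
  have pair: "\<Sqinter>(\<phi> ` {a, b}) = \<phi> a \<sqinter> \<phi> b" for a b by (simp add: meet_def)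
  have 1: "\<phi> d \<in> carrier N" if "d \<in> gens S" for d using that \<phi> by (auto elim!: gen_cases)
  have 2: "\<phi> d \<sqsubseteq> \<phi> d'" if "d \<in> gens S" "d' \<in> gens S" "gle S d d'" for d d'
  proof -
    obtain i x y where d: "i \<in> I" "x \<in> E i" "y \<in> E i" "d = c i (x, y)" using gen_cases[OF \<open>d \<in> gens S\<close>] .
    obtain j x' y' where d': "j \<in> I" "x' \<in> E j" "y' \<in> E j" "d' = c j (x', y')" using gen_cases[OF \<open>d' \<in> gens S\<close>] .
    obtain f where "f \<in> E i \<rightarrow> E j" "f x = x'" "f y = y'"
      "\<And>u v. u \<in> E i \<Longrightarrow> v \<in> E i \<Longrightarrow> gle S (c i (u, v)) (c j (f u, f v))"
      using transition[OF d(1) d'(1) d(2,3) d'(2,3)] \<open>gle S d d'\<close> d(4) d'(4) by auto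
    then show ?thesis using mono[of i j f x y] d d' by simp
  qed
  have 3: "\<Sqinter>(\<phi> ` A) \<sqsubseteq> \<Squnion>((\<lambda>V. \<Sqinter>(\<phi> ` V)) ` U)" if UA: "(U, A) \<in> basic S" for U A
  proof -
    obtain i where i: "i \<in> I" "(U, A) \<in> aut_covers (c i) (E i)" using UA by (auto simp: basic_eq)
    from i(2) consider
      (1) x y z where "U = {}" "A = {c i (z, x), c i (z, y)}" "x \<in> E i" "y \<in> E i" "z \<in> E i" "x \<noteq> y"
    | (2) x y z where "U = {}" "A = {c i (x, z), c i (y, z)}" "x \<in> E i" "y \<in> E i" "z \<in> E i" "x \<noteq> y"
    | (3) z where "U = (\<lambda>x. {c i (x, z)}) ` E i" "A = {}" "z \<in> E i"
    | (4) z where "U = (\<lambda>x. {c i (z, x)}) ` E i" "A = {}" "z \<in> E i"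
      unfolding aut_covers_def by blast
    then show ?thesis
    proof cases
      case 1
      then show ?thesis using func[OF i(1) 1(3-6)] by (simp only: pair image_empty N.sup_empty N.le_refl N.bottom_closed)
    next
      case 2
      then show ?thesis using inj[OF i(1) 2(3-6)] by (simp only: pair image_empty N.sup_empty N.le_refl N.bottom_closed)
    next
      case 3
      have "(\<lambda>V. \<Sqinter>(\<phi> ` V)) ` U = (\<lambda>x. \<phi> (c i (x, z))) ` E i"
        unfolding 3(1) image_image using single i(1) 3(3) by (intro image_cong) auto
      then show ?thesis using surj[OF i(1) 3(3)] 3(2) by simp
    next
      case 4
      have "(\<lambda>V. \<Sqinter>(\<phi> ` V)) ` U = (\<lambda>x. \<phi> (c i (z, x))) ` E i"
        unfolding 4(1) image_image using single i(1) 4(3) by (intro image_cong) auto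
      then show ?thesis using total[OF i(1) 4(3)] 4(2) by simp
    qed
  qed
  show "locale_hom L N (extend N \<phi>)" by (rule extend_hom(1)[OF N 1 2 3])
  assume "i \<in> I" "x \<in> E i" "y \<in> E i"
  then show "extend N \<phi> (entry i x y) = \<phi> (c i (x, y))"
    using extend_hom(2)[OF N 1 2 3 gen] by (simp add: entry_def)
qed

sublocale LL: locale_pair L L
  by (simp add: locale_pair_def localic_sheaves)

abbreviation T :: "('d set set \<times> 'd set set) set gorder" where "T \<equiv> tensor L L"

abbreviation m where "m \<equiv> extend T \<mu>"
abbreviation counit_hom where "counit_hom \<equiv> extend two \<epsilon>"
abbreviation inverse_hom where "inverse_hom \<equiv> extend L (\<lambda>d. sharp S {\<sigma> d})"

lemma comult_val:
  "i \<in> I \<Longrightarrow> x \<in> E i \<Longrightarrow> y \<in> E i \<Longrightarrow>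
    \<mu> (c i (x, y)) = \<Squnion>\<^bsub>T\<^esub>((\<lambda>z. tens L L (entry i x z) (entry i z y)) ` E i)"
  by (simp add: comult_gen aut_comult_def entry_def)

text \<open>
  The product of two bijection matrices, with entries from the two tensor factors, is again one. For
  disjointness, \<open>(x u) \<otimes> (u y)\<close> and \<open>(x' v) \<otimes> (v y')\<close> with exactly one
  of \<open>x = x'\<close>, \<open>y = y'\<close> meet in \<open>0\<close>: if \<open>u \<noteq> v\<close>, one factor vanishes because
  the outer entries agree, and if \<open>u = v\<close>, the other one does because they differ.
\<close>

lemma comult_hom:
  "locale_hom L T m"
  "i \<in> I \<Longrightarrow> x \<in> E i \<Longrightarrow> y \<in> E i \<Longrightarrow>
    m (entry i x y) = \<Squnion>\<^bsub>T\<^esub>((\<lambda>z. tens L L (entry i x z) (entry i z y)) ` E i)"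
proof -
  interpret T: localic T by (rule LL.localic_tensor)
  have tc: "tens L L (entry i x z) (entry i z y) \<in> carrier T"
    if "i \<in> I" "x \<in> E i" "y \<in> E i" "z \<in> E i" for i x y z
    using that by (intro LL.tens_closed entry_closed)
  have closed: "\<mu> (c i (x, y)) \<in> carrier T" if "i \<in> I" "x \<in> E i" "y \<in> E i" for i x y
    unfolding comult_val[OF that] using that tc by (intro T.sup_closed) auto
  have mono: "\<mu> (c i (x, y)) \<sqsubseteq>\<^bsub>T\<^esub> \<mu> (c j (f x, f y))"
    if h: "i \<in> I" "j \<in> I" "f \<in> E i \<rightarrow> E j" "x \<in> E i" "y \<in> E i"
      "\<And>u v. u \<in> E i \<Longrightarrow> v \<in> E i \<Longrightarrow> gle S (c i (u, v)) (c j (f u, f v))" for i j x y f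
  proof -
    have f: "f u \<in> E j" if "u \<in> E i" for u using h(3) that by auto
    have "tens L L (entry i x z) (entry i z y) \<sqsubseteq>\<^bsub>T\<^esub> tens L L (entry j (f x) (f z)) (entry j (f z) (f y))"
      if "z \<in> E i" for z
      using h f that by (intro LL.tens_mono entry_mono entry_closed) auto
    then show ?thesis
      unfolding comult_val[OF h(1,4,5)] comult_val[OF h(2) f[OF h(4)] f[OF h(5)]]
      using f tc h by (intro T.sup_image_cong_le) blast+
  qed
  have meet: "\<mu> (c i (x, y)) \<sqinter>\<^bsub>T\<^esub> \<mu> (c i (x', y')) = \<bottom>\<^bsub>T\<^esub>"
    if h: "i \<in> I" "x \<in> E i" "y \<in> E i" "x' \<in> E i" "y' \<in> E i"
      and bot: "\<And>u v. u \<in> E i \<Longrightarrow> v \<in> E i \<Longrightarrow>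
        entry i x u \<sqinter>\<^bsub>L\<^esub> entry i x' v = \<bottom>\<^bsub>L\<^esub> \<or> entry i u y \<sqinter>\<^bsub>L\<^esub> entry i v y' = \<bottom>\<^bsub>L\<^esub>" for i x y x' y'
  proof -
    have b: "tens L L (entry i x u) (entry i u y) \<sqinter>\<^bsub>T\<^esub> tens L L (entry i x' v) (entry i v y') = \<bottom>\<^bsub>T\<^esub>"
      if uv: "u \<in> E i" "v \<in> E i" for u v
    proof -
      have "tens L L (entry i x u) (entry i u y) \<sqinter>\<^bsub>T\<^esub> tens L L (entry i x' v) (entry i v y') =
          tens L L (entry i x u \<sqinter>\<^bsub>L\<^esub> entry i x' v) (entry i u y \<sqinter>\<^bsub>L\<^esub> entry i v y')"
        using h uv by (intro LL.tens_meet[symmetric] entry_closed)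
      then show ?thesis
        using bot[OF uv] h uv by (auto simp: LL.tens_bottom1 LL.tens_bottom2 entry_closed)
    qed
    have "\<mu> (c i (x, y)) \<sqinter>\<^bsub>T\<^esub> \<mu> (c i (x', y')) = \<Squnion>\<^bsub>T\<^esub>((\<lambda>(u, v). tens L L (entry i x u) (entry i u y) \<sqinter>\<^bsub>T\<^esub>
        tens L L (entry i x' v) (entry i v y')) ` (E i \<times> E i))"
      unfolding comult_val[OF h(1,2,3)] comult_val[OF h(1,4,5)]
      using tc h by (intro T.meet_of_sups) auto
    also have "\<dots> = \<bottom>\<^bsub>T\<^esub>" using b by (intro T.sup_bottoms) auto
    finally show ?thesis .
  qed
  have func: "\<mu> (c i (z, x)) \<sqinter>\<^bsub>T\<^esub> \<mu> (c i (z, y)) = \<bottom>\<^bsub>T\<^esub>"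
    if "i \<in> I" "x \<in> E i" "y \<in> E i" "z \<in> E i" "x \<noteq> y" for i x y z
  proof (rule meet)
    show "entry i z u \<sqinter>\<^bsub>L\<^esub> entry i z v = \<bottom>\<^bsub>L\<^esub> \<or> entry i u x \<sqinter>\<^bsub>L\<^esub> entry i v y = \<bottom>\<^bsub>L\<^esub>"
      if uv: "u \<in> E i" "v \<in> E i" for u v
      using \<open>i \<in> I\<close> \<open>x \<in> E i\<close> \<open>y \<in> E i\<close> \<open>z \<in> E i\<close> \<open>x \<noteq> y\<close> uv entry_functional[of i]
      by (cases "u = v") simp_all
  qed (use that in simp_all)
  have inj: "\<mu> (c i (x, z)) \<sqinter>\<^bsub>T\<^esub> \<mu> (c i (y, z)) = \<bottom>\<^bsub>T\<^esub>"
    if "i \<in> I" "x \<in> E i" "y \<in> E i" "z \<in> E i" "x \<noteq> y" for i x y z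
  proof (rule meet)
    show "entry i x u \<sqinter>\<^bsub>L\<^esub> entry i y v = \<bottom>\<^bsub>L\<^esub> \<or> entry i u z \<sqinter>\<^bsub>L\<^esub> entry i v z = \<bottom>\<^bsub>L\<^esub>"
      if uv: "u \<in> E i" "v \<in> E i" for u v
      using \<open>i \<in> I\<close> \<open>x \<in> E i\<close> \<open>y \<in> E i\<close> \<open>z \<in> E i\<close> \<open>x \<noteq> y\<close> uv entry_injective[of i]
      by (cases "u = v") simp_all
  qed (use that in simp_all)
  have surj: "\<Squnion>\<^bsub>T\<^esub>((\<lambda>x. \<mu> (c i (x, y))) ` E i) = \<top>\<^bsub>T\<^esub>" if i: "i \<in> I" and y: "y \<in> E i" for i y
  proof -
    have "\<Squnion>\<^bsub>T\<^esub>((\<lambda>x. \<mu> (c i (x, y))) ` E i) =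
        \<Squnion>\<^bsub>T\<^esub>((\<lambda>x. \<Squnion>\<^bsub>T\<^esub>((\<lambda>z. tens L L (entry i x z) (entry i z y)) ` E i)) ` E i)"
      using comult_val i y by simp
    also have "\<dots> = \<Squnion>\<^bsub>T\<^esub>((\<lambda>z. \<Squnion>\<^bsub>T\<^esub>((\<lambda>x. tens L L (entry i x z) (entry i z y)) ` E i)) ` E i)"
      using tc i y by (intro T.sup_swap)
    also have "\<dots> = \<Squnion>\<^bsub>T\<^esub>((\<lambda>z. tens L L \<top>\<^bsub>L\<^esub> (entry i z y)) ` E i)"
    proof -
      have "\<Squnion>\<^bsub>T\<^esub>((\<lambda>x. tens L L (entry i x z) (entry i z y)) ` E i) = tens L L \<top>\<^bsub>L\<^esub> (entry i z y)" if "z \<in> E i" for z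
        using LL.tens_sup1[of "(\<lambda>x. entry i x z) ` E i" "entry i z y"] i y that entry_closed
        by (simp add: image_subset_iff image_image entry_surjective)
      then show ?thesis by simp
    qed
    also have "\<dots> = tens L L \<top>\<^bsub>L\<^esub> \<top>\<^bsub>L\<^esub>"
      using LL.tens_sup2[of "\<top>\<^bsub>L\<^esub>" "(\<lambda>z. entry i z y) ` E i"] i y entry_closed
      by (simp add: image_subset_iff image_image entry_surjective)
    finally show ?thesis by (simp add: LL.tens_top)
  qed
  have total: "\<Squnion>\<^bsub>T\<^esub>((\<lambda>x. \<mu> (c i (y, x))) ` E i) = \<top>\<^bsub>T\<^esub>" if i: "i \<in> I" and y: "y \<in> E i" for i y
  proof -
    have "\<Squnion>\<^bsub>T\<^esub>((\<lambda>x. \<mu> (c i (y, x))) ` E i) =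
        \<Squnion>\<^bsub>T\<^esub>((\<lambda>x. \<Squnion>\<^bsub>T\<^esub>((\<lambda>z. tens L L (entry i y z) (entry i z x)) ` E i)) ` E i)"
      using comult_val i y by simp
    also have "\<dots> = \<Squnion>\<^bsub>T\<^esub>((\<lambda>z. \<Squnion>\<^bsub>T\<^esub>((\<lambda>x. tens L L (entry i y z) (entry i z x)) ` E i)) ` E i)"
      using tc i y by (intro T.sup_swap)
    also have "\<dots> = \<Squnion>\<^bsub>T\<^esub>((\<lambda>z. tens L L (entry i y z) \<top>\<^bsub>L\<^esub>) ` E i)"
    proof -
      have "\<Squnion>\<^bsub>T\<^esub>((\<lambda>x. tens L L (entry i y z) (entry i z x)) ` E i) = tens L L (entry i y z) \<top>\<^bsub>L\<^esub>" if "z \<in> E i" for z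
        using LL.tens_sup2[of "entry i y z" "(\<lambda>x. entry i z x) ` E i"] i y that entry_closed
        by (simp add: image_subset_iff image_image entry_total)
      then show ?thesis by simp
    qed
    also have "\<dots> = tens L L \<top>\<^bsub>L\<^esub> \<top>\<^bsub>L\<^esub>"
      using LL.tens_sup1[of "(\<lambda>z. entry i y z) ` E i" "\<top>\<^bsub>L\<^esub>"] i y entry_closed
      by (simp add: image_subset_iff image_image entry_total)
    finally show ?thesis by (simp add: LL.tens_top)
  qed
  note * = extend_aut[OF T.localic_axioms closed mono func inj surj total]
  show "locale_hom L T m" by (rule *(1))
  show "i \<in> I \<Longrightarrow> x \<in> E i \<Longrightarrow> y \<in> E i \<Longrightarrow>
    m (entry i x y) = \<Squnion>\<^bsub>T\<^esub>((\<lambda>z. tens L L (entry i x z) (entry i z y)) ` E i)"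
    by (rule trans[OF *(2) comult_val])
qed

lemma counit_hom:
  "locale_hom L two counit_hom"
  "i \<in> I \<Longrightarrow> x \<in> E i \<Longrightarrow> y \<in> E i \<Longrightarrow> counit_hom (entry i x y) \<longleftrightarrow> x = y"
proof -
  note * = extend_aut[OF localic_two, of \<epsilon>]
  show "locale_hom L two counit_hom"
    by (rule *(1)) (auto simp: two_meet two_bottom two_sup two_top counit_gen Pi_iff)
  show "i \<in> I \<Longrightarrow> x \<in> E i \<Longrightarrow> y \<in> E i \<Longrightarrow> counit_hom (entry i x y) \<longleftrightarrow> x = y"
    by (subst *(2)) (auto simp: two_meet two_bottom two_sup two_top counit_gen Pi_iff)
qed

lemma inverse_hom:
  "locale_hom L L inverse_hom"
  "i \<in> I \<Longrightarrow> x \<in> E i \<Longrightarrow> y \<in> E i \<Longrightarrow> inverse_hom (entry i x y) = entry i y x"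
proof -
  let ?\<phi> = "\<lambda>d. sharp S {\<sigma> d}"
  have v: "?\<phi> (c i (x, y)) = entry i y x" if "i \<in> I" "x \<in> E i" "y \<in> E i" for i x y
    using that by (simp add: inverse_gen entry_def)
  have closed: "?\<phi> (c i (x, y)) \<in> carrier L" if "i \<in> I" "x \<in> E i" "y \<in> E i" for i x y
    using that by (simp add: v entry_closed)
  have mono: "?\<phi> (c i (x, y)) \<sqsubseteq>\<^bsub>L\<^esub> ?\<phi> (c j (f x, f y))"
    if "i \<in> I" "j \<in> I" "f \<in> E i \<rightarrow> E j" "x \<in> E i" "y \<in> E i"
      "\<And>u v. u \<in> E i \<Longrightarrow> v \<in> E i \<Longrightarrow> gle S (c i (u, v)) (c j (f u, f v))" for i j x y f
    using that by (subst (1 2) v) (auto intro!: entry_mono)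
  have func: "?\<phi> (c i (z, x)) \<sqinter>\<^bsub>L\<^esub> ?\<phi> (c i (z, y)) = \<bottom>\<^bsub>L\<^esub>"
    if "i \<in> I" "x \<in> E i" "y \<in> E i" "z \<in> E i" "x \<noteq> y" for i x y z
    using that by (simp add: v entry_injective)
  have inj: "?\<phi> (c i (x, z)) \<sqinter>\<^bsub>L\<^esub> ?\<phi> (c i (y, z)) = \<bottom>\<^bsub>L\<^esub>"
    if "i \<in> I" "x \<in> E i" "y \<in> E i" "z \<in> E i" "x \<noteq> y" for i x y z
    using that by (simp add: v entry_functional)
  have surj: "\<Squnion>\<^bsub>L\<^esub>((\<lambda>x. ?\<phi> (c i (x, z))) ` E i) = \<top>\<^bsub>L\<^esub>" if "i \<in> I" "z \<in> E i" for i z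
    using entry_total[OF that] v that by simp
  have total: "\<Squnion>\<^bsub>L\<^esub>((\<lambda>x. ?\<phi> (c i (z, x))) ` E i) = \<top>\<^bsub>L\<^esub>" if "i \<in> I" "z \<in> E i" for i z
    using entry_surjective[OF that] v that by simp
  note * = extend_aut[OF localic_sheaves, of ?\<phi>, OF closed mono func inj surj total]
  show "locale_hom L L inverse_hom" by (rule *(1))
  show "i \<in> I \<Longrightarrow> x \<in> E i \<Longrightarrow> y \<in> E i \<Longrightarrow> inverse_hom (entry i x y) = entry i y x"
    by (rule trans[OF *(2) v])
qed

text \<open>
  On generators both sides are \<open>\<Squnion> ((x w) \<otimes> (w z)) \<otimes> (z y)\<close>, with the suprema over \<open>w\<close> and \<open>z\<close> taken in
  opposite order: matrix multiplication is associative.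
\<close>

lemma coassociative:
  assumes "a \<in> carrier L"
  shows "tensor_map T L m id (m a) = tensor_assoc L L L (tensor_map L T id m (m a))"
proof -
  interpret T: localic T by (rule LL.localic_tensor)
  interpret TL: locale_pair T L by (simp add: locale_pair_def localic_sheaves T.localic_axioms)
  interpret LT: locale_pair L T by (simp add: locale_pair_def localic_sheaves T.localic_axioms)
  interpret TT: localic "tensor T L" by (rule TL.localic_tensor)
  note ls = localic_sheaves and lt = T.localic_axioms
  note left = tensor_map_hom[OF ls ls lt ls comult_hom(1) locale_hom_id[OF ls]]
  note right = tensor_map_hom[OF ls ls ls lt locale_hom_id[OF ls] comult_hom(1)]
  note assoc = tensor_assoc_hom[OF ls ls ls]
  \<comment> \<open>Both sides are arrows of locales, so comparing them on the entries is enough.\<close>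
  note h1 = locale_hom_comp[OF comult_hom(1) left(1)]
  note h2 = locale_hom_comp[OF locale_hom_comp[OF comult_hom(1) right(1)] assoc(1)]
  have "(tensor_map T L m id \<circ> m) a = (tensor_assoc L L L \<circ> (tensor_map L T id m \<circ> m)) a"
  proof (rule hom_ext_entries[OF h1 h2 _ assms])
    fix i x y assume i: "i \<in> I" and x: "x \<in> E i" and y: "y \<in> E i"
    let ?t = "\<lambda>w z. tens T L (tens L L (entry i x w) (entry i w z)) (entry i z y)"
    have tc: "tens L L (entry i u z) (entry i z v) \<in> carrier T" if "u \<in> E i" "z \<in> E i" "v \<in> E i" for u z v
      using that i by (intro LL.tens_closed entry_closed)
    have ttc: "?t w z \<in> carrier (tensor T L)" if "w \<in> E i" "z \<in> E i" for w z
      using that i x y by (intro TL.tens_closed tc entry_closed)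
    have "tensor_map T L m id (m (entry i x y)) =
        \<Squnion>\<^bsub>tensor T L\<^esub>((\<lambda>z. tensor_map T L m id (tens L L (entry i x z) (entry i z y))) ` E i)"
      unfolding comult_hom(2)[OF i x y] using tc x y by (intro locale_hom_sup_image[OF left(1)])
    also have "\<dots> = \<Squnion>\<^bsub>tensor T L\<^esub>((\<lambda>z. \<Squnion>\<^bsub>tensor T L\<^esub>((\<lambda>w. ?t w z) ` E i)) ` E i)"
    proof -
      have "tensor_map T L m id (tens L L (entry i x z) (entry i z y)) = \<Squnion>\<^bsub>tensor T L\<^esub>((\<lambda>w. ?t w z) ` E i)"
        if z: "z \<in> E i" for z
      proof -
        have "tensor_map T L m id (tens L L (entry i x z) (entry i z y)) = tens T L (m (entry i x z)) (entry i z y)"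
          using left(2) entry_closed i x y z by simp
        also have "\<dots> = \<Squnion>\<^bsub>tensor T L\<^esub>((\<lambda>w. ?t w z) ` E i)"
          using TL.tens_sup1[of "(\<lambda>w. tens L L (entry i x w) (entry i w z)) ` E i" "entry i z y"] tc entry_closed i x y z
          by (simp add: comult_hom(2)[OF i x z] image_image image_subset_iff)
        finally show ?thesis .
      qed
      then show ?thesis by simp
    qed
    also have "\<dots> = \<Squnion>\<^bsub>tensor T L\<^esub>((\<lambda>w. \<Squnion>\<^bsub>tensor T L\<^esub>((\<lambda>z. ?t w z) ` E i)) ` E i)"
      using ttc by (intro TT.sup_swap)
    also have "\<dots> = \<Squnion>\<^bsub>tensor T L\<^esub>((\<lambda>w. tensor_assoc L L L (tensor_map L T id m
        (tens L L (entry i x w) (entry i w y)))) ` E i)"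
    proof -
      have "tensor_assoc L L L (tensor_map L T id m (tens L L (entry i x w) (entry i w y))) =
          \<Squnion>\<^bsub>tensor T L\<^esub>((\<lambda>z. ?t w z) ` E i)" if w: "w \<in> E i" for w
      proof -
        have "tensor_map L T id m (tens L L (entry i x w) (entry i w y)) = tens L T (entry i x w) (m (entry i w y))"
          using right(2) entry_closed i x y w by simp
        also have "\<dots> = \<Squnion>\<^bsub>tensor L T\<^esub>((\<lambda>z. tens L T (entry i x w) (tens L L (entry i w z) (entry i z y))) ` E i)"
          using LT.tens_sup2[of "entry i x w" "(\<lambda>z. tens L L (entry i w z) (entry i z y)) ` E i"] tc entry_closed i x y w
          by (simp add: comult_hom(2)[OF i w y] image_image image_subset_iff)
        finally have "tensor_assoc L L L (tensor_map L T id m (tens L L (entry i x w) (entry i w y))) =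
          \<Squnion>\<^bsub>tensor T L\<^esub>((\<lambda>z. tensor_assoc L L L (tens L T (entry i x w) (tens L L (entry i w z) (entry i z y)))) ` E i)"
          using LT.tens_closed tc entry_closed i x y w by (simp add: locale_hom_sup_image[OF assoc(1)])
        also have "(\<lambda>z. tensor_assoc L L L (tens L T (entry i x w) (tens L L (entry i w z) (entry i z y)))) ` E i =
            (\<lambda>z. ?t w z) ` E i"
          using assoc(2) entry_closed i x y w by (intro image_cong) auto
        finally show ?thesis .
      qed
      then show ?thesis by simp
    qed
    also have "\<dots> = (tensor_assoc L L L \<circ> tensor_map L T id m) (m (entry i x y))"
      unfolding comult_hom(2)[OF i x y]
      using locale_hom_sup_image[OF locale_hom_comp[OF right(1) assoc(1)], of "E i"
          "\<lambda>w. tens L L (entry i x w) (entry i w y)"] tc x y by simp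
    finally show "(tensor_map T L m id \<circ> m) (entry i x y) =
        (tensor_assoc L L L \<circ> (tensor_map L T id m \<circ> m)) (entry i x y)" by simp
  qed
  then show ?thesis by simp
qed

text \<open>
  Two arrows into the same locale are combined by multiplying their matrices there. This
  reduces the unit and inverse laws to identities between matrix products.
\<close>

lemma copair_comult:
  fixes N (structure)
  assumes N: "localic N" and f: "locale_hom L N f" and h: "locale_hom L N h"
  shows "locale_hom L N (copair N f h \<circ> m)"
    and "i \<in> I \<Longrightarrow> x \<in> E i \<Longrightarrow> y \<in> E i \<Longrightarrow>
      copair N f h (m (entry i x y)) = \<Squnion>((\<lambda>z. f (entry i x z) \<sqinter> h (entry i z y)) ` E i)"
proof -
  note cp = LL.copair_hom[OF N f h]
  show "locale_hom L N (copair N f h \<circ> m)" by (rule locale_hom_comp[OF comult_hom(1) cp(1)])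
  assume i: "i \<in> I" and x: "x \<in> E i" and y: "y \<in> E i"
  have "copair N f h (m (entry i x y)) =
      \<Squnion>((\<lambda>z. copair N f h (tens L L (entry i x z) (entry i z y))) ` E i)"
    unfolding comult_hom(2)[OF i x y]
    using i x y by (intro locale_hom_sup_image[OF cp(1)] LL.tens_closed entry_closed)
  also have "(\<lambda>z. copair N f h (tens L L (entry i x z) (entry i z y))) ` E i =
      (\<lambda>z. f (entry i x z) \<sqinter> h (entry i z y)) ` E i"
    using cp(2) entry_closed i x y by (intro image_cong) auto
  finally show "copair N f h (m (entry i x y)) = \<Squnion>((\<lambda>z. f (entry i x z) \<sqinter> h (entry i z y)) ` E i)" .
qed

lemma counit_val:
  assumes "i \<in> I" "x \<in> E i" "y \<in> E i"
  shows "(from_two L \<circ> counit_hom) (entry i x y) = (if x = y then \<top>\<^bsub>L\<^esub> else \<bottom>\<^bsub>L\<^esub>)"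
  using counit_hom(2)[OF assms] by (simp add: from_two_def)

lemma counit_from_two: "locale_hom L L (from_two L \<circ> counit_hom)"
  by (rule locale_hom_comp[OF counit_hom(1) from_two_hom[OF localic_sheaves]])

lemma counit_left:
  assumes "a \<in> carrier L"
  shows "copair L (from_two L \<circ> counit_hom) id (m a) = a"
proof -
  note c = copair_comult[OF localic_sheaves counit_from_two locale_hom_id[OF localic_sheaves]]
  have "(copair L (from_two L \<circ> counit_hom) id \<circ> m) a = id a"
  proof (rule hom_ext_entries[OF c(1) locale_hom_id[OF localic_sheaves] _ assms])
    fix i x y assume i: "i \<in> I" and x: "x \<in> E i" and y: "y \<in> E i"
    have "(from_two L \<circ> counit_hom) (entry i x z) \<sqinter>\<^bsub>L\<^esub> id (entry i z y) = (if z = x then entry i x y else \<bottom>\<^bsub>L\<^esub>)"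
      if "z \<in> E i" for z
      using that i x y by (auto simp: counit_val entry_closed simp del: comp_apply)
    then show "(copair L (from_two L \<circ> counit_hom) id \<circ> m) (entry i x y) = id (entry i x y)"
      unfolding comp_apply[of "copair _ _ _"] c(2)[OF i x y]
      using entry_closed[OF i x y] entry_closed[OF i _ y] x
      by (intro LL.L.sup_eqI) (auto simp: image_iff simp del: comp_apply)
  qed
  then show ?thesis by simp
qed

lemma counit_right:
  assumes "a \<in> carrier L"
  shows "copair L id (from_two L \<circ> counit_hom) (m a) = a"
proof -
  note c = copair_comult[OF localic_sheaves locale_hom_id[OF localic_sheaves] counit_from_two]
  have "(copair L id (from_two L \<circ> counit_hom) \<circ> m) a = id a"
  proof (rule hom_ext_entries[OF c(1) locale_hom_id[OF localic_sheaves] _ assms])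
    fix i x y assume i: "i \<in> I" and x: "x \<in> E i" and y: "y \<in> E i"
    have "id (entry i x z) \<sqinter>\<^bsub>L\<^esub> (from_two L \<circ> counit_hom) (entry i z y) = (if z = y then entry i x y else \<bottom>\<^bsub>L\<^esub>)"
      if "z \<in> E i" for z
      using that i x y by (auto simp: counit_val entry_closed simp del: comp_apply)
    then show "(copair L id (from_two L \<circ> counit_hom) \<circ> m) (entry i x y) = id (entry i x y)"
      unfolding comp_apply[of "copair _ _ _"] c(2)[OF i x y]
      using entry_closed[OF i x y] entry_closed[OF i _ y] y
      by (intro LL.L.sup_eqI) (auto simp: image_iff simp del: comp_apply)
  qed
  then show ?thesis by simp
qed

text \<open>
  The product of a bijection matrix with its transpose is the identity matrix: off the diagonal the
  terms vanish by injectivity, on the diagonal their supremum is that of a row.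
\<close>

lemma inverse_right:
  assumes "a \<in> carrier L"
  shows "copair L id inverse_hom (m a) = from_two L (counit_hom a)"
proof -
  note c = copair_comult[OF localic_sheaves locale_hom_id[OF localic_sheaves] inverse_hom(1)]
  have "(copair L id inverse_hom \<circ> m) a = (from_two L \<circ> counit_hom) a"
  proof (rule hom_ext_entries[OF c(1) counit_from_two _ assms])
    fix i x y assume i: "i \<in> I" and x: "x \<in> E i" and y: "y \<in> E i"
    have "(copair L id inverse_hom \<circ> m) (entry i x y) = \<Squnion>\<^bsub>L\<^esub>((\<lambda>z. entry i x z \<sqinter>\<^bsub>L\<^esub> entry i y z) ` E i)"
      using inverse_hom(2) i x y by (simp add: c(2))
    also have "\<dots> = (if x = y then \<top>\<^bsub>L\<^esub> else \<bottom>\<^bsub>L\<^esub>)"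
    proof (cases "x = y")
      case True
      then show ?thesis using entry_total[OF i y] entry_closed[OF i y] by (simp add: LL.L.meet_idem)
    next
      case False
      then show ?thesis using entry_injective i x y by (auto intro!: LL.L.sup_bottoms)
    qed
    finally show "(copair L id inverse_hom \<circ> m) (entry i x y) = (from_two L \<circ> counit_hom) (entry i x y)"
      by (simp only: counit_val[OF i x y])
  qed
  then show ?thesis by simp
qed

lemma inverse_left:
  assumes "a \<in> carrier L"
  shows "copair L inverse_hom id (m a) = from_two L (counit_hom a)"
proof -
  note c = copair_comult[OF localic_sheaves inverse_hom(1) locale_hom_id[OF localic_sheaves]]
  have "(copair L inverse_hom id \<circ> m) a = (from_two L \<circ> counit_hom) a"
  proof (rule hom_ext_entries[OF c(1) counit_from_two _ assms])
    fix i x y assume i: "i \<in> I" and x: "x \<in> E i" and y: "y \<in> E i"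
    have "(copair L inverse_hom id \<circ> m) (entry i x y) = \<Squnion>\<^bsub>L\<^esub>((\<lambda>z. entry i z x \<sqinter>\<^bsub>L\<^esub> entry i z y) ` E i)"
      using inverse_hom(2) i x y by (simp add: c(2))
    also have "\<dots> = (if x = y then \<top>\<^bsub>L\<^esub> else \<bottom>\<^bsub>L\<^esub>)"
    proof (cases "x = y")
      case True
      then show ?thesis using entry_surjective[OF i y] entry_closed[OF i _ y] by (simp add: LL.L.meet_idem)
    next
      case False
      then show ?thesis using entry_functional i x y by (auto intro!: LL.L.sup_bottoms)
    qed
    finally show "(copair L inverse_hom id \<circ> m) (entry i x y) = (from_two L \<circ> counit_hom) (entry i x y)"
      by (simp only: counit_val[OF i x y])
  qed
  then show ?thesis by simp
qed

theorem localic_group: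
  fixes G :: "'d set set lgroup"
  assumes same: "same_order G L" and "comult G = m" and "counit G = counit_hom"
  shows "localic_group G"
  unfolding localic_group_def same_order_simps[OF same] assms(2,3)
  using localic_sheaves comult_hom(1) counit_hom(1) coassociative counit_left counit_right
    inverse_hom(1) inverse_right inverse_left by blast

end

section \<open>The group of a set, and the inclusion of a square\<close>

lemma aut_set_system:
  "aut_system (aut_set_site E) {()} (\<lambda>_. E) (\<lambda>_. id) (\<lambda>(x, y). x = y) prod.swap
    (aut_comult (aut_set_site E) id E)"
  by unfold_locales (auto simp: aut_set_site_def intro: exI[of _ id])

lemma lAut_set_simps:
  "same_order (lAut_set E) (sheaf_locale (aut_set_site E))"
  "comult (lAut_set E) = extend (tensor (sheaf_locale (aut_set_site E)) (sheaf_locale (aut_set_site E)))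
    (aut_comult (aut_set_site E) id E)"
  "counit (lAut_set E) = extend two (\<lambda>(x, y). x = y)"
  by (simp_all add: lAut_set_def same_order_def Let_def)

text \<open>
  The inclusion of one square \<open>E i \<times> E i\<close> among the generators is a morphism of localic groups, since
  the structure maps of both groups are given by the same matrix formulas. In the site of
  \<^term>\<open>lAut_set\<close> the only inequalities are equalities, so monotonicity holds at once.
\<close>

lemma (in aut_system) action_hom:
  fixes G :: "'d set set lgroup" and i
  defines "\<alpha> \<equiv> extend L (\<lambda>p. sharp S {c i p})"
  assumes same: "same_order G L" and mG: "comult G = m" and eG: "counit G = counit_hom"
    and i: "i \<in> I"
  shows "localic_group_hom G (lAut_set (E i)) \<alpha>"
    and "x \<in> E i \<Longrightarrow> y \<in> E i \<Longrightarrow> \<alpha> (sharp (aut_set_site (E i)) {(x, y)}) = sharp S {c i (x, y)}"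
proof -
  interpret U: aut_system "aut_set_site (E i)" "{()}" "\<lambda>_. E i" "\<lambda>_. id" "\<lambda>(x, y). x = y" prod.swap
    "aut_comult (aut_set_site (E i)) id (E i)"
    by (rule aut_set_system)
  note h = U.extend_aut[OF localic_sheaves, of "\<lambda>p. sharp S {c i p}", folded \<alpha>_def entry_def]
  have hom: "locale_hom U.L L \<alpha>"
    and val: "\<And>x y. x \<in> E i \<Longrightarrow> y \<in> E i \<Longrightarrow> \<alpha> (U.entry () x y) = entry i x y"
    using h i by (simp_all add: entry_def[symmetric] entry_closed entry_functional entry_injective entry_surjective entry_total aut_set_site_def)
  show "x \<in> E i \<Longrightarrow> y \<in> E i \<Longrightarrow> \<alpha> (sharp (aut_set_site (E i)) {(x, y)}) = sharp S {c i (x, y)}"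
    using val[of x y] by (simp add: U.entry_def entry_def)
  note mu = U.comult_hom(2)[of "()", simplified]
  note tm = tensor_map_hom[OF U.localic_sheaves U.localic_sheaves localic_sheaves localic_sheaves hom hom]
  have comult: "m (\<alpha> a) = tensor_map L L \<alpha> \<alpha> (U.m a)" if "a \<in> carrier U.L" for a
  proof -
    have "(m \<circ> \<alpha>) a = (tensor_map L L \<alpha> \<alpha> \<circ> U.m) a"
    proof (rule U.hom_ext_entries[OF locale_hom_comp[OF hom comult_hom(1)] locale_hom_comp[OF U.comult_hom(1) tm(1)] _ that])
      fix u x y assume xy: "x \<in> E i" "y \<in> E i"
      have "tensor_map L L \<alpha> \<alpha> (U.m (U.entry () x y)) =
          \<Squnion>\<^bsub>T\<^esub>((\<lambda>z. tensor_map L L \<alpha> \<alpha> (tens U.L U.L (U.entry () x z) (U.entry () z y))) ` E i)"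
        unfolding mu[OF xy] using xy
        by (intro locale_hom_sup_image[OF tm(1)] U.LL.tens_closed U.entry_closed) auto
      also have "(\<lambda>z. tensor_map L L \<alpha> \<alpha> (tens U.L U.L (U.entry () x z) (U.entry () z y))) ` E i =
          (\<lambda>z. tens L L (entry i x z) (entry i z y)) ` E i"
        using xy by (intro image_cong) (simp_all add: tm(2) U.entry_closed val)
      finally have "m (\<alpha> (U.entry () x y)) = tensor_map L L \<alpha> \<alpha> (U.m (U.entry () x y))"
        by (simp only: val[OF xy] comult_hom(2)[OF i xy])
      then show "(m \<circ> \<alpha>) (U.entry u x y) = (tensor_map L L \<alpha> \<alpha> \<circ> U.m) (U.entry u x y)"
        by (cases u) (simp only: comp_apply)
    qed
    then show ?thesis by simp
  qed
  have counit: "counit_hom (\<alpha> a) = U.counit_hom a" if "a \<in> carrier U.L" for a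
  proof -
    have "(counit_hom \<circ> \<alpha>) a = U.counit_hom a"
    proof (rule U.hom_ext_entries[OF locale_hom_comp[OF hom counit_hom(1)] U.counit_hom(1) _ that])
      fix u x y assume "x \<in> E i" "y \<in> E i"
      then show "(counit_hom \<circ> \<alpha>) (U.entry u x y) = U.counit_hom (U.entry u x y)"
        using i U.counit_hom(2)[of "()" x y] by (simp add: val counit_hom(2))
    qed
    then show ?thesis by simp
  qed
  note sameU = lAut_set_simps(1)[of "E i"]
  show "localic_group_hom G (lAut_set (E i)) \<alpha>"
    unfolding localic_group_hom_def
    using localic_group[OF same mG eG] U.localic_group[OF lAut_set_simps] hom comult counit
    unfolding mG eG lAut_set_simps(2,3) same_order_simps[OF same] same_order_simps[OF sameU] by blast
qed

section \<open>Set-valued functors and the nonvanishing of generators\<close>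

locale set_functor = category C
  for C :: "('o, 'm) cat" +
  fixes F :: "('o, 'm, 'u set, 'u fn) functr"
  assumes map_closed: "f \<in> homset C X Y \<Longrightarrow> x \<in> on_obj F X \<Longrightarrow> apply_fn (on_arr F f) x \<in> on_obj F Y"
    and map_ident: "X \<in> obj C \<Longrightarrow> x \<in> on_obj F X \<Longrightarrow> apply_fn (on_arr F (ident C X)) x = x"
    and map_comp: "f \<in> homset C X Y \<Longrightarrow> g \<in> homset C Y Z \<Longrightarrow> x \<in> on_obj F X \<Longrightarrow>
      apply_fn (on_arr F (comp C g f)) x = apply_fn (on_arr F g) (apply_fn (on_arr F f) x)"
begin

abbreviation act :: "'m \<Rightarrow> 'u \<Rightarrow> 'u" where "act f x \<equiv> apply_fn (on_arr F f) x"

lemma hom_objs: "f \<in> homset C X Y \<Longrightarrow> X \<in> obj C \<and> Y \<in> obj C"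
  using dom_obj cod_obj by (auto simp: homset_def)

lemma gens_iff: "(X, (x, y)) \<in> gens (aut_site C F) \<longleftrightarrow> X \<in> obj C \<and> x \<in> on_obj F X \<and> y \<in> on_obj F X"
  by (simp add: aut_site_def)

lemma gle_iff: "gle (aut_site C F) (X, (x, y)) (X', (x', y')) \<longleftrightarrow>
    (\<exists>f \<in> homset C X X'. act f x = x' \<and> act f y = y')"
  by (simp add: aut_site_def)

lemma aut_system: "aut_system (aut_site C F) (obj C) (on_obj F) Pair (\<lambda>(X, (x, y)). x = y)
    (\<lambda>(X, (x, y)). (X, (y, x))) (\<lambda>(X, p). aut_comult (aut_site C F) (Pair X) (on_obj F X) p)"
proof
  show "gens (aut_site C F) = (\<Union>i \<in> obj C. Pair i ` (on_obj F i \<times> on_obj F i))"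
    by (auto simp: aut_site_def)
  show "basic (aut_site C F) = (\<Union>i \<in> obj C. aut_covers (Pair i) (on_obj F i))"
    by (simp add: aut_site_def)
  show "gle (aut_site C F) d d" if "d \<in> gens (aut_site C F)" for d
  proof -
    obtain X x y where d: "d = (X, (x, y))" by (cases d)
    then show ?thesis using that ident_hom map_ident by (auto simp: gens_iff gle_iff)
  qed
  fix X Y x y x' y'
  assume "x \<in> on_obj F X" "y \<in> on_obj F X" "gle (aut_site C F) (X, (x, y)) (Y, (x', y'))"
  then obtain f where "f \<in> homset C X Y" "act f x = x'" "act f y = y'" by (auto simp: gle_iff)
  then show "\<exists>h \<in> on_obj F X \<rightarrow> on_obj F Y. h x = x' \<and> h y = y' \<and>
      (\<forall>u \<in> on_obj F X. \<forall>v \<in> on_obj F X. gle (aut_site C F) (X, (u, v)) (Y, (h u, h v)))"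
    using map_closed by (intro bexI[of _ "act f"]) (auto simp: gle_iff)
qed auto

lemma lAut_simps:
  "same_order (lAut C F) (sheaf_locale (aut_site C F))"
  "comult (lAut C F) = extend (tensor (sheaf_locale (aut_site C F)) (sheaf_locale (aut_site C F)))
    (\<lambda>(X, p). aut_comult (aut_site C F) (Pair X) (on_obj F X) p)"
  "counit (lAut C F) = extend two (\<lambda>(X, (x, y)). x = y)"
  by (simp_all add: lAut_def same_order_def Let_def)

lemma lAut_acts:
  assumes "X \<in> obj C"
  shows "action (lAut C F) (on_obj F X) (lAut_action C F X)"
    and "x \<in> on_obj F X \<Longrightarrow> y \<in> on_obj F X \<Longrightarrow>
      lAut_action C F X (sharp (aut_set_site (on_obj F X)) {(x, y)}) = sharp (aut_site C F) {(X, (x, y))}"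
proof -
  interpret A: aut_system "aut_site C F" "obj C" "on_obj F" Pair "\<lambda>(X, (x, y)). x = y"
    "\<lambda>(X, (x, y)). (X, (y, x))" "\<lambda>(X, p). aut_comult (aut_site C F) (Pair X) (on_obj F X) p"
    by (rule aut_system)
  note * = A.action_hom[OF lAut_simps assms]
  have eq: "lAut_action C F X = extend A.L (\<lambda>p. sharp (aut_site C F) {(X, p)})"
    by (simp add: lAut_action_def same_order_simps[OF lAut_simps(1)])
  show "action (lAut C F) (on_obj F X) (lAut_action C F X)"
    unfolding action_def eq by (rule *(1))
  show "x \<in> on_obj F X \<Longrightarrow> y \<in> on_obj F X \<Longrightarrow>
      lAut_action C F X (sharp (aut_set_site (on_obj F X)) {(x, y)}) = sharp (aut_site C F) {(X, (x, y))}"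
    unfolding eq by (rule *(2))
qed

lemma gle_trans:
  assumes "d \<in> gens (aut_site C F)" "gle (aut_site C F) d d'" "gle (aut_site C F) d' d''"
  shows "gle (aut_site C F) d d''"
proof -
  obtain X x y X' x' y' X'' x'' y'' where
    d: "d = (X, (x, y))" "d' = (X', (x', y'))" "d'' = (X'', (x'', y''))" by (metis surj_pair)
  obtain f g where "f \<in> homset C X X'" "act f x = x'" "act f y = y'"
    "g \<in> homset C X' X''" "act g x' = x''" "act g y' = y''"
    using assms(2,3) by (auto simp: d gle_iff)
  then show ?thesis
    using assms(1) map_comp comp_hom unfolding d gens_iff gle_iff by (intro bexI[of _ "comp C g f"]) auto
qed

text \<open>
  If \<open>F\<close> is pointwise faithful, surjective on arrows and any two of its elements have a common
  source, then the generators are nonzero. The objects with no generator below them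
  form a sheaf: a generator below a covered object can be refined to one below a member of the cover.
  For the empty covers this says that there is none at all, and pointwise faithfulness excludes it:
  two arrows agreeing at \<open>w\<close> coincide, hence agree at \<open>w'\<close>. For the covers of \<open>1\<close>, the
  generator \<open>(W, (w, w'))\<close> is refined by a common source \<open>Z\<close> of \<open>W\<close> and \<open>Y\<close> for one of the two points,
  and the other point is lifted to \<open>Z\<close> by surjectivity.
\<close>

theorem sharp_nonzero:
  assumes faithful: "\<And>X Y f g x. f \<in> homset C X Y \<Longrightarrow> g \<in> homset C X Y \<Longrightarrow> x \<in> on_obj F X \<Longrightarrow>
      act f x = act g x \<Longrightarrow> f = g"
    and surj: "\<And>X Y f y. f \<in> homset C X Y \<Longrightarrow> y \<in> on_obj F Y \<Longrightarrow> \<exists>x \<in> on_obj F X. act f x = y"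
    and span: "\<And>X Y x y. X \<in> obj C \<Longrightarrow> Y \<in> obj C \<Longrightarrow> x \<in> on_obj F X \<Longrightarrow> y \<in> on_obj F Y \<Longrightarrow>
      \<exists>Z f g z. f \<in> homset C Z X \<and> g \<in> homset C Z Y \<and> z \<in> on_obj F Z \<and> act f z = x \<and> act g z = y"
    and X: "X \<in> obj C" "x \<in> on_obj F X" "y \<in> on_obj F X"
  shows "sharp (aut_site C F) {(X, (x, y))} \<noteq> \<bottom>\<^bsub>lAut C F\<^esub>"
proof -
  let ?S = "aut_site C F"
  interpret A: aut_system ?S "obj C" "on_obj F" Pair "\<lambda>(X, (x, y)). x = y"
    "\<lambda>(X, (x, y)). (X, (y, x))" "\<lambda>(X, p). aut_comult (aut_site C F) (Pair X) (on_obj F X) p"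
    by (rule aut_system)
  define below where "below d A \<longleftrightarrow> d \<in> gens ?S \<and> (\<forall>b \<in> A. gle ?S d b)" for d A
  let ?T = "{A \<in> objs ?S. \<nexists>d. below d A}"
  \<comment> \<open>The refinement property; for an empty cover it says that no \<open>d\<close> exists.\<close>
  have dense: "\<exists>V \<in> U. \<exists>d'. below d' V \<and> gle ?S d' d"
    if UA: "(U, A) \<in> basic ?S" and d: "below d A" for U A d
  proof -
    obtain W w w' where dW: "d = (W, (w, w'))" "W \<in> obj C" "w \<in> on_obj F W" "w' \<in> on_obj F W"
      using d by (cases d) (auto simp: below_def gens_iff)
    obtain Y where Y: "Y \<in> obj C" "(U, A) \<in> aut_covers (Pair Y) (on_obj F Y)"
      using UA by (auto simp: aut_site_def)
    from Y(2) consider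
      (func) a b z where "U = {}" "A = {(Y, (z, a)), (Y, (z, b))}" "a \<noteq> b"
    | (inj) a b z where "U = {}" "A = {(Y, (a, z)), (Y, (b, z))}" "a \<noteq> b"
    | (surj) z where "U = (\<lambda>a. {(Y, (a, z))}) ` on_obj F Y" "A = {}" "z \<in> on_obj F Y"
    | (total) z where "U = (\<lambda>a. {(Y, (z, a))}) ` on_obj F Y" "A = {}" "z \<in> on_obj F Y"
      unfolding aut_covers_def by blast
    then show ?thesis
    proof cases
      case func
      then obtain f g where "f \<in> homset C W Y" "g \<in> homset C W Y" "act f w = z" "act g w = z" "act f w' = a" "act g w' = b"
        using d by (auto simp: below_def dW gle_iff)
      then show ?thesis using faithful[of f W Y g w] dW func(3) by auto
    next
      case inj
      then obtain f g where "f \<in> homset C W Y" "g \<in> homset C W Y" "act f w' = z" "act g w' = z" "act f w = a" "act g w = b"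
        using d by (auto simp: below_def dW gle_iff)
      then show ?thesis using faithful[of f W Y g w'] dW inj(3) by auto
    next
      case surj
      obtain Z f g s where s: "f \<in> homset C Z W" "g \<in> homset C Z Y" "s \<in> on_obj F Z" "act f s = w'" "act g s = z"
        using span[OF dW(2) Y(1) dW(4) surj(3)] by blast
      obtain r where r: "r \<in> on_obj F Z" "act f r = w" using assms(2)[OF s(1) dW(3)] by blast
      have "below (Z, (r, s)) {(Y, (act g r, z))} \<and> gle ?S (Z, (r, s)) d"
        using s r hom_objs[OF s(1)] by (auto simp: below_def gens_iff gle_iff dW)
      then show ?thesis using map_closed[OF s(2) r(1)] surj(1) by blast
    next
      case total
      obtain Z f g s where s: "f \<in> homset C Z W" "g \<in> homset C Z Y" "s \<in> on_obj F Z" "act f s = w" "act g s = z"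
        using span[OF dW(2) Y(1) dW(3) total(3)] by blast
      obtain r where r: "r \<in> on_obj F Z" "act f r = w'" using assms(2)[OF s(1) dW(4)] by blast
      have "below (Z, (s, r)) {(Y, (z, act g r))} \<and> gle ?S (Z, (s, r)) d"
        using s r hom_objs[OF s(1)] by (auto simp: below_def gens_iff gle_iff dW)
      then show ?thesis using map_closed[OF s(2) r(1)] total(1) by blast
    qed
  qed
  have "sheaf ?S ?T"
  proof (rule A.sheafI)
    fix A B assume A: "A \<in> ?T" and B: "B \<in> objs ?S" "obj_le ?S B A"
    have "below d A" if "below d B" for d
      using that B(2) gle_trans[of d] unfolding below_def obj_le_def by blast
    then show "B \<in> ?T" using A B(1) by blast
  next
    fix U A B assume UA: "(U, A) \<in> basic ?S" and B: "B \<in> objs ?S" and V: "\<And>V. V \<in> U \<Longrightarrow> V \<union> B \<in> ?T"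
    have "\<not> below d (A \<union> B)" for d
    proof
      assume d: "below d (A \<union> B)"
      then obtain V d' where "V \<in> U" "below d' V" "gle ?S d' d"
        using dense[OF UA, of d] by (auto simp: below_def)
      moreover from this have "below d' (V \<union> B)"
        using d gle_trans[of d' d] by (auto simp: below_def)
      ultimately show False using V by blast
    qed
    then show "A \<union> B \<in> ?T" using A.Un_objs[OF A.basic_objs[OF UA] B] by blast
  qed auto
  \<comment> \<open>The bottom element is the smallest sheaf, hence contained in \<open>?T\<close>.\<close>
  moreover have "below (X, (x, y)) {(X, (x, y))}"
    using X A.gle_self by (auto simp: below_def gens_iff)
  ultimately have "{(X, (x, y))} \<notin> \<bottom>\<^bsub>A.L\<^esub>"
    using A.frame.bottom_eq by (auto simp: sheaf_locale_def)
  moreover have "{(X, (x, y))} \<in> sharp ?S {(X, (x, y))}" by (simp add: A.sharp_eq A.frame.cl_mem)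
  ultimately show ?thesis by (auto simp: same_order_simps[OF lAut_simps(1)])
qed

end

section \<open>Prorepresentable functors\<close>

text \<open>
  A strict epimorphism \<open>q\<close> is an epimorphism: the composite \<open>f q\<close> is compatible with every pair that
  \<open>q\<close> identifies, so it factors through \<open>q\<close> in only one way.
\<close>

lemma (in category) all_strict_epi_cancel:
  assumes "\<forall>f \<in> arr C. strict_epi C f"
    and q: "q \<in> homset C D W" and f: "f \<in> homset C W X" "g \<in> homset C W X"
    and eq: "comp C f q = comp C g q"
  shows "f = g"
proof -
  have X: "X \<in> obj C" using f cod_obj by (auto simp: homset_def)
  have sq: "strict_epi C q" and d: "dom C q = D" "cod C q = W"
    using q assms(1) by (auto simp: homset_def)
  have "comp C (comp C f q) s = comp C (comp C f q) t"
    if "s \<in> homset C B D" "t \<in> homset C B D" "comp C q s = comp C q t" for B s t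
    using comp_assoc[OF that(1) q f(1)] comp_assoc[OF that(2) q f(1)] that(3) by simp
  then have "\<exists>!h. h \<in> homset C W X \<and> comp C f q = comp C h q"
    using sq[unfolded strict_epi_def d, THEN conjunct2, THEN bspec, OF X, THEN bspec, OF comp_hom[OF q f(1)]]
    by blast
  then show ?thesis using f eq by blast
qed

text \<open>
  Corestricting \<open>f\<close> to its image gives a compatible arrow, hence a map \<open>h\<close> from \<open>B\<close> to the image that
  is the identity there. Followed by the inclusion, \<open>h\<close> is an endomap of \<open>B\<close> that fixes \<open>f\<close>, and
  uniqueness makes it the identity.
\<close>

lemma strict_epi_Ens_surj:
  assumes "strict_epi Ens (A, f, B)"
  shows "f ` A = B"
proof -
  have f: "f \<in> A \<rightarrow>\<^sub>E B" using assms by (simp add: strict_epi_def Ens_def)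
  have univ: "\<exists>!h. h \<in> homset Ens B Z \<and> g = comp Ens h (A, f, B)"
    if "g \<in> homset Ens A Z"
      "\<And>D s t. s \<in> homset Ens D A \<Longrightarrow> t \<in> homset Ens D A \<Longrightarrow>
        comp Ens (A, f, B) s = comp Ens (A, f, B) t \<Longrightarrow> comp Ens g s = comp Ens g t" for g Z
  proof -
    have d: "dom Ens (A, f, B) = A" "cod Ens (A, f, B) = B" "Z \<in> obj Ens" by (simp_all add: Ens_def)
    show ?thesis
      using assms[unfolded strict_epi_def d, THEN conjunct2, THEN bspec, OF d(3), THEN bspec, OF that(1)]
        that(2) by blast
  qed
  let ?I = "f ` A"
  have "\<exists>!h. h \<in> homset Ens B ?I \<and> (A, f, ?I) = comp Ens h (A, f, B)"
    using f by (intro univ) (auto simp: Ens_def homset_def)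
  then obtain h where h: "h \<in> B \<rightarrow>\<^sub>E ?I" "f = compose A h f"
    by (auto simp: Ens_def homset_def)
  have hf: "h (f a) = f a" if "a \<in> A" for a using h(2) that by (metis compose_eq)
  have ex1: "\<exists>!h. h \<in> homset Ens B B \<and> (A, f, B) = comp Ens h (A, f, B)"
    using f by (intro univ) (auto simp: Ens_def homset_def)
  have fe: "compose A k f = f" if "\<And>a. a \<in> A \<Longrightarrow> k (f a) = f a" for k
    using f that by (auto simp: compose_def fun_eq_iff PiE_def extensional_def)
  have hB: "h \<in> B \<rightarrow>\<^sub>E B" using h(1) f by (auto simp: PiE_iff)
  then have "(B, h, B) \<in> homset Ens B B" "(A, f, B) = comp Ens (B, h, B) (A, f, B)"
    using fe[OF hf] by (simp_all add: Ens_def homset_def)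
  moreover have "(B, restrict id B, B) \<in> homset Ens B B" "(A, f, B) = comp Ens (B, restrict id B, B) (A, f, B)"
  proof -
    have "compose A (restrict id B) f = f" using f by (intro fe) (auto dest: PiE_mem)
    then show "(A, f, B) = comp Ens (B, restrict id B, B) (A, f, B)" by (simp add: Ens_def)
  qed (simp add: Ens_def homset_def)
  ultimately have "(B, h, B) = (B, restrict id B, B)" using ex1 by blast
  then have "h b = b" if "b \<in> B" for b using that by simp
  then have "B \<subseteq> f ` A" using h(1) by (metis PiE_mem subsetI)
  then show ?thesis using f by auto
qed

locale prorepresentable = category C
  for C :: "('o, 'm) cat" +
  fixes P :: "('i, 'j, 'o, 'm) pro"
  assumes pro: "pro_object C P"
begin

abbreviation J where "J \<equiv> index P"
abbreviation D where "D \<equiv> on_obj (diagram P)"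
abbreviation D_arr where "D_arr \<equiv> on_arr (diagram P)"

sublocale J: category J
  using pro by (simp add: pro_object_def cofiltered_def)

lemma cofiltered_J: "cofiltered J" and functor_D: "is_functor J C (diagram P)"
  using pro by (auto simp: pro_object_def)

lemma J_objs: "u \<in> homset J k i \<Longrightarrow> k \<in> obj J \<and> i \<in> obj J"
  using J.dom_obj J.cod_obj by (auto simp: homset_def)

lemma span_J:
  assumes "i \<in> obj J" "j \<in> obj J"
  obtains k u v where "u \<in> homset J k i" "v \<in> homset J k j"
  using cofiltered_J assms unfolding cofiltered_def by blast

lemma equalize_J:
  assumes "u \<in> homset J i j" "v \<in> homset J i j"
  obtains k w where "w \<in> homset J k i" "comp J u w = comp J v w"
  using cofiltered_J assms J_objs[OF assms(1)] unfolding cofiltered_def by blast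

lemma D_obj: "i \<in> obj J \<Longrightarrow> D i \<in> obj C"
  using functor_D by (auto simp: is_functor_def)

lemma D_hom: "u \<in> homset J i j \<Longrightarrow> D_arr u \<in> homset C (D i) (D j)"
  using functor_D J_objs unfolding is_functor_def by blast

lemma D_ident: "i \<in> obj J \<Longrightarrow> D_arr (ident J i) = ident C (D i)"
  using functor_D by (auto simp: is_functor_def)

lemma D_comp: "u \<in> homset J i j \<Longrightarrow> v \<in> homset J j k \<Longrightarrow> D_arr (comp J v u) = comp C (D_arr v) (D_arr u)"
  using functor_D J_objs unfolding is_functor_def by blast

lemma germs_iff: "(i, f) \<in> germs C P X \<longleftrightarrow> i \<in> obj J \<and> f \<in> homset C (D i) X"
  by (simp add: germs_def)

lemma germ_relI:
  assumes "(i, f) \<in> germs C P X" "(j, g) \<in> germs C P X" "u \<in> homset J k i" "v \<in> homset J k j"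
    "comp C f (D_arr u) = comp C g (D_arr v)"
  shows "((i, f), (j, g)) \<in> germ_rel C P X"
  using assms J_objs[OF assms(3)] unfolding germ_rel_def by blast

lemma germ_relE:
  assumes "((i, f), (j, g)) \<in> germ_rel C P X"
  obtains k u v where "(i, f) \<in> germs C P X" "(j, g) \<in> germs C P X"
    "u \<in> homset J k i" "v \<in> homset J k j" "comp C f (D_arr u) = comp C g (D_arr v)"
  using assms unfolding germ_rel_def by blast

text \<open>
  For transitivity two refinements must be compared over the middle index: cofilteredness provides a
  common refinement, and a further one that equalizes the two resulting arrows to that index.
\<close>

lemma germ_rel_equiv: "equiv (germs C P X) (germ_rel C P X)"
proof (rule equivI)
  show "germ_rel C P X \<subseteq> germs C P X \<times> germs C P X" by (auto simp: germ_rel_def)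
  show "refl_on (germs C P X) (germ_rel C P X)"
  proof (rule refl_onI)
    fix p assume p: "p \<in> germs C P X"
    obtain i f where "p = (i, f)" by (cases p)
    then show "(p, p) \<in> germ_rel C P X"
      using p germ_relI[of i f X i f "ident J i" i "ident J i"] J.ident_hom by (auto simp: germs_iff)
  qed
  show "sym (germ_rel C P X)"
  proof (rule symI)
    fix p q assume pq: "(p, q) \<in> germ_rel C P X"
    obtain i f j g where p: "p = (i, f)" "q = (j, g)" by (cases p, cases q)
    from pq show "(q, p) \<in> germ_rel C P X" unfolding p
      by (elim germ_relE) (rule germ_relI, assumption+, erule sym)
  qed
  show "trans (germ_rel C P X)"
  proof (rule transI)
    fix p q r assume pq: "(p, q) \<in> germ_rel C P X" and qr: "(q, r) \<in> germ_rel C P X"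
    obtain i f j g l h where p: "p = (i, f)" "q = (j, g)" "r = (l, h)" by (metis surj_pair)
    obtain k u v where 1: "(i, f) \<in> germs C P X" "(j, g) \<in> germs C P X"
      "u \<in> homset J k i" "v \<in> homset J k j" "comp C f (D_arr u) = comp C g (D_arr v)"
      using germ_relE[OF pq[unfolded p]] .
    obtain k' u' v' where 2: "(l, h) \<in> germs C P X"
      "u' \<in> homset J k' j" "v' \<in> homset J k' l" "comp C g (D_arr u') = comp C h (D_arr v')"
      using germ_relE[OF qr[unfolded p]] by metis
    obtain n a b where ab: "a \<in> homset J n k" "b \<in> homset J n k'"
      using span_J J_objs[OF 1(3)] J_objs[OF 2(2)] by metis
    obtain n' w where w: "w \<in> homset J n' n" "comp J (comp J v a) w = comp J (comp J u' b) w"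
      using equalize_J[OF J.comp_hom[OF ab(1) 1(4)] J.comp_hom[OF ab(2) 2(2)]] .
    let ?a = "comp J a w" and ?b = "comp J b w"
    have a: "?a \<in> homset J n' k" and b: "?b \<in> homset J n' k'" using ab w J.comp_hom by auto
    have eq: "comp J v ?a = comp J u' ?b"
      using w(2) J.comp_assoc[OF w(1) ab(1) 1(4)] J.comp_assoc[OF w(1) ab(2) 2(2)] by simp
    have f: "f \<in> homset C (D i) X" "g \<in> homset C (D j) X" "h \<in> homset C (D l) X"
      using 1 2 by (auto simp: germs_iff)
    have "comp C f (D_arr (comp J u ?a)) = comp C (comp C f (D_arr u)) (D_arr ?a)"
      using comp_assoc[OF D_hom[OF a] D_hom[OF 1(3)] f(1)] by (simp add: D_comp[OF a 1(3)])
    also have "\<dots> = comp C g (D_arr (comp J v ?a))"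
      using comp_assoc[OF D_hom[OF a] D_hom[OF 1(4)] f(2)] by (simp add: D_comp[OF a 1(4)] 1(5))
    also have "\<dots> = comp C (comp C g (D_arr u')) (D_arr ?b)"
      using comp_assoc[OF D_hom[OF b] D_hom[OF 2(2)] f(2)] by (simp add: D_comp[OF b 2(2)] eq)
    also have "\<dots> = comp C h (D_arr (comp J v' ?b))"
      using comp_assoc[OF D_hom[OF b] D_hom[OF 2(3)] f(3)] by (simp add: D_comp[OF b 2(3)] 2(4))
    finally show "(p, r) \<in> germ_rel C P X" unfolding p
      by (intro germ_relI[OF 1(1) 2(1) J.comp_hom[OF a 1(3)] J.comp_hom[OF b 2(3)]])
  qed
qed

definition germ :: "'o \<Rightarrow> 'i \<Rightarrow> 'm \<Rightarrow> ('i \<times> 'm) set" where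
  "germ X i f = germ_rel C P X `` {(i, f)}"

lemma germ_mem: "i \<in> obj J \<Longrightarrow> f \<in> homset C (D i) X \<Longrightarrow> germ X i f \<in> pro_hom C P X"
  unfolding germ_def pro_hom_def by (intro quotientI) (simp add: germs_iff)

lemma germ_cases:
  assumes "x \<in> pro_hom C P X"
  obtains i f where "i \<in> obj J" "f \<in> homset C (D i) X" "x = germ X i f"
  using assms unfolding pro_hom_def germ_def by (auto elim!: quotientE simp: germs_iff)

lemma germ_eq_iff:
  assumes "i \<in> obj J" "f \<in> homset C (D i) X" "j \<in> obj J" "g \<in> homset C (D j) X"
  shows "germ X i f = germ X j g \<longleftrightarrow> ((i, f), (j, g)) \<in> germ_rel C P X"
  unfolding germ_def using assms by (intro eq_equiv_class_iff[OF germ_rel_equiv]) (auto simp: germs_iff)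

lemma map_germ:
  assumes f: "f \<in> homset C X Y" and i: "i \<in> obj J" and a: "a \<in> homset C (D i) X"
  shows "pro_hom_map C P f (germ X i a) = germ Y i (comp C f a)"
proof -
  have "germ_rel C P Y `` {(j, comp C f b)} = germ Y i (comp C f a)" if jb: "(j, b) \<in> germ X i a" for j b
  proof -
    have "((i, a), (j, b)) \<in> germ_rel C P X" using jb by (simp add: germ_def)
    then obtain k u v where k: "(j, b) \<in> germs C P X" "u \<in> homset J k i" "v \<in> homset J k j"
      "comp C a (D_arr u) = comp C b (D_arr v)" by (elim germ_relE)
    have b: "b \<in> homset C (D j) X" and j: "j \<in> obj J" using k(1) by (auto simp: germs_iff)
    have "((i, comp C f a), (j, comp C f b)) \<in> germ_rel C P Y"
      using k(4) comp_assoc[OF D_hom[OF k(2)] a f] comp_assoc[OF D_hom[OF k(3)] b f] i j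
      by (intro germ_relI[OF _ _ k(2,3)]) (auto simp: germs_iff intro: comp_hom[OF a f] comp_hom[OF b f])
    then show ?thesis
      using germ_eq_iff[OF i comp_hom[OF a f] j comp_hom[OF b f]] by (simp add: germ_def)
  qed
  moreover have "(i, a) \<in> germ X i a"
    using equiv_class_self[OF germ_rel_equiv] i a by (simp add: germ_def germs_iff)
  ultimately have "(\<Union>(j, b) \<in> germ X i a. germ_rel C P Y `` {(j, comp C f b)}) = germ Y i (comp C f a)"
    by blast
  moreover have "dom C f = X" "cod C f = Y" using f by (auto simp: homset_def)
  ultimately show ?thesis using germ_mem[OF i a] by (simp add: pro_hom_map_def)
qed

abbreviation F where "F \<equiv> hom_functor C P"

lemma F_obj: "on_obj F X = pro_hom C P X" and F_arr: "apply_fn (on_arr F f) = pro_hom_map C P f"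
  by (simp_all add: hom_functor_def apply_fn_def fun_eq_iff)

sublocale F: set_functor C F
proof
  fix X Y f x assume f: "f \<in> homset C X Y" and "x \<in> on_obj F X"
  then obtain i a where i: "i \<in> obj J" "a \<in> homset C (D i) X" "x = germ X i a"
    by (auto simp: F_obj elim: germ_cases)
  show "apply_fn (on_arr F f) x \<in> on_obj F Y"
    using f i map_germ germ_mem comp_hom by (simp add: F_obj F_arr)
next
  fix X x assume X: "X \<in> obj C" and "x \<in> on_obj F X"
  then obtain i a where i: "i \<in> obj J" "a \<in> homset C (D i) X" "x = germ X i a"
    by (auto simp: F_obj elim: germ_cases)
  show "apply_fn (on_arr F (ident C X)) x = x"
    using i map_germ[OF ident_hom[OF X]] comp_ident_left by (simp add: F_arr)
next
  fix X Y Z f g x assume f: "f \<in> homset C X Y" and g: "g \<in> homset C Y Z" and "x \<in> on_obj F X"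
  then obtain i a where i: "i \<in> obj J" "a \<in> homset C (D i) X" "x = germ X i a"
    by (auto simp: F_obj elim: germ_cases)
  show "apply_fn (on_arr F (comp C g f)) x = apply_fn (on_arr F g) (apply_fn (on_arr F f) x)"
    using i f g map_germ comp_hom comp_assoc by (simp add: F_arr)
qed

text \<open>
  If \<open>x\<close> is represented by \<open>a : D i \<rightarrow> X\<close>, then \<open>f a\<close> and \<open>g a\<close> agree after restriction along two arrows
  of the index category, and, after equalizing these, along one. Hence \<open>f\<close> and \<open>g\<close> agree after
  composition with a single arrow, which is an epimorphism.
\<close>

lemma F_faithful:
  assumes epi: "\<forall>f \<in> arr C. strict_epi C f"
    and f: "f \<in> homset C X Y" "g \<in> homset C X Y" and "x \<in> on_obj F X" "F.act f x = F.act g x"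
  shows "f = g"
proof -
  obtain i a where i: "i \<in> obj J" "a \<in> homset C (D i) X" "x = germ X i a"
    using assms(4) by (auto simp: F_obj elim: germ_cases)
  have "((i, comp C f a), (i, comp C g a)) \<in> germ_rel C P Y"
    using assms(5) i f map_germ germ_eq_iff[OF i(1) comp_hom[OF i(2) f(1)] i(1) comp_hom[OF i(2) f(2)]]
    by (simp add: F_arr)
  then obtain k u v where k: "u \<in> homset J k i" "v \<in> homset J k i"
    "comp C (comp C f a) (D_arr u) = comp C (comp C g a) (D_arr v)" by (elim germ_relE)
  obtain n w where w: "w \<in> homset J n k" "comp J u w = comp J v w" using equalize_J[OF k(1,2)] .
  let ?q = "comp C a (D_arr (comp J u w))"
  have q: "?q \<in> homset C (D n) X" using i(2) D_hom[OF J.comp_hom[OF w(1) k(1)]] by (intro comp_hom)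
  have "comp C h ?q = comp C (comp C (comp C h a) (D_arr u)) (D_arr w)" if h: "h \<in> homset C X Y" for h
    using comp_assoc[OF D_hom[OF J.comp_hom[OF w(1) k(1)]] i(2) h]
      comp_assoc[OF D_hom[OF w(1)] D_hom[OF k(1)] comp_hom[OF i(2) h]] D_comp[OF w(1) k(1)] by simp
  moreover have "comp C h ?q = comp C (comp C (comp C h a) (D_arr v)) (D_arr w)"
    if h: "h \<in> homset C X Y" for h
    using comp_assoc[OF D_hom[OF J.comp_hom[OF w(1) k(2)]] i(2) h]
      comp_assoc[OF D_hom[OF w(1)] D_hom[OF k(2)] comp_hom[OF i(2) h]] D_comp[OF w(1) k(2)] w(2) by simp
  ultimately have "comp C f ?q = comp C g ?q" using k(3) f by simp
  then show ?thesis by (rule all_strict_epi_cancel[OF epi q f])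
qed

text \<open>
  The common source is \<open>D k\<close> for an index \<open>k\<close> dominating those of \<open>x\<close> and \<open>y\<close>, with the germ of its
  identity as the element mapped to both.
\<close>

lemma F_span:
  assumes "x \<in> on_obj F X" "y \<in> on_obj F Y"
  shows "\<exists>Z f g z. f \<in> homset C Z X \<and> g \<in> homset C Z Y \<and> z \<in> on_obj F Z \<and> F.act f z = x \<and> F.act g z = y"
proof -
  obtain i a where i: "i \<in> obj J" "a \<in> homset C (D i) X" "x = germ X i a"
    using assms(1) by (auto simp: F_obj elim: germ_cases)
  obtain j b where j: "j \<in> obj J" "b \<in> homset C (D j) Y" "y = germ Y j b"
    using assms(2) by (auto simp: F_obj elim: germ_cases)
  obtain k u v where k: "u \<in> homset J k i" "v \<in> homset J k j" using span_J[OF i(1) j(1)] .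
  have kJ: "k \<in> obj J" using J_objs[OF k(1)] by simp
  have restrict: "F.act (comp C c (D_arr w)) (germ (D k) k (ident C (D k))) = germ Z l c"
    if w: "w \<in> homset J k l" and c: "c \<in> homset C (D l) Z" for w l c Z
  proof -
    have lJ: "l \<in> obj J" using J_objs[OF w] by simp
    have cw: "comp C c (D_arr w) \<in> homset C (D k) Z" using comp_hom[OF D_hom[OF w] c] .
    have "((k, comp C c (D_arr w)), (l, c)) \<in> germ_rel C P Z"
      using cw c kJ lJ J.ident_hom[OF kJ] w comp_ident_right[OF cw]
      by (intro germ_relI[of _ _ _ _ _ "ident J k" k w]) (auto simp: germs_iff D_ident)
    then have "germ Z k (comp C c (D_arr w)) = germ Z l c" using germ_eq_iff[OF kJ cw lJ c] by simp
    then show ?thesis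
      using map_germ[OF cw kJ ident_hom[OF D_obj[OF kJ]]] comp_ident_right[OF cw] by (simp add: F_arr)
  qed
  have "germ (D k) k (ident C (D k)) \<in> on_obj F (D k)"
    using germ_mem[OF kJ ident_hom[OF D_obj[OF kJ]]] by (simp add: F_obj)
  then show ?thesis
    using restrict[OF k(1) i(2)] restrict[OF k(2) j(2)] comp_hom[OF D_hom[OF k(1)] i(2)]
      comp_hom[OF D_hom[OF k(2)] j(2)] i(3) j(3) by blast
qed

lemma F_surj:
  assumes "\<forall>f \<in> arr C. strict_epi C f" "preserves_strict_epis C Ens F"
    and f: "f \<in> homset C X Y" and "y \<in> on_obj F Y"
  shows "\<exists>x \<in> on_obj F X. F.act f x = y"
proof -
  have "f \<in> arr C" "dom C f = X" "cod C f = Y" using f by (auto simp: homset_def)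
  then have "strict_epi Ens (pro_hom C P X, pro_hom_map C P f, pro_hom C P Y)"
    using assms(1,2) by (force simp: preserves_strict_epis_def hom_functor_def)
  then have "pro_hom_map C P f ` pro_hom C P X = pro_hom C P Y" by (rule strict_epi_Ens_surj)
  moreover have "y \<in> pro_hom C P Y" using assms(4) by (simp add: F_obj)
  ultimately have "y \<in> pro_hom_map C P f ` pro_hom C P X" by simp
  then obtain x where "y = pro_hom_map C P f x" "x \<in> pro_hom C P X" by (rule imageE)
  then show ?thesis by (intro bexI[of _ x]) (simp_all add: F_obj F_arr)
qed

end

lemma opposite_opposite: "opposite (opposite G) = G"
  by (simp add: opposite_def)

theorem theorem2p2:
  fixes C :: "('o, 'm) cat"
    and P :: "('i, 'j, 'o, 'm) pro"
    and F :: "('o, 'm, ('i \<times> 'm) set set, ('i \<times> 'm) set fn) functr"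
  assumes "category C"
    and "pro_object C P"
    and "F = hom_functor C P"
    and "\<forall>f \<in> arr C. strict_epi C f"
    and "\<forall>X \<in> obj C. on_obj F X \<noteq> {}"
    and "preserves_strict_epis C Ens F"
  shows "opposite (lAut_pro C P) = lAut C F \<and>
    (\<forall>X \<in> obj C.
      transitive_action (lAut C F) (on_obj F X) (lAut_action C F X) \<and>
      (\<forall>x0 \<in> on_obj F X. \<forall>x1 \<in> on_obj F X.
        sharp (aut_site C F) {(X, (x0, x1))} \<noteq> \<bottom>\<^bsub>lAut C F\<^esub>))"
proof -
  interpret prorepresentable C P
    using assms(1,2) by (simp add: prorepresentable_def prorepresentable_axioms_def)
  have nonzero: "sharp (aut_site C F) {(X, (x0, x1))} \<noteq> \<bottom>\<^bsub>lAut C F\<^esub>"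
    if "X \<in> obj C" "x0 \<in> on_obj F X" "x1 \<in> on_obj F X" for X x0 x1
    unfolding assms(3)
  proof (rule F.sharp_nonzero)
    show "X \<in> obj C" "x0 \<in> on_obj (hom_functor C P) X" "x1 \<in> on_obj (hom_functor C P) X"
      using that assms(3) by simp_all
    fix X Y f g x y
    show "f \<in> homset C X Y \<Longrightarrow> g \<in> homset C X Y \<Longrightarrow> x \<in> on_obj (hom_functor C P) X \<Longrightarrow>
        F.act f x = F.act g x \<Longrightarrow> f = g"
      by (rule F_faithful[OF assms(4)])
    show "f \<in> homset C X Y \<Longrightarrow> y \<in> on_obj (hom_functor C P) Y \<Longrightarrow>
        \<exists>x \<in> on_obj (hom_functor C P) X. F.act f x = y"
      by (rule F_surj[OF assms(4) assms(6)[unfolded assms(3)]])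
    show "x \<in> on_obj (hom_functor C P) X \<Longrightarrow> y \<in> on_obj (hom_functor C P) Y \<Longrightarrow>
        \<exists>Z f g z. f \<in> homset C Z X \<and> g \<in> homset C Z Y \<and> z \<in> on_obj (hom_functor C P) Z \<and>
          F.act f z = x \<and> F.act g z = y"
      by (rule F_span)
  qed
  have "transitive_action (lAut C F) (on_obj F X) (lAut_action C F X)" if "X \<in> obj C" for X
    using that nonzero F.lAut_acts[OF that] by (simp add: transitive_action_def assms(3))
  moreover have "opposite (lAut_pro C P) = lAut C F"
    by (simp add: lAut_pro_def assms(3) opposite_opposite)
  ultimately show ?thesis using nonzero by blast
qed

end
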